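(* Let $\mathfrak g$ be a complex semisimple Lie algebra with a nondegenerate symmetric invariant bilinear form $\langle\cdot,\cdot\rangle$ whose restriction to a compact real form of $\mathfrak g$ is positive definite. Let $G=\mathrm{Int}\,\mathfrak g$ (the group of inner automorphisms, i.e. the connected adjoint group), equipped with the Sklyanin Poisson–Lie bracket described in the context, and let $\bar G$ be the group of all automorphisms $g:\mathfrak g\to\mathfrak g$ preserving $\langle\cdot,\cdot\rangle$. For regular functions $\phi,\psi$ on $\bar G$ put $$\{\phi,\psi\}=-r^{\mu\nu}_{alt}\,(\partial'_\mu\phi-\partial_\mu\phi)(\partial'_\nu\psi-\partial_\nu\psi)+r^{\mu\nu}_{sym}\,(\partial'_\mu\phi-\partial_\mu\phi)(\partial'_\nu\psi+\partial_\nu\psi),\qquad( * )$$ with $r$, $\partial_\mu$, $\partial'_\mu$ as in the context, and let $X$ be the manifold $\bar G$ equipped with the bracket $( * )$. Then the bracket $( * )$ is a Poisson bracket, the action of $G$ on $X$ by conjugations is Poisson, and the orbits of this action are Poisson homogeneous $G$-spaces such that the Lagrangian subalgebra $$\mathfrak l_g=\{(x,y)\in\mathfrak g\times\mathfrak g\mid x=g(y)\}\subset\mathfrak g\times\mathfrak g$$ corresponds to the point $g\in X$ (for every $g\in X$).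
   Context: The element $r$ and the vector fields. Fix a Cartan subalgebra $\mathfrak h\subset\mathfrak g$, the root system of $\mathfrak g$ with respect to $\mathfrak h$, and a set $\mathbf R_+$ of positive roots. Put $\mathfrak n_\pm=\bigoplus_{\alpha\in\mathbf R_+}\mathfrak g_{\pm\alpha}$, $\mathfrak b_\pm=\mathfrak h\oplus\mathfrak n_\pm$. Let $t\in\mathfrak g\otimes\mathfrak g$ be the tensor corresponding to $\langle\cdot,\cdot\rangle$ ($t=\sum_i u_i\otimes u^i$ for dual bases), decomposed as $t=t_0+t_1+t_2$ with $t_0\in\mathfrak h\otimes\mathfrak h$, $t_1\in\mathfrak n_+\otimes\mathfrak n_-$, $t_2\in\mathfrak n_-\otimes\mathfrak n_+$. Put $r=\tfrac12t_0+t_1=r_{sym}+r_{alt}$ with $r_{sym}$ symmetric and $r_{alt}$ skew-symmetric. Let $r^{\mu\nu}$, $r_{sym}^{\mu\nu}$, $r_{alt}^{\mu\nu}$ be components in a basis $\{e_\mu\}$ of $\mathfrak g$ (summation over repeated indices). $\partial_\mu$ (resp. $\partial'_\mu$) is the right-invariant (resp. left-invariant) vector field corresponding to $e_\mu$, on $G$ or on $\bar G$ (both have Lie algebra $\mathfrak g$). Poisson–Lie structure on $G$: $\{\phi,\psi\}=r^{\mu\nu}(\partial'_\mu\phi\,\partial'_\nu\psi-\partial_\mu\phi\,\partial_\nu\psi)$ (Sklyanin bracket). The corresponding Lie bialgebra structure on $\mathfrak g$ is given by the Manin triple $(\mathfrak g\times\mathfrak g,\mathfrak g_{diag},\mathfrak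 m)$, where $\mathfrak g\times\mathfrak g$ (the double $D(\mathfrak g)$) carries the scalar product $\langle(x_1,y_1),(x_2,y_2)\rangle=\langle x_1,x_2\rangle-\langle y_1,y_2\rangle$, $\mathfrak g_{diag}\simeq\mathfrak g$ is the diagonal, and $\mathfrak m=\{(x,y)\in\mathfrak b_-\times\mathfrak b_+\mid x_{\mathfrak h}+y_{\mathfrak h}=0\}$, with $x_{\mathfrak h},y_{\mathfrak h}$ the images in $\mathfrak h$; $\mathfrak m$ is identified with $\mathfrak g^*$ by this scalar product, so $D(\mathfrak g)=\mathfrak g\oplus\mathfrak g^*$. A Lagrangian subalgebra of $D(\mathfrak g)$ is a Lie subalgebra that is a maximal isotropic subspace. Poisson actions and homogeneous spaces. An action of a Poisson–Lie group $G$ on a Poisson manifold $M$ is Poisson if the action map $G\times M\to M$ is Poisson. A Poisson homogeneous $G$-space is a Poisson manifold with a transitive Poisson $G$-action; here the orbits in $X$ carry the Poisson structure restricted from $X$. The Lagrangian subalgebra corresponding to a point $m$ of a Poisson homogeneous $G$-space $M$ (Drinfeld's correspondence) is defined as follows: let $\mathfrak h_m\subset\mathfrak g$ be the Lie algebra of the stabilizer of $m$, identify $T_mM$ with $\mathfrak g/\mathfrak h_m$ via $a\mapsto\frac{d}{ds}\big|_{s=0}\exp(sa)\cdot m$, and hence $T^*_mM$ with $\mathfrak h_m^\perp\subset\mathfrak g^*$. Let $\pi$ be the Poisson bivector of $M$, $\{\phi,\psi\}=\langle\pi,d\phi\otimes d\psi\rangle$. The subalgebra is $$\{a+\lambda\mid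 a\in\mathfrak g,\ \lambda\in\mathfrak h_m^\perp\subset\mathfrak g^*,\ (\lambda\otimes\mathrm{id})(\pi(m))=a\bmod\mathfrak h_m\}\subset\mathfrak g\oplus\mathfrak g^*=D(\mathfrak g).$$ *)

theory Defs
  imports "HOL-Analysis.Analysis"
begin

text \<open>
  The Lie algebra is the whole type \<open>'g\<close>.  The basis \<open>lie_basis\<close> is the basis
  \<open>e\<^sub>\<mu>\<close> in which components of tensors are taken; the class puts no condition on it
  beyond being a finite basis, so statements about the class hold for every choice of basis.
\<close>

class complex_lie_algebra = ab_group_add +
  fixes scaleC :: "complex \<Rightarrow> 'a \<Rightarrow> 'a"  (infixr \<open>*\<^sub>C\<close> 75)
    and lie_basis :: "'a set"
    and lie :: "'a \<Rightarrow> 'a \<Rightarrow> 'a"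
  assumes scaleC_add_right: "scaleC c (x + y) = scaleC c x + scaleC c y"
    and scaleC_add_left: "scaleC (c + d) x = scaleC c x + scaleC d x"
    and scaleC_scaleC: "scaleC c (scaleC d x) = scaleC (c * d) x"
    and scaleC_one: "scaleC 1 x = x"
    and finite_lie_basis: "finite lie_basis"
    and lie_basis: "\<exists>!c. (\<forall>\<mu>. \<mu> \<notin> lie_basis \<longrightarrow> c \<mu> = 0) \<and> x = sum (\<lambda>\<mu>. scaleC (c \<mu>) \<mu>) lie_basis"
    and lie_add_left: "lie (x + y) z = lie x z + lie y z"
    and lie_add_right: "lie x (y + z) = lie x y + lie x z"
    and lie_scale_left: "lie (scaleC c x) y = scaleC c (lie x y)"
    and lie_scale_right: "lie x (scaleC c y) = scaleC c (lie x y)"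
    and lie_self: "lie x x = 0"
    and lie_jacobi: "lie x (lie y z) + lie y (lie z x) + lie z (lie x y) = 0"

global_interpretation cvs:
  finite_dimensional_vector_space "scaleC :: complex \<Rightarrow> 'g \<Rightarrow> 'g::complex_lie_algebra" lie_basis
proof -
  interpret V: vector_space "scaleC :: complex \<Rightarrow> 'g \<Rightarrow> 'g"
    by standard (simp_all add: scaleC_add_right scaleC_add_left scaleC_scaleC scaleC_one)
  show "finite_dimensional_vector_space (scaleC :: complex \<Rightarrow> 'g \<Rightarrow> 'g) lie_basis"
  proof
    show "finite (lie_basis :: 'g set)" by (rule finite_lie_basis)
    show "V.independent (lie_basis :: 'g set)"
    proof (rule V.independent_if_scalars_zero[OF finite_lie_basis])
      fix f :: "'g \<Rightarrow> complex" and e :: 'g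
      assume f: "(\<Sum>x\<in>lie_basis. f x *\<^sub>C x) = 0" and e: "e \<in> lie_basis"
      let ?c = "\<lambda>x. if x \<in> lie_basis then f x else 0"
      define P where "P c \<longleftrightarrow> (\<forall>\<mu>. \<mu> \<notin> lie_basis \<longrightarrow> c \<mu> = 0) \<and>
        0 = (\<Sum>\<mu>\<in>lie_basis. c \<mu> *\<^sub>C (\<mu>::'g))" for c :: "'g \<Rightarrow> complex"
      have ex1: "\<exists>!c. P c" unfolding P_def by (rule lie_basis)
      have "P ?c" unfolding P_def using f by simp
      moreover have "P (\<lambda>_. 0)" unfolding P_def by simp
      ultimately have "?c = (\<lambda>_. 0)" using ex1 by blast
      then have "?c e = 0" by (rule fun_cong)
      then show "f e = 0" using e by simp
    qed
    show "V.span (lie_basis :: 'g set) = UNIV"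
    proof (intro set_eqI iffI UNIV_I)
      fix x :: 'g
      obtain c where "x = (\<Sum>\<mu>\<in>lie_basis. c \<mu> *\<^sub>C \<mu>)"
        using lie_basis[of x] by auto
      then show "x \<in> V.span lie_basis"
        by (simp add: V.span_sum V.span_scale V.span_base)
    qed
  qed
qed

abbreviation endomorphism :: "('g::complex_lie_algebra \<Rightarrow> 'g) \<Rightarrow> bool" where
  "endomorphism f \<equiv> Vector_Spaces.linear scaleC scaleC f"

abbreviation functional :: "('g::complex_lie_algebra \<Rightarrow> complex) \<Rightarrow> bool" where
  "functional \<xi> \<equiv> Vector_Spaces.linear scaleC (*) \<xi>"

definition coord :: "'g::complex_lie_algebra \<Rightarrow> 'g \<Rightarrow> complex" where
  "coord \<mu> x = cvs.representation lie_basis x \<mu>"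

definition trace_end :: "('g::complex_lie_algebra \<Rightarrow> 'g) \<Rightarrow> complex" where
  "trace_end f = (\<Sum>\<mu>\<in>lie_basis. coord \<mu> (f \<mu>))"

definition killing :: "'g::complex_lie_algebra \<Rightarrow> 'g \<Rightarrow> complex" where
  "killing x y = trace_end (\<lambda>z. lie x (lie y z))"

definition lie_ideal :: "'g::complex_lie_algebra set \<Rightarrow> bool" where
  "lie_ideal I \<longleftrightarrow> cvs.subspace I \<and> (\<forall>x. \<forall>y\<in>I. lie x y \<in> I)"

definition derived_algebra :: "'g::complex_lie_algebra set \<Rightarrow> 'g set" where
  "derived_algebra S = cvs.span {lie x y | x y. x \<in> S \<and> y \<in> S}"

definition solvable :: "'g::complex_lie_algebra set \<Rightarrow> bool" where
  "solvable S \<longleftrightarrow> (\<exists>n. (derived_algebra ^^ n) S = {0})"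

definition semisimple :: "'g::complex_lie_algebra itself \<Rightarrow> bool" where
  "semisimple _ \<longleftrightarrow> (\<forall>I :: 'g set. lie_ideal I \<and> solvable I \<longrightarrow> I = {0})"

definition invariant_form :: "('g::complex_lie_algebra \<Rightarrow> 'g \<Rightarrow> complex) \<Rightarrow> bool" where
  "invariant_form B \<longleftrightarrow>
     (\<forall>x. functional (B x)) \<and>
     (\<forall>x y. B x y = B y x) \<and>
     (\<forall>x y z. B (lie x y) z = B x (lie y z))"

definition nondegenerate_form :: "('g::complex_lie_algebra \<Rightarrow> 'g \<Rightarrow> complex) \<Rightarrow> bool" where
  "nondegenerate_form B \<longleftrightarrow> (\<forall>x. (\<forall>y. B x y = 0) \<longrightarrow> x = 0)"

definition real_form :: "'g::complex_lie_algebra set \<Rightarrow> bool" where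
  "real_form K \<longleftrightarrow>
     0 \<in> K \<and> (\<forall>x\<in>K. \<forall>y\<in>K. x + y \<in> K) \<and>
     (\<forall>c::real. \<forall>x\<in>K. complex_of_real c *\<^sub>C x \<in> K) \<and>
     (\<forall>x\<in>K. \<forall>y\<in>K. lie x y \<in> K) \<and>
     (\<forall>x. \<exists>!p. p \<in> K \<times> K \<and> x = fst p + \<i> *\<^sub>C snd p)"

text \<open>A real semisimple Lie algebra is compact iff its Killing form is negative definite; the
  Killing form of a real form is the restriction of the complex one.\<close>

definition compact_real_form :: "'g::complex_lie_algebra set \<Rightarrow> bool" where
  "compact_real_form K \<longleftrightarrow> real_form K \<and>
     (\<forall>x\<in>K. x \<noteq> 0 \<longrightarrow> killing x x \<in> \<real> \<and> Re (killing x x) < 0)"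

definition positive_definite_on :: "'g::complex_lie_algebra set \<Rightarrow> ('g \<Rightarrow> 'g \<Rightarrow> complex) \<Rightarrow> bool" where
  "positive_definite_on K B \<longleftrightarrow>
     (\<forall>x\<in>K. \<forall>y\<in>K. B x y \<in> \<real>) \<and> (\<forall>x\<in>K. x \<noteq> 0 \<longrightarrow> Re (B x x) > 0)"

text \<open>A Cartan subalgebra of a complex semisimple Lie algebra: maximal commutative, acting by
  diagonalizable operators.\<close>

definition cartan_subalgebra :: "'g::complex_lie_algebra set \<Rightarrow> bool" where
  "cartan_subalgebra H \<longleftrightarrow>
     cvs.subspace H \<and>
     (\<forall>x\<in>H. \<forall>y\<in>H. lie x y = 0) \<and>
     (\<forall>x. (\<forall>h\<in>H. lie h x = 0) \<longrightarrow> x \<in> H) \<and>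
     (\<forall>h\<in>H. cvs.span {x. \<exists>c. lie h x = c *\<^sub>C x} = UNIV)"

text \<open>An element of the dual of the subspace \<open>H\<close> is encoded as a function on \<open>'g\<close> that is
  linear on \<open>H\<close> and zero outside \<open>H\<close>; this keeps sums and negatives in the encoding.\<close>

definition dual_of :: "'g::complex_lie_algebra set \<Rightarrow> ('g \<Rightarrow> complex) set" where
  "dual_of H = {\<alpha>. (\<forall>x. x \<notin> H \<longrightarrow> \<alpha> x = 0) \<and>
     (\<forall>x\<in>H. \<forall>y\<in>H. \<alpha> (x + y) = \<alpha> x + \<alpha> y) \<and> (\<forall>c. \<forall>x\<in>H. \<alpha> (c *\<^sub>C x) = c * \<alpha> x)}"

definition root_space :: "'g::complex_lie_algebra set \<Rightarrow> ('g \<Rightarrow> complex) \<Rightarrow> 'g set" where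
  "root_space H \<alpha> = {x. \<forall>h\<in>H. lie h x = \<alpha> h *\<^sub>C x}"

definition roots :: "'g::complex_lie_algebra set \<Rightarrow> ('g \<Rightarrow> complex) set" where
  "roots H = {\<alpha> \<in> dual_of H. \<alpha> \<noteq> (\<lambda>_. 0) \<and> root_space H \<alpha> \<noteq> {0}}"

definition neg_root :: "('g \<Rightarrow> complex) \<Rightarrow> 'g \<Rightarrow> complex" where
  "neg_root \<alpha> = (\<lambda>h. - \<alpha> h)"

definition positive_roots :: "'g::complex_lie_algebra set \<Rightarrow> ('g \<Rightarrow> complex) set \<Rightarrow> bool" where
  "positive_roots H R \<longleftrightarrow>
     R \<subseteq> roots H \<and>
     (\<forall>\<alpha>\<in>roots H. (\<alpha> \<in> R) \<noteq> (neg_root \<alpha> \<in> R)) \<and>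
     (\<forall>\<alpha>\<in>R. \<forall>\<beta>\<in>R. (\<lambda>h. \<alpha> h + \<beta> h) \<in> roots H \<longrightarrow> (\<lambda>h. \<alpha> h + \<beta> h) \<in> R)"

definition n_plus :: "'g::complex_lie_algebra set \<Rightarrow> ('g \<Rightarrow> complex) set \<Rightarrow> 'g set" where
  "n_plus H R = cvs.span (\<Union>\<alpha>\<in>R. root_space H \<alpha>)"

definition n_minus :: "'g::complex_lie_algebra set \<Rightarrow> ('g \<Rightarrow> complex) set \<Rightarrow> 'g set" where
  "n_minus H R = cvs.span (\<Union>\<alpha>\<in>R. root_space H (neg_root \<alpha>))"

definition b_plus :: "'g::complex_lie_algebra set \<Rightarrow> ('g \<Rightarrow> complex) set \<Rightarrow> 'g set" where
  "b_plus H R = {h + n | h n. h \<in> H \<and> n \<in> n_plus H R}"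

definition b_minus :: "'g::complex_lie_algebra set \<Rightarrow> ('g \<Rightarrow> complex) set \<Rightarrow> 'g set" where
  "b_minus H R = {h + n | h n. h \<in> H \<and> n \<in> n_minus H R}"

text \<open>The image in \<open>H\<close> of \<open>x \<in> H \<oplus> N\<close>.\<close>

definition cartan_part :: "'g::complex_lie_algebra set \<Rightarrow> 'g set \<Rightarrow> 'g \<Rightarrow> 'g" where
  "cartan_part H N x = (THE h. h \<in> H \<and> x - h \<in> N)"

text \<open>
  An element \<open>T\<close> of the tensor square of \<open>'g\<close> is represented by its components
  \<open>T \<mu> \<nu>\<close> in \<open>lie_basis\<close>; components at indices outside the basis are zero.
\<close>

type_synonym 'g tensor = "'g \<Rightarrow> 'g \<Rightarrow> complex"

definition tensor :: "'g::complex_lie_algebra \<Rightarrow> 'g \<Rightarrow> 'g tensor" where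
  "tensor u v = (\<lambda>\<mu> \<nu>. coord \<mu> u * coord \<nu> v)"

definition tensor_space :: "'g::complex_lie_algebra set \<Rightarrow> 'g set \<Rightarrow> 'g tensor set" where
  "tensor_space A B = {T. \<exists>n u v. (\<forall>i<(n::nat). u i \<in> A \<and> v i \<in> B) \<and>
     T = (\<lambda>\<mu> \<nu>. \<Sum>i<n. tensor (u i) (v i) \<mu> \<nu>)}"

text \<open>\<open>pairing T \<xi> \<eta>\<close> is \<open>\<langle>T, \<xi> \<otimes> \<eta>\<rangle>\<close> and \<open>contract \<xi> T\<close> is \<open>(\<xi> \<otimes> id)(T)\<close>.\<close>

definition pairing ::
  "'g::complex_lie_algebra tensor \<Rightarrow> ('g \<Rightarrow> complex) \<Rightarrow> ('g \<Rightarrow> complex) \<Rightarrow> complex" where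
  "pairing T \<xi> \<eta> = (\<Sum>\<mu>\<in>lie_basis. \<Sum>\<nu>\<in>lie_basis. T \<mu> \<nu> * \<xi> \<mu> * \<eta> \<nu>)"

definition contract :: "('g::complex_lie_algebra \<Rightarrow> complex) \<Rightarrow> 'g tensor \<Rightarrow> 'g" where
  "contract \<xi> T = (\<Sum>\<mu>\<in>lie_basis. \<Sum>\<nu>\<in>lie_basis. (T \<mu> \<nu> * \<xi> \<mu>) *\<^sub>C \<nu>)"

definition dual_vector :: "('g::complex_lie_algebra \<Rightarrow> 'g \<Rightarrow> complex) \<Rightarrow> 'g \<Rightarrow> 'g" where
  "dual_vector B \<mu> = (THE u. \<forall>\<nu>\<in>lie_basis. B \<nu> u = (if \<nu> = \<mu> then 1 else 0))"

definition form_tensor :: "('g::complex_lie_algebra \<Rightarrow> 'g \<Rightarrow> complex) \<Rightarrow> 'g tensor" where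
  "form_tensor B = (\<lambda>\<mu> \<nu>. \<Sum>e\<in>lie_basis. tensor e (dual_vector B e) \<mu> \<nu>)"

definition sym_part :: "'g tensor \<Rightarrow> 'g tensor" where
  "sym_part r = (\<lambda>\<mu> \<nu>. (r \<mu> \<nu> + r \<nu> \<mu>) / 2)"

definition alt_part :: "'g tensor \<Rightarrow> 'g tensor" where
  "alt_part r = (\<lambda>\<mu> \<nu>. (r \<mu> \<nu> - r \<nu> \<mu>) / 2)"

text \<open>The exponential series of an endomorphism.  Since \<open>'g\<close> carries no topology, convergence
  is tested on all linear functionals.\<close>

definition exp_end :: "('g::complex_lie_algebra \<Rightarrow> 'g) \<Rightarrow> 'g \<Rightarrow> 'g" where
  "exp_end f x = (THE y. \<forall>\<xi>. functional \<xi> \<longrightarrow> (\<lambda>n. \<xi> ((f ^^ n) x) / fact n) sums \<xi> y)"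

definition Exp :: "'g::complex_lie_algebra \<Rightarrow> 'g \<Rightarrow> 'g" where
  "Exp a = exp_end (lie a)"

text \<open>Closure under inverses is automatic, \<open>Exp (- a)\<close> being inverse to \<open>Exp a\<close>.\<close>

inductive_set Int_group :: "('g::complex_lie_algebra \<Rightarrow> 'g) set" where
  id: "id \<in> Int_group"
| exp: "h \<in> Int_group \<Longrightarrow> Exp a \<circ> h \<in> Int_group"

definition Aut_form :: "('g::complex_lie_algebra \<Rightarrow> 'g \<Rightarrow> complex) \<Rightarrow> ('g \<Rightarrow> 'g) set" where
  "Aut_form B = {g. endomorphism g \<and> bij g \<and>
     (\<forall>x y. g (lie x y) = lie (g x) (g y)) \<and> (\<forall>x y. B (g x) (g y) = B x y)}"

text \<open>Throughout, the values of a function outside the space on which it lives are irrelevant;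
  all identities between functions are required only on that space.\<close>

inductive_set poly_functions :: "(('g::complex_lie_algebra \<Rightarrow> 'g) \<Rightarrow> complex) set" where
  const: "(\<lambda>_. c) \<in> poly_functions"
| coeff: "functional \<xi> \<Longrightarrow> (\<lambda>g. \<xi> (g x)) \<in> poly_functions"
| add: "p \<in> poly_functions \<Longrightarrow> q \<in> poly_functions \<Longrightarrow> (\<lambda>g. p g + q g) \<in> poly_functions"
| mult: "p \<in> poly_functions \<Longrightarrow> q \<in> poly_functions \<Longrightarrow> (\<lambda>g. p g * q g) \<in> poly_functions"

definition restrictions :: "('m \<Rightarrow> complex) set \<Rightarrow> 'm set \<Rightarrow> ('m \<Rightarrow> complex) set" where
  "restrictions A S = {\<phi>. \<exists>\<psi>\<in>A. \<forall>m\<in>S. \<phi> m = \<psi> m}"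

text \<open>Both groups below are Zariski closed in the space of endomorphisms (their elements have
  determinant \<open>\<plusminus>1\<close>), so their regular functions are the restrictions of polynomials.\<close>

definition regular :: "('g::complex_lie_algebra \<Rightarrow> 'g) set \<Rightarrow> (('g \<Rightarrow> 'g) \<Rightarrow> complex) set" where
  "regular S = restrictions poly_functions S"

definition right_inv_field ::
  "'g::complex_lie_algebra \<Rightarrow> (('g \<Rightarrow> 'g) \<Rightarrow> complex) \<Rightarrow> ('g \<Rightarrow> 'g) \<Rightarrow> complex" where
  "right_inv_field a \<phi> g = deriv (\<lambda>s. \<phi> (Exp (s *\<^sub>C a) \<circ> g)) 0"

definition left_inv_field ::
  "'g::complex_lie_algebra \<Rightarrow> (('g \<Rightarrow> 'g) \<Rightarrow> complex) \<Rightarrow> ('g \<Rightarrow> 'g) \<Rightarrow> complex" where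
  "left_inv_field a \<phi> g = deriv (\<lambda>s. \<phi> (g \<circ> Exp (s *\<^sub>C a))) 0"

type_synonym 'm bracket = "('m \<Rightarrow> complex) \<Rightarrow> ('m \<Rightarrow> complex) \<Rightarrow> 'm \<Rightarrow> complex"

definition sklyanin_bracket :: "'g::complex_lie_algebra tensor \<Rightarrow> ('g \<Rightarrow> 'g) bracket" where
  "sklyanin_bracket r \<phi> \<psi> g =
     (\<Sum>\<mu>\<in>lie_basis. \<Sum>\<nu>\<in>lie_basis. r \<mu> \<nu> *
        (left_inv_field \<mu> \<phi> g * left_inv_field \<nu> \<psi> g
         - right_inv_field \<mu> \<phi> g * right_inv_field \<nu> \<psi> g))"

definition X_bracket :: "'g::complex_lie_algebra tensor \<Rightarrow> ('g \<Rightarrow> 'g) bracket" where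
  "X_bracket r \<phi> \<psi> g =
     - (\<Sum>\<mu>\<in>lie_basis. \<Sum>\<nu>\<in>lie_basis. alt_part r \<mu> \<nu> *
          (left_inv_field \<mu> \<phi> g - right_inv_field \<mu> \<phi> g) *
          (left_inv_field \<nu> \<psi> g - right_inv_field \<nu> \<psi> g))
     + (\<Sum>\<mu>\<in>lie_basis. \<Sum>\<nu>\<in>lie_basis. sym_part r \<mu> \<nu> *
          (left_inv_field \<mu> \<phi> g - right_inv_field \<mu> \<phi> g) *
          (left_inv_field \<nu> \<psi> g + right_inv_field \<nu> \<psi> g))"

definition conjugation :: "('g \<Rightarrow> 'g) \<Rightarrow> ('g \<Rightarrow> 'g) \<Rightarrow> ('g \<Rightarrow> 'g)" where
  "conjugation h g = h \<circ> g \<circ> inv h"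

definition function_algebra :: "('m \<Rightarrow> complex) set \<Rightarrow> bool" where
  "function_algebra A \<longleftrightarrow> (\<forall>c. (\<lambda>_. c) \<in> A) \<and>
     (\<forall>\<phi>\<in>A. \<forall>\<psi>\<in>A. (\<lambda>m. \<phi> m + \<psi> m) \<in> A \<and> (\<lambda>m. \<phi> m * \<psi> m) \<in> A)"

text \<open>\<open>P\<close> is a Poisson bracket on the algebra \<open>A\<close> of functions on \<open>M\<close>.  The second condition
  says that \<open>P\<close> depends only on values on \<open>M\<close>.\<close>

definition poisson_bracket :: "'m set \<Rightarrow> ('m \<Rightarrow> complex) set \<Rightarrow> 'm bracket \<Rightarrow> bool" where
  "poisson_bracket M A P \<longleftrightarrow>
     function_algebra A \<and>
     (\<forall>\<phi>\<in>A. \<forall>\<psi>\<in>A. P \<phi> \<psi> \<in> A) \<and>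
     (\<forall>\<phi>\<in>A. \<forall>\<phi>'\<in>A. \<forall>\<psi>\<in>A. (\<forall>m\<in>M. \<phi> m = \<phi>' m) \<longrightarrow> (\<forall>m\<in>M. P \<phi> \<psi> m = P \<phi>' \<psi> m)) \<and>
     (\<forall>\<phi>\<in>A. \<forall>\<psi>\<in>A. \<forall>\<theta>\<in>A. \<forall>c. \<forall>m\<in>M.
        P (\<lambda>x. c * \<phi> x + \<psi> x) \<theta> m = c * P \<phi> \<theta> m + P \<psi> \<theta> m) \<and>
     (\<forall>\<phi>\<in>A. \<forall>\<psi>\<in>A. \<forall>m\<in>M. P \<phi> \<psi> m = - P \<psi> \<phi> m) \<and>
     (\<forall>\<phi>\<in>A. \<forall>\<psi>\<in>A. \<forall>\<theta>\<in>A. \<forall>m\<in>M.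
        P \<phi> (\<lambda>x. \<psi> x * \<theta> x) m = P \<phi> \<psi> m * \<theta> m + \<psi> m * P \<phi> \<theta> m) \<and>
     (\<forall>\<phi>\<in>A. \<forall>\<psi>\<in>A. \<forall>\<theta>\<in>A. \<forall>m\<in>M.
        P \<phi> (P \<psi> \<theta>) m + P \<psi> (P \<theta> \<phi>) m + P \<theta> (P \<phi> \<psi>) m = 0)"

text \<open>The tensor product of the two function algebras.\<close>

definition product_functions ::
  "'m set \<Rightarrow> 'n set \<Rightarrow> ('m \<Rightarrow> complex) set \<Rightarrow> ('n \<Rightarrow> complex) set \<Rightarrow> ('m \<times> 'n \<Rightarrow> complex) set" where
  "product_functions M N A B = {\<Phi>. \<exists>n \<phi> \<psi>. (\<forall>i<(n::nat). \<phi> i \<in> A \<and> \<psi> i \<in> B) \<and>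
     (\<forall>x\<in>M. \<forall>y\<in>N. \<Phi> (x, y) = (\<Sum>i<n. \<phi> i x * \<psi> i y))}"

definition product_bracket :: "'m bracket \<Rightarrow> 'n bracket \<Rightarrow> ('m \<times> 'n) bracket" where
  "product_bracket P Q \<Phi> \<Psi> = (\<lambda>(x, y).
     P (\<lambda>x'. \<Phi> (x', y)) (\<lambda>x'. \<Psi> (x', y)) x + Q (\<lambda>y'. \<Phi> (x, y')) (\<lambda>y'. \<Psi> (x, y')) y)"

definition poisson_map ::
  "'m set \<Rightarrow> ('m \<Rightarrow> complex) set \<Rightarrow> 'm bracket \<Rightarrow>
   'n set \<Rightarrow> ('n \<Rightarrow> complex) set \<Rightarrow> 'n bracket \<Rightarrow> ('m \<Rightarrow> 'n) \<Rightarrow> bool" where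
  "poisson_map M A P N B Q f \<longleftrightarrow>
     f ` M \<subseteq> N \<and> (\<forall>\<phi>\<in>B. \<phi> \<circ> f \<in> A) \<and>
     (\<forall>\<phi>\<in>B. \<forall>\<psi>\<in>B. \<forall>m\<in>M. P (\<phi> \<circ> f) (\<psi> \<circ> f) m = Q \<phi> \<psi> (f m))"

definition action :: "('g \<Rightarrow> 'g) set \<Rightarrow> 'm set \<Rightarrow> (('g \<Rightarrow> 'g) \<Rightarrow> 'm \<Rightarrow> 'm) \<Rightarrow> bool" where
  "action G M act \<longleftrightarrow>
     (\<forall>h\<in>G. \<forall>m\<in>M. act h m \<in> M) \<and> (\<forall>m\<in>M. act id m = m) \<and>
     (\<forall>h\<in>G. \<forall>k\<in>G. \<forall>m\<in>M. act (h \<circ> k) m = act h (act k m))"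

text \<open>The acting Poisson-Lie group is always \<^const>\<open>Int_group\<close> with the Sklyanin bracket of \<open>r\<close>.\<close>

definition poisson_action ::
  "'g::complex_lie_algebra tensor \<Rightarrow>
   'm set \<Rightarrow> ('m \<Rightarrow> complex) set \<Rightarrow> 'm bracket \<Rightarrow> (('g \<Rightarrow> 'g) \<Rightarrow> 'm \<Rightarrow> 'm) \<Rightarrow> bool" where
  "poisson_action r M A P act \<longleftrightarrow>
     action Int_group M act \<and>
     poisson_map (Int_group \<times> M)
       (product_functions Int_group M (regular Int_group) A)
       (product_bracket (sklyanin_bracket r) P)
       M A P (\<lambda>(h, m). act h m)"

definition stabilizer_algebra ::
  "(('g::complex_lie_algebra \<Rightarrow> 'g) \<Rightarrow> 'm \<Rightarrow> 'm) \<Rightarrow> 'm \<Rightarrow> 'g set" where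
  "stabilizer_algebra act m = {a. \<forall>s. act (Exp (s *\<^sub>C a)) m = m}"

definition annihilator :: "'g::complex_lie_algebra set \<Rightarrow> ('g \<Rightarrow> complex) set" where
  "annihilator S = {\<xi>. functional \<xi> \<and> (\<forall>x\<in>S. \<xi> x = 0)}"

text \<open>The differential at \<open>m\<close> of a function on a homogeneous space, as an element of the
  annihilator of the stabilizer algebra.\<close>

definition differential ::
  "(('g::complex_lie_algebra \<Rightarrow> 'g) \<Rightarrow> 'm \<Rightarrow> 'm) \<Rightarrow> ('m \<Rightarrow> complex) \<Rightarrow> 'm \<Rightarrow> 'g \<Rightarrow> complex" where
  "differential act \<phi> m a = deriv (\<lambda>s. \<phi> (act (Exp (s *\<^sub>C a)) m)) 0"

text \<open>\<open>T\<close> represents the bivector at \<open>m\<close>, i.e. its image in the tensor square of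
  \<open>T\<^sub>mM = 'g / stabilizer_algebra act m\<close> is the bivector.\<close>

definition represents_bivector ::
  "(('g::complex_lie_algebra \<Rightarrow> 'g) \<Rightarrow> 'm \<Rightarrow> 'm) \<Rightarrow> ('m \<Rightarrow> complex) set \<Rightarrow> 'm bracket \<Rightarrow>
   'm \<Rightarrow> 'g tensor \<Rightarrow> bool" where
  "represents_bivector act A P m T \<longleftrightarrow> T \<in> tensor_space UNIV UNIV \<and>
     (\<forall>\<phi>\<in>A. \<forall>\<psi>\<in>A. P \<phi> \<psi> m = pairing T (differential act \<phi> m) (differential act \<psi> m))"

text \<open>The manifold \<open>M\<close> is given by an algebra \<open>A\<close> of functions on it, which must be rich enough
  for their differentials to fill the cotangent spaces; the Poisson structure must come from a
  bivector at every point.\<close>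

definition poisson_homogeneous_space ::
  "'g::complex_lie_algebra tensor \<Rightarrow>
   'm set \<Rightarrow> ('m \<Rightarrow> complex) set \<Rightarrow> 'm bracket \<Rightarrow> (('g \<Rightarrow> 'g) \<Rightarrow> 'm \<Rightarrow> 'm) \<Rightarrow> bool" where
  "poisson_homogeneous_space r M A P act \<longleftrightarrow>
     poisson_bracket M A P \<and>
     (\<forall>m\<in>M. {differential act \<phi> m | \<phi>. \<phi> \<in> A} = annihilator (stabilizer_algebra act m)) \<and>
     (\<forall>m\<in>M. \<exists>T. represents_bivector act A P m T) \<and>
     poisson_action r M A P act \<and>
     M \<noteq> {} \<and> (\<forall>m\<in>M. \<forall>m'\<in>M. \<exists>h\<in>Int_group. act h m = m')"

text \<open>The Poisson structure on \<open>M\<close> restricts to \<open>S\<close> when the bracket on \<open>S\<close> of functions on \<open>M\<close>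
  depends only on their values on \<open>S\<close>; the restricted bracket is then computed with
  arbitrary extensions.\<close>

definition bracket_restricts :: "('m \<Rightarrow> complex) set \<Rightarrow> 'm bracket \<Rightarrow> 'm set \<Rightarrow> bool" where
  "bracket_restricts A P S \<longleftrightarrow>
     (\<forall>\<phi>\<in>A. \<forall>\<phi>'\<in>A. \<forall>\<psi>\<in>A. \<forall>\<psi>'\<in>A.
        (\<forall>m\<in>S. \<phi> m = \<phi>' m) \<and> (\<forall>m\<in>S. \<psi> m = \<psi>' m) \<longrightarrow> (\<forall>m\<in>S. P \<phi> \<psi> m = P \<phi>' \<psi>' m))"

definition restricted_bracket :: "('m \<Rightarrow> complex) set \<Rightarrow> 'm bracket \<Rightarrow> 'm set \<Rightarrow> 'm bracket" where
  "restricted_bracket A P S \<phi> \<psi> =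
     P (SOME \<phi>'. \<phi>' \<in> A \<and> (\<forall>m\<in>S. \<phi>' m = \<phi> m)) (SOME \<psi>'. \<psi>' \<in> A \<and> (\<forall>m\<in>S. \<psi>' m = \<psi> m))"

definition scale_pair :: "complex \<Rightarrow> 'g \<times> 'g \<Rightarrow> 'g::complex_lie_algebra \<times> 'g" where
  "scale_pair c z = (c *\<^sub>C fst z, c *\<^sub>C snd z)"

definition lie_pair :: "'g \<times> 'g \<Rightarrow> 'g \<times> 'g \<Rightarrow> 'g::complex_lie_algebra \<times> 'g" where
  "lie_pair z w = (lie (fst z) (fst w), lie (snd z) (snd w))"

definition double_form ::
  "('g::complex_lie_algebra \<Rightarrow> 'g \<Rightarrow> complex) \<Rightarrow> 'g \<times> 'g \<Rightarrow> 'g \<times> 'g \<Rightarrow> complex" where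
  "double_form B z w = B (fst z) (fst w) - B (snd z) (snd w)"

definition isotropic_subspace ::
  "('g::complex_lie_algebra \<Rightarrow> 'g \<Rightarrow> complex) \<Rightarrow> ('g \<times> 'g) set \<Rightarrow> bool" where
  "isotropic_subspace B L \<longleftrightarrow>
     module.subspace scale_pair L \<and> (\<forall>z\<in>L. \<forall>w\<in>L. double_form B z w = 0)"

definition lagrangian_subalgebra ::
  "('g::complex_lie_algebra \<Rightarrow> 'g \<Rightarrow> complex) \<Rightarrow> ('g \<times> 'g) set \<Rightarrow> bool" where
  "lagrangian_subalgebra B L \<longleftrightarrow>
     isotropic_subspace B L \<and>
     (\<forall>L'. isotropic_subspace B L' \<and> L \<subseteq> L' \<longrightarrow> L' = L) \<and>
     (\<forall>z\<in>L. \<forall>w\<in>L. lie_pair z w \<in> L)"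

definition manin_m :: "'g::complex_lie_algebra set \<Rightarrow> ('g \<Rightarrow> complex) set \<Rightarrow> ('g \<times> 'g) set" where
  "manin_m H R = {(x, y). x \<in> b_minus H R \<and> y \<in> b_plus H R \<and>
     cartan_part H (n_minus H R) x + cartan_part H (n_plus H R) y = 0}"

text \<open>The functional on \<open>'g\<close> (embedded diagonally) which an element of \<^const>\<open>manin_m\<close> represents.\<close>

definition functional_of ::
  "('g::complex_lie_algebra \<Rightarrow> 'g \<Rightarrow> complex) \<Rightarrow> 'g \<times> 'g \<Rightarrow> 'g \<Rightarrow> complex" where
  "functional_of B z = (\<lambda>a. double_form B z (a, a))"

text \<open>The choice of the representative \<open>T\<close> of the bivector does not matter, as its contraction
  is taken modulo the stabilizer algebra.\<close>

definition drinfeld_subalgebra ::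
  "('g::complex_lie_algebra \<Rightarrow> 'g \<Rightarrow> complex) \<Rightarrow> 'g set \<Rightarrow> ('g \<Rightarrow> complex) set \<Rightarrow>
   ('m \<Rightarrow> complex) set \<Rightarrow> 'm bracket \<Rightarrow> (('g \<Rightarrow> 'g) \<Rightarrow> 'm \<Rightarrow> 'm) \<Rightarrow> 'm \<Rightarrow> ('g \<times> 'g) set" where
  "drinfeld_subalgebra B H R A P act m =
     (let T = (SOME T. represents_bivector act A P m T) in
      {(a, a) + z | a z. z \<in> manin_m H R \<and>
         functional_of B z \<in> annihilator (stabilizer_algebra act m) \<and>
         contract (functional_of B z) T - a \<in> stabilizer_algebra act m})"

definition graph_subalgebra :: "('g \<Rightarrow> 'g) \<Rightarrow> ('g \<times> 'g) set" where
  "graph_subalgebra g = {(x, y). x = g y}"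

definition conj_orbit :: "('g::complex_lie_algebra \<Rightarrow> 'g) \<Rightarrow> ('g \<Rightarrow> 'g) set" where
  "conj_orbit g = {conjugation h g | h. h \<in> Int_group}"

end

theory Submission
  imports Defs
begin

text \<open>
  Vector fields on the group combine to a Lie algebra action \<open>\<rho>\<close> of \<open>\<gg> \<times> \<gg>\<close>,
  \<open>\<rho>(x, y) = \<partial>'\<^sub>y - \<partial>\<^sub>x\<close>.  At \<open>g\<close> the elements of the graph \<open>\<ll>\<^sub>g\<close> act by zero, so
  \<open>\<rho>(z) \<phi> = \<langle>d\<phi>, z\<rangle>\<close> for some \<open>d\<phi>\<close> in the Lagrangian subalgebra \<open>\<ll>\<^sub>g\<close>.  In these terms the
  bracket (*) is \<open>{\<phi>, \<psi>}(g) = - \<langle>m(d\<phi>), d\<psi>\<rangle>\<close>, where \<open>m\<close> is the projection to \<open>\<mm>\<close> along the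
  diagonal.  Skew symmetry expresses that \<open>\<ll>\<^sub>g\<close> is isotropic, and the Jacobiator of
  \<open>\<phi>\<close>, \<open>\<psi>\<close>, \<open>\<theta>\<close> turns out to be \<open>- \<langle>d\<phi>, [d\<psi>, d\<theta>]\<rangle>\<close>, which vanishes since \<open>\<ll>\<^sub>g\<close> is an isotropic
  subalgebra.  In the Poisson property of the conjugation action only the skew part of \<open>r\<close>
  matters, the symmetric part being invariant.  Finally, \<open>z \<in> \<mm>\<close> representing \<open>d\<phi>\<close> on the diagonal acts at
  \<open>g\<close> as the Hamiltonian field of \<open>\<phi>\<close>, so \<open>a + z\<close> belongs to Drinfeld's subalgebra iff
  \<open>\<rho>(a + z)\<close> vanishes at \<open>g\<close>, i.e. iff \<open>a + z \<in> \<ll>\<^sub>g\<close>.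
\<close>

subsection \<open>Linear algebra\<close>

text \<open>The Jacobi identity needs second derivatives, and the group carries no manifold
  structure here. Functions on it are therefore represented by polynomials on the space of all maps:
  there \<open>rho\<close> can be iterated and the bracket of polynomials is again a polynomial,
  while skew symmetry and Jacobi are proved only at points of \<open>Aut_form B\<close>. The
  projections m(d\<phi>) vary with the point, but Leibniz' rule lets them be frozen at the point
  under consideration; the second-order terms then combine into commutators, because a full gradient
  acts there by zero. The rows and columns of r form a basis of the complement dual to the diagonal;
  the factor 1/2 at \<open>t0\<close> is what puts them into it. Two existence questions remain at a
  point m. Enough functions exist because the form turns triviality of the centre into surjectivity
  of differentials. The bivector, given only modulo the stabilizer, is lifted to a tensor by a
  generalized inverse of 1 - \<open>inv m\<close>. The bracket descends to conjugacy classes because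
  one argument enters through fields tangent to them, and skew symmetry covers the other.\<close>

lemma vector_space_times: "vector_space ((*) :: complex \<Rightarrow> complex \<Rightarrow> complex)"
  by standard (simp_all add: algebra_simps)

lemma vector_space_pair_functional:
  "vector_space_pair (scaleC :: complex \<Rightarrow> 'g \<Rightarrow> 'g::complex_lie_algebra) ((*) :: complex \<Rightarrow> complex \<Rightarrow> complex)"
  unfolding vector_space_pair_def
  using vector_space_times cvs.vector_space_axioms by blast

lemma vector_space_pair_endomorphism:
  "vector_space_pair (scaleC :: complex \<Rightarrow> 'g \<Rightarrow> 'g::complex_lie_algebra) (scaleC :: complex \<Rightarrow> 'g \<Rightarrow> 'g)"
  unfolding vector_space_pair_def
  using cvs.vector_space_axioms by blast

lemma functional_iff:
  "functional \<xi> \<longleftrightarrow> (\<forall>x y. \<xi> (x + y) = \<xi> x + \<xi> y) \<and> (\<forall>c x. \<xi> (c *\<^sub>C x) = c * \<xi> x)"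
  unfolding Vector_Spaces.linear_iff using cvs.vector_space_axioms vector_space_times by blast

lemma endomorphism_iff:
  "endomorphism f \<longleftrightarrow> (\<forall>x y. f (x + y) = f x + f y) \<and> (\<forall>c x. f (c *\<^sub>C x) = c *\<^sub>C f x)"
  unfolding Vector_Spaces.linear_iff using cvs.vector_space_axioms by blast

lemma functionalI:
  "(\<And>x y. \<xi> (x + y) = \<xi> x + \<xi> y) \<Longrightarrow> (\<And>c x. \<xi> (c *\<^sub>C x) = c * \<xi> x) \<Longrightarrow> functional \<xi>"
  by (simp add: functional_iff)

lemma endomorphismI:
  "(\<And>x y. f (x + y) = f x + f y) \<Longrightarrow> (\<And>c x. f (c *\<^sub>C x) = c *\<^sub>C f x) \<Longrightarrow> endomorphism f"
  by (simp add: endomorphism_iff)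

lemma
  assumes "functional \<xi>"
  shows functional_add: "\<xi> (x + y) = \<xi> x + \<xi> y"
    and functional_scale: "\<xi> (c *\<^sub>C x) = c * \<xi> x"
    and functional_0: "\<xi> 0 = 0"
    and functional_neg: "\<xi> (- x) = - \<xi> x"
    and functional_diff: "\<xi> (x - y) = \<xi> x - \<xi> y"
proof -
  show *: "\<xi> (x + y) = \<xi> x + \<xi> y" "\<xi> (c *\<^sub>C x) = c * \<xi> x" for x y c
    using assms by (auto simp: functional_iff)
  show 0: "\<xi> 0 = 0" using *(1)[of 0 0] by simp
  show **: "\<xi> (- x) = - \<xi> x" for x using *(1)[of x "- x"] 0 by (simp add: eq_neg_iff_add_eq_0 add.commute)
  show "\<xi> (x - y) = \<xi> x - \<xi> y" using *(1)[of x "- y"] **[of y] by simp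
qed

lemma functional_sum: "functional \<xi> \<Longrightarrow> \<xi> (\<Sum>i\<in>I. f i) = (\<Sum>i\<in>I. \<xi> (f i))"
  by (induction I rule: infinite_finite_induct) (simp_all add: functional_0 functional_add)

lemma
  assumes "endomorphism f"
  shows endomorphism_add: "f (x + y) = f x + f y"
    and endomorphism_scale: "f (c *\<^sub>C x) = c *\<^sub>C f x"
    and endomorphism_0: "f 0 = 0"
    and endomorphism_neg: "f (- x) = - f x"
    and endomorphism_diff: "f (x - y) = f x - f y"
proof -
  show *: "f (x + y) = f x + f y" "f (c *\<^sub>C x) = c *\<^sub>C f x" for x y c
    using assms by (auto simp: endomorphism_iff)
  show 0: "f 0 = 0" using *(1)[of 0 0] by simp
  show **: "f (- x) = - f x" for x using *(1)[of x "- x"] 0 by (simp add: eq_neg_iff_add_eq_0 add.commute)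
  show "f (x - y) = f x - f y" using *(1)[of x "- y"] **[of y] by simp
qed

lemma endomorphism_sum: "endomorphism f \<Longrightarrow> f (\<Sum>i\<in>I. h i) = (\<Sum>i\<in>I. f (h i))"
  by (induction I rule: infinite_finite_induct) (simp_all add: endomorphism_0 endomorphism_add)

lemma functional_comp: "functional \<xi> \<Longrightarrow> endomorphism f \<Longrightarrow> functional (\<lambda>x. \<xi> (f x))"
  by (simp add: functional_iff endomorphism_iff)

lemma endomorphism_funpow: "endomorphism f \<Longrightarrow> endomorphism (f ^^ n)"
  by (induction n) (auto simp: endomorphism_iff)

lemma endomorphism_lie: "endomorphism (lie a)"
  by (simp add: endomorphism_iff lie_add_right lie_scale_right)

lemma endomorphism_lie_left: "endomorphism (\<lambda>a. lie a x)"
  by (simp add: endomorphism_iff lie_add_left lie_scale_left)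

lemmas lie_0_right [simp] = endomorphism_0[OF endomorphism_lie]
  and lie_neg_right = endomorphism_neg[OF endomorphism_lie]
  and lie_diff_right = endomorphism_diff[OF endomorphism_lie]
  and lie_0_left [simp] = endomorphism_0[OF endomorphism_lie_left]
  and lie_neg_left = endomorphism_neg[OF endomorphism_lie_left]
  and lie_diff_left = endomorphism_diff[OF endomorphism_lie_left]

lemma lie_skew: "lie x y = - lie y x"
proof -
  have "lie (x + y) (x + y) = (lie x x + lie y x) + (lie x y + lie y y)"
    unfolding lie_add_left lie_add_right ..
  then have "lie x y + lie y x = 0" by (simp add: lie_self add.commute)
  then show ?thesis by (simp add: eq_neg_iff_add_eq_0)
qed

lemma lie_lie: "lie (lie x y) z = lie x (lie y z) - lie y (lie x z)"
  using lie_jacobi[of x y z] lie_skew[of z "lie x y"] lie_skew[of z x] lie_neg_right[of y "lie x z"]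
  by (simp add: algebra_simps)

lemma coord_add: "coord \<mu> (x + y) = coord \<mu> x + coord \<mu> y"
  unfolding coord_def
  by (subst cvs.representation_add) (simp_all add: cvs.independent_Basis cvs.span_Basis)

lemma coord_scale: "coord \<mu> (c *\<^sub>C x) = c * coord \<mu> x"
  unfolding coord_def
  by (subst cvs.representation_scale) (simp_all add: cvs.independent_Basis cvs.span_Basis)

lemma functional_coord: "functional (coord \<mu>)"
  by (simp add: functional_iff coord_add coord_scale)

lemma coord_basis: "\<mu> \<in> lie_basis \<Longrightarrow> coord \<nu> \<mu> = (if \<nu> = \<mu> then 1 else 0)"
  unfolding coord_def by (subst cvs.representation_basis) (simp_all add: cvs.independent_Basis)

lemma sum_coord: "(\<Sum>\<mu>\<in>lie_basis. coord \<mu> x *\<^sub>C \<mu>) = x"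
  unfolding coord_def
  by (rule cvs.sum_representation_eq)
    (simp_all add: cvs.independent_Basis cvs.span_Basis finite_lie_basis)

lemma functional_expand: "functional \<xi> \<Longrightarrow> \<xi> x = (\<Sum>\<mu>\<in>lie_basis. coord \<mu> x * \<xi> \<mu>)"
proof -
  assume "functional \<xi>"
  then have "\<xi> (\<Sum>\<mu>\<in>lie_basis. coord \<mu> x *\<^sub>C \<mu>) = (\<Sum>\<mu>\<in>lie_basis. coord \<mu> x * \<xi> \<mu>)"
    by (simp add: functional_sum functional_scale)
  then show ?thesis by (simp add: sum_coord)
qed

lemma endomorphism_expand: "endomorphism f \<Longrightarrow> f x = (\<Sum>\<mu>\<in>lie_basis. coord \<mu> x *\<^sub>C f \<mu>)"
proof -
  assume "endomorphism f"
  then have "f (\<Sum>\<mu>\<in>lie_basis. coord \<mu> x *\<^sub>C \<mu>) = (\<Sum>\<mu>\<in>lie_basis. coord \<mu> x *\<^sub>C f \<mu>)"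
    by (simp add: endomorphism_sum endomorphism_scale)
  then show ?thesis by (simp add: sum_coord)
qed

lemma functional_eqI: "(\<And>\<xi>. functional \<xi> \<Longrightarrow> \<xi> x = \<xi> y) \<Longrightarrow> x = y"
  using sum_coord[of x] sum_coord[of y] functional_coord by (metis (no_types, lifting) sum.cong)

lemma functional_separates:
  fixes x :: "'g::complex_lie_algebra"
  assumes U: "cvs.subspace U" and x: "x \<notin> U"
  obtains \<xi> where "functional \<xi>" "\<And>u. u \<in> U \<Longrightarrow> \<xi> u = 0" "\<xi> x = 1"
proof -
  interpret vp: vector_space_pair "scaleC :: complex \<Rightarrow> 'g \<Rightarrow> 'g" "(*) :: complex \<Rightarrow> complex \<Rightarrow> complex"
    by (rule vector_space_pair_functional)
  obtain C where C: "C \<subseteq> U" "cvs.independent C" "U \<subseteq> cvs.span C"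
    using cvs.basis_exists[of U] by metis
  have "cvs.span C \<subseteq> U" using C(1) U cvs.span_minimal by blast
  then have xC: "x \<notin> cvs.span C" using x by blast
  then have "cvs.independent (insert x C)" using C(2) by (simp add: cvs.independent_insert)
  then obtain \<xi> where \<xi>: "functional \<xi>" "\<forall>v\<in>insert x C. \<xi> v = (if v = x then 1 else 0)"
    using vp.linear_independent_extend[of "insert x C" "\<lambda>v. if v = x then 1 else 0"] by blast
  have C0: "\<xi> c = 0" if "c \<in> C" for c using \<xi>(2) that xC cvs.span_base by fastforce
  have "\<xi> u = 0" if "u \<in> cvs.span C" for u
    using that
  proof (induction rule: cvs.span_induct_alt)
    case (step c v w) then show ?case using \<xi>(1) C0 by (simp add: functional_add functional_scale)
  qed (simp add: functional_0[OF \<xi>(1)])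
  then show thesis using that[OF \<xi>(1)] \<xi>(2) C(3) by auto
qed

text \<open>A generalized inverse: \<open>s\<close> is a linear section over the range of
  \<open>f\<close>. It serves to factor functionals through \<open>f\<close> and, later, to lift a
  bivector from a quotient.\<close>

lemma right_inverse_on_range:
  assumes "endomorphism f"
  obtains s :: "'g::complex_lie_algebra \<Rightarrow> 'g"
  where "endomorphism s" "\<And>x. f (s (f x)) = f x"
proof -
  interpret vp: vector_space_pair "scaleC :: complex \<Rightarrow> 'g \<Rightarrow> 'g" "scaleC :: complex \<Rightarrow> 'g \<Rightarrow> 'g"
    by (rule vector_space_pair_endomorphism)
  obtain s where "endomorphism s" "\<forall>y\<in>f ` UNIV. f (s y) = y"
    using vp.linear_exists_right_inverse_on[OF assms cvs.subspace_UNIV] by blast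
  then show thesis by (intro that[of s]) blast+
qed

text \<open>The vector \<open>x - s (f x)\<close> lies in the kernel, so \<xi> only sees
  \<open>f x\<close>, and \<xi> composed with the section is the factor.\<close>

lemma functional_factors:
  assumes f: "endomorphism f" and \<xi>: "functional \<xi>" and ker: "\<And>x. f x = 0 \<Longrightarrow> \<xi> x = 0"
  obtains \<zeta> where "functional \<zeta>" "\<And>x. \<xi> x = \<zeta> (f x)"
proof -
  obtain s where s: "endomorphism s" "\<And>x. f (s (f x)) = f x"
    using right_inverse_on_range[OF f] by blast
  have "\<xi> x = \<xi> (s (f x))" for x
    using ker[of "x - s (f x)"] s(2)[of x] by (simp add: endomorphism_diff[OF f] functional_diff[OF \<xi>])
  then show thesis using that[OF functional_comp[OF \<xi> s(1)]] by blast
qed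

subsection \<open>The exponential\<close>

text \<open>The l1 norm of the coordinates; its only purpose is to dominate the exponential
  series.\<close>

definition cnorm :: "'g::complex_lie_algebra \<Rightarrow> real" where
  "cnorm x = (\<Sum>\<mu>\<in>lie_basis. norm (coord \<mu> x))"

lemma cnorm_nonneg: "cnorm x \<ge> 0"
  by (simp add: cnorm_def sum_nonneg)

lemma cnorm_sum_scale: "cnorm (\<Sum>i\<in>I. c i *\<^sub>C v i) \<le> (\<Sum>i\<in>I. norm (c i) * cnorm (v i))"
proof -
  have "cnorm (\<Sum>i\<in>I. c i *\<^sub>C v i) \<le> (\<Sum>\<mu>\<in>lie_basis. \<Sum>i\<in>I. norm (c i) * norm (coord \<mu> (v i)))"
    unfolding cnorm_def
    by (intro sum_mono) (simp add: functional_sum[OF functional_coord] coord_scale sum_norm_le norm_mult)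
  also have "\<dots> = (\<Sum>i\<in>I. norm (c i) * cnorm (v i))"
    unfolding cnorm_def sum_distrib_left by (rule sum.swap)
  finally show ?thesis .
qed

lemma functional_bound: "functional \<xi> \<Longrightarrow> norm (\<xi> x) \<le> (\<Sum>\<mu>\<in>lie_basis. norm (\<xi> \<mu>)) * cnorm x"
proof -
  assume "functional \<xi>"
  then have "norm (\<xi> x) \<le> (\<Sum>\<mu>\<in>lie_basis. norm (coord \<mu> x) * norm (\<xi> \<mu>))"
    by (subst functional_expand) (auto intro!: sum_norm_le simp: norm_mult)
  also have "\<dots> \<le> (\<Sum>\<mu>\<in>lie_basis. cnorm x * norm (\<xi> \<mu>))"
    unfolding cnorm_def
    by (intro sum_mono mult_right_mono member_le_sum) (simp_all add: finite_lie_basis)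
  finally show ?thesis by (simp add: sum_distrib_left mult.commute)
qed

lemma endomorphism_bound:
  "endomorphism f \<Longrightarrow> cnorm (f x) \<le> (\<Sum>\<mu>\<in>lie_basis. cnorm (f \<mu>)) * cnorm x"
proof -
  assume "endomorphism f"
  then have "cnorm (f x) \<le> (\<Sum>\<mu>\<in>lie_basis. norm (coord \<mu> x) * cnorm (f \<mu>))"
    by (subst endomorphism_expand) (auto intro!: cnorm_sum_scale)
  also have "\<dots> \<le> (\<Sum>\<mu>\<in>lie_basis. cnorm x * cnorm (f \<mu>))"
    unfolding cnorm_def[of x]
    by (intro sum_mono mult_right_mono member_le_sum) (simp_all add: finite_lie_basis cnorm_nonneg)
  finally show ?thesis by (simp add: sum_distrib_left mult.commute)
qed

text \<open>The iterates grow at most like \<open>M ^ n\<close>, which \<open>fact n\<close> beats.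
  Absolute summability is recorded because Cauchy products of two such series are formed
  below.\<close>

lemma summable_exp_end:
  assumes f: "endomorphism f" and \<xi>: "functional \<xi>"
  shows "summable (\<lambda>n. norm (\<xi> ((f ^^ n) x) / fact n))"
proof -
  define M where "M = (\<Sum>\<mu>\<in>lie_basis. cnorm (f \<mu>))"
  define C where "C = (\<Sum>\<mu>\<in>lie_basis. norm (\<xi> \<mu>))"
  have M: "M \<ge> 0" and C: "C \<ge> 0" by (simp_all add: M_def C_def sum_nonneg cnorm_nonneg)
  have pow: "cnorm ((f ^^ n) x) \<le> M ^ n * cnorm x" for n
  proof (induction n)
    case (Suc n)
    have "cnorm ((f ^^ Suc n) x) \<le> M * cnorm ((f ^^ n) x)"
      using endomorphism_bound[OF f] by (simp add: M_def)
    also have "\<dots> \<le> M * (M ^ n * cnorm x)" using Suc M by (rule mult_left_mono)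
    finally show ?case by (simp add: mult.assoc)
  qed simp
  have "summable (\<lambda>n. (C * cnorm x) * (inverse (fact n) * M ^ n))"
    by (intro summable_mult summable_exp)
  then show ?thesis
  proof (rule summable_comparison_test[rotated], intro exI allI impI)
    fix n :: nat
    have "norm (\<xi> ((f ^^ n) x)) \<le> C * (M ^ n * cnorm x)"
      using functional_bound[OF \<xi>, of "(f ^^ n) x"] mult_left_mono[OF pow[of n] C] by (simp add: C_def)
    then have "norm (\<xi> ((f ^^ n) x)) / fact n \<le> C * (M ^ n * cnorm x) / fact n"
      by (rule divide_right_mono) simp
    then show "norm (norm (\<xi> ((f ^^ n) x) / fact n)) \<le> (C * cnorm x) * (inverse (fact n) * M ^ n)"
      by (simp add: norm_divide field_simps)
  qed
qed

text \<open>\<open>exp_end\<close> is a definite description. The witness is the vector of the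
  coordinatewise sums, and it is unique because functionals separate points.\<close>

lemma exp_end_sums:
  assumes f: "endomorphism f" and \<xi>: "functional \<xi>"
  shows "(\<lambda>n. \<xi> ((f ^^ n) x) / fact n) sums \<xi> (exp_end f x)"
proof -
  define y where "y = (\<Sum>\<mu>\<in>lie_basis. (\<Sum>n. coord \<mu> ((f ^^ n) x) / fact n) *\<^sub>C \<mu>)"
  have *: "(\<lambda>n. \<xi> ((f ^^ n) x) / fact n) sums \<xi> y" if \<xi>: "functional \<xi>" for \<xi>
  proof -
    have "(\<lambda>n. \<Sum>\<mu>\<in>lie_basis. coord \<mu> ((f ^^ n) x) / fact n * \<xi> \<mu>) sums
        (\<Sum>\<mu>\<in>lie_basis. (\<Sum>n. coord \<mu> ((f ^^ n) x) / fact n) * \<xi> \<mu>)"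
      by (intro sums_sum sums_mult2 summable_sums summable_norm_cancel[OF summable_exp_end]
          f functional_coord)
    moreover have "(\<Sum>\<mu>\<in>lie_basis. coord \<mu> ((f ^^ n) x) / fact n * \<xi> \<mu>) = \<xi> ((f ^^ n) x) / fact n" for n
      unfolding functional_expand[OF \<xi>, of "(f ^^ n) x"] sum_divide_distrib
      by (intro sum.cong refl) simp
    ultimately show ?thesis by (simp add: y_def functional_sum[OF \<xi>] functional_scale[OF \<xi>])
  qed
  have "\<forall>\<xi>. functional \<xi> \<longrightarrow> (\<lambda>n. \<xi> ((f ^^ n) x) / fact n) sums \<xi> (exp_end f x)"
    unfolding exp_end_def
  proof (rule theI[of _ y])
    fix y' assume "\<forall>\<xi>. functional \<xi> \<longrightarrow> (\<lambda>n. \<xi> ((f ^^ n) x) / fact n) sums \<xi> y'"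
    then show "y' = y" by (intro functional_eqI sums_unique2[OF _ *]) blast+
  qed (use * in blast)
  then show ?thesis using \<xi> by blast
qed

lemma Exp_sums: "functional \<xi> \<Longrightarrow> (\<lambda>n. \<xi> ((lie a ^^ n) x) / fact n) sums \<xi> (Exp a x)"
  unfolding Exp_def by (rule exp_end_sums[OF endomorphism_lie])

lemma Exp_eqI:
  "(\<And>\<xi>. functional \<xi> \<Longrightarrow> (\<lambda>n. \<xi> ((lie a ^^ n) x) / fact n) sums \<xi> y) \<Longrightarrow> Exp a x = y"
  by (rule functional_eqI) (rule sums_unique2[OF Exp_sums])

lemma lie_scale_funpow: "(lie (s *\<^sub>C a) ^^ n) x = s ^ n *\<^sub>C (lie a ^^ n) x"
  by (induction n) (simp_all add: scaleC_one lie_scale_left lie_scale_right scaleC_scaleC)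

lemma Exp_0 [simp]: "Exp 0 = id"
proof
  fix x :: 'a
  show "Exp 0 x = id x"
  proof (rule Exp_eqI)
    fix \<xi> :: "'a \<Rightarrow> complex" assume "functional \<xi>"
    then have "\<xi> ((lie 0 ^^ n) x) / fact n = (if n = 0 then \<xi> x else 0)" for n
      by (cases n) (simp_all add: functional_0)
    then show "(\<lambda>n. \<xi> ((lie 0 ^^ n) x) / fact n) sums \<xi> (id x)"
      using sums_single[of 0 "\<lambda>_. \<xi> x"] by simp
  qed
qed

lemma endomorphism_Exp: "endomorphism (Exp a)"
proof (rule endomorphismI)
  fix x y c
  show "Exp a (x + y) = Exp a x + Exp a y"
    by (rule Exp_eqI) (simp add: endomorphism_add[OF endomorphism_funpow[OF endomorphism_lie]]
        functional_add add_divide_distrib sums_add Exp_sums)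
  show "Exp a (c *\<^sub>C x) = c *\<^sub>C Exp a x"
    by (rule Exp_eqI) (simp add: endomorphism_scale[OF endomorphism_funpow[OF endomorphism_lie]]
        functional_scale sums_mult Exp_sums flip: times_divide_eq_right)
qed

lemma lie_hom_Exp:
  assumes g: "endomorphism g" "\<And>x y. g (lie x y) = lie (g x) (g y)"
  shows "g (Exp a x) = Exp (g a) (g x)"
proof -
  have "(lie (g a) ^^ n) (g x) = g ((lie a ^^ n) x)" for n
    by (induction n) (simp_all add: g(2))
  then show ?thesis
    by (intro Exp_eqI[symmetric]) (simp add: Exp_sums[OF functional_comp[OF _ g(1)]])
qed

text \<open>Along \<open>s *\<^sub>C a\<close> the exponential series is an everywhere convergent
  power series in s, whose derivative at 0 is its linear coefficient.\<close>

lemma has_field_derivative_Exp: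
  assumes \<xi>: "functional \<xi>"
  shows "((\<lambda>s. \<xi> (Exp (s *\<^sub>C a) x)) has_field_derivative \<xi> (lie a x)) (at 0)"
proof -
  define c where "c n = \<xi> ((lie a ^^ n) x) / fact n" for n
  have sums: "(\<lambda>n. c n * s ^ n) sums \<xi> (Exp (s *\<^sub>C a) x)" for s
    using Exp_sums[OF \<xi>, of "s *\<^sub>C a" x]
    by (simp add: c_def lie_scale_funpow functional_scale[OF \<xi>] mult.commute)
  then have "summable (\<lambda>n. c n * s ^ n)" for s by (rule sums_summable)
  then have "((\<lambda>s. \<Sum>n. c n * s ^ n) has_field_derivative (\<Sum>n. diffs c n * 0 ^ n)) (at 0)"
    by (rule termdiffs_strong_converges_everywhere)
  moreover have "(\<Sum>n. diffs c n * 0 ^ n) = \<xi> (lie a x)"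
    by (simp add: diffs_def c_def)
  moreover have "(\<lambda>s. \<Sum>n. c n * s ^ n) = (\<lambda>s. \<xi> (Exp (s *\<^sub>C a) x))"
    using sums by (auto simp: sums_iff)
  ultimately show ?thesis by simp
qed

text \<open>Expanding both arguments in the basis reduces \<beta> to products of scalar series,
  which are Cauchy products. Applied to the bracket and to the form, this carries derivation and
  skewness properties of \<open>lie a\<close> over to \<open>Exp a\<close>.\<close>

lemma Exp_bilinear_sums:
  fixes \<beta> :: "'g::complex_lie_algebra \<Rightarrow> 'g \<Rightarrow> complex"
  assumes left: "\<And>y. functional (\<lambda>x. \<beta> x y)" and right: "\<And>x. functional (\<beta> x)"
  shows "(\<lambda>n. \<Sum>k\<le>n. \<beta> ((lie a ^^ k) x) ((lie b ^^ (n - k)) y) / (fact k * fact (n - k)))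
    sums \<beta> (Exp a x) (Exp b y)"
proof -
  have expand: "\<beta> u v = (\<Sum>\<mu>\<in>lie_basis. \<Sum>\<nu>\<in>lie_basis. coord \<mu> u * coord \<nu> v * \<beta> \<mu> \<nu>)" for u v
    by (subst functional_expand[OF left], subst functional_expand[OF right])
      (simp add: sum_distrib_left mult_ac)
  have "(\<lambda>n. \<Sum>\<mu>\<in>lie_basis. \<Sum>\<nu>\<in>lie_basis. (\<Sum>k\<le>n. (coord \<mu> ((lie a ^^ k) x) / fact k) *
        (coord \<nu> ((lie b ^^ (n - k)) y) / fact (n - k))) * \<beta> \<mu> \<nu>)
    sums (\<Sum>\<mu>\<in>lie_basis. \<Sum>\<nu>\<in>lie_basis. coord \<mu> (Exp a x) * coord \<nu> (Exp b y) * \<beta> \<mu> \<nu>)"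
  proof (intro sums_sum sums_mult2)
    fix \<mu> \<nu> :: 'g
    show "(\<lambda>n. \<Sum>k\<le>n. (coord \<mu> ((lie a ^^ k) x) / fact k) *
        (coord \<nu> ((lie b ^^ (n - k)) y) / fact (n - k))) sums (coord \<mu> (Exp a x) * coord \<nu> (Exp b y))"
      using Cauchy_product_sums[OF summable_exp_end[OF endomorphism_lie functional_coord]
          summable_exp_end[OF endomorphism_lie functional_coord], of \<mu> a x \<nu> b y]
        Exp_sums[OF functional_coord, of \<mu> a x] Exp_sums[OF functional_coord, of \<nu> b y]
      by (simp add: sums_iff)
  qed
  moreover have "(\<Sum>\<mu>\<in>lie_basis. \<Sum>\<nu>\<in>lie_basis. (\<Sum>k\<le>n. (coord \<mu> ((lie a ^^ k) x) / fact k) *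
        (coord \<nu> ((lie b ^^ (n - k)) y) / fact (n - k))) * \<beta> \<mu> \<nu>)
    = (\<Sum>k\<le>n. \<beta> ((lie a ^^ k) x) ((lie b ^^ (n - k)) y) / (fact k * fact (n - k)))" for n
  proof -
    have "(\<Sum>\<mu>\<in>lie_basis. \<Sum>\<nu>\<in>lie_basis. (\<Sum>k\<le>n. (coord \<mu> ((lie a ^^ k) x) / fact k) *
        (coord \<nu> ((lie b ^^ (n - k)) y) / fact (n - k))) * \<beta> \<mu> \<nu>)
      = (\<Sum>\<mu>\<in>lie_basis. \<Sum>k\<le>n. \<Sum>\<nu>\<in>lie_basis. (coord \<mu> ((lie a ^^ k) x) / fact k) *
        (coord \<nu> ((lie b ^^ (n - k)) y) / fact (n - k)) * \<beta> \<mu> \<nu>)"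
      by (intro sum.cong refl) (simp add: sum_distrib_right sum.swap[of _ "{..n}"])
    also have "\<dots> = (\<Sum>k\<le>n. \<Sum>\<mu>\<in>lie_basis. \<Sum>\<nu>\<in>lie_basis. (coord \<mu> ((lie a ^^ k) x) / fact k) *
        (coord \<nu> ((lie b ^^ (n - k)) y) / fact (n - k)) * \<beta> \<mu> \<nu>)"
      by (rule sum.swap)
    also have "\<dots> = (\<Sum>k\<le>n. \<beta> ((lie a ^^ k) x) ((lie b ^^ (n - k)) y) / (fact k * fact (n - k)))"
      by (subst expand) (simp add: sum_divide_distrib)
    finally show ?thesis .
  qed
  ultimately show ?thesis by (simp add: expand[of "Exp a x"])
qed

text \<open>The coefficients of the Cauchy product exp(-x) exp(x) = 1, multiplied by c.\<close>

lemma binomial_cancel: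
  "(\<Sum>k\<le>n. (-1) ^ k * (c::complex) / (fact k * fact (n - k))) = (if n = 0 then c else 0)"
proof -
  have "(\<Sum>k\<le>n. (-1) ^ k * c / (fact k * fact (n - k))) = (\<Sum>k\<le>n. of_nat (n choose k) * (-1) ^ k * 1 ^ (n - k)) * (c / fact n)"
    unfolding sum_distrib_right
    by (intro sum.cong refl) (simp add: binomial_fact)
  also have "\<dots> = (-1 + 1) ^ n * (c / fact n)"
    by (subst binomial_ring) (simp)
  finally show ?thesis by (cases n) simp_all
qed

lemma sums_delta_0: "(\<lambda>n. if n = 0 then c else 0) sums (c::complex)"
  using sums_single[of 0 "\<lambda>_. c"] by simp

text \<open>Expanding \<open>Exp a x\<close> in the basis turns the composition into a sum of Cauchy
  products. The n-th term contains only the n-th iterate of \<open>lie a\<close>, with the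
  alternating coefficients of \<open>binomial_cancel\<close>.\<close>

lemma Exp_minus: "Exp (- a) (Exp a x) = x"
proof (rule functional_eqI)
  fix \<xi> :: "'a \<Rightarrow> complex" assume \<xi>: "functional \<xi>"
  have expand: "\<xi> (Exp (- a) y) = (\<Sum>\<mu>\<in>lie_basis. coord \<mu> y * \<xi> (Exp (- a) \<mu>))" for y
    by (rule functional_expand[OF functional_comp[OF \<xi> endomorphism_Exp]])
  have pow: "(lie (- a) ^^ k) y = (-1) ^ k *\<^sub>C (lie a ^^ k) y" for k y
    using lie_scale_funpow[where s = "-1" and a = a and n = k and x = y] by (simp add: cvs.scale_minus_left scaleC_one)
  have "(\<lambda>n. \<Sum>\<mu>\<in>lie_basis. \<Sum>k\<le>n. (\<xi> ((lie (- a) ^^ k) \<mu>) / fact k) *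
      (coord \<mu> ((lie a ^^ (n - k)) x) / fact (n - k))) sums (\<Sum>\<mu>\<in>lie_basis. \<xi> (Exp (- a) \<mu>) * coord \<mu> (Exp a x))"
  proof (intro sums_sum)
    fix \<mu> :: 'a
    show "(\<lambda>n. \<Sum>k\<le>n. (\<xi> ((lie (- a) ^^ k) \<mu>) / fact k) *
        (coord \<mu> ((lie a ^^ (n - k)) x) / fact (n - k))) sums (\<xi> (Exp (- a) \<mu>) * coord \<mu> (Exp a x))"
      using Cauchy_product_sums[OF summable_exp_end[OF endomorphism_lie \<xi>]
          summable_exp_end[OF endomorphism_lie functional_coord], of "- a" \<mu> \<mu> a x]
        Exp_sums[OF \<xi>, of "- a" \<mu>] Exp_sums[OF functional_coord, of \<mu> a x]
      by (simp add: sums_iff)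
  qed
  moreover have "(\<Sum>\<mu>\<in>lie_basis. \<Sum>k\<le>n. (\<xi> ((lie (- a) ^^ k) \<mu>) / fact k) *
      (coord \<mu> ((lie a ^^ (n - k)) x) / fact (n - k))) = (if n = 0 then \<xi> x else 0)" for n
  proof -
    have "(\<Sum>\<mu>\<in>lie_basis. \<Sum>k\<le>n. (\<xi> ((lie (- a) ^^ k) \<mu>) / fact k) *
        (coord \<mu> ((lie a ^^ (n - k)) x) / fact (n - k)))
      = (\<Sum>k\<le>n. (\<Sum>\<mu>\<in>lie_basis. coord \<mu> ((lie a ^^ (n - k)) x) * \<xi> ((lie (- a) ^^ k) \<mu>)) / (fact k * fact (n - k)))"
      by (subst sum.swap) (simp add: sum_divide_distrib mult_ac)
    also have "\<dots> = (\<Sum>k\<le>n. \<xi> ((lie (- a) ^^ k) ((lie a ^^ (n - k)) x)) / (fact k * fact (n - k)))"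
      by (subst functional_expand[OF functional_comp[OF \<xi> endomorphism_funpow[OF endomorphism_lie]], symmetric]) simp
    also have "\<dots> = (\<Sum>k\<le>n. (-1) ^ k * \<xi> ((lie a ^^ n) x) / (fact k * fact (n - k)))"
      by (intro sum.cong refl)
        (simp add: pow functional_scale[OF \<xi>] flip: funpow_add[THEN fun_cong, unfolded comp_def])
    also have "\<dots> = (if n = 0 then \<xi> x else 0)" by (simp add: binomial_cancel)
    finally show ?thesis .
  qed
  ultimately show "\<xi> (Exp (- a) (Exp a x)) = \<xi> x"
    using sums_unique2[OF _ sums_delta_0] by (simp add: expand[of "Exp a x"] mult.commute)
qed

lemma bij_Exp: "bij (Exp a)"
  using Exp_minus[of a] Exp_minus[of "- a"] by (intro o_bij[of "Exp (- a)"]) (auto simp: fun_eq_iff)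

lemma inv_Exp: "inv (Exp a) = Exp (- a)"
  using Exp_minus[of a] Exp_minus[of "- a"] by (intro inv_unique_comp) (auto simp: fun_eq_iff)

text \<open>By the Jacobi identity \<open>lie a\<close> is a derivation; this is its Leibniz rule of
  order n, by Pascal's rule.\<close>

lemma lie_funpow_leibniz:
  "(lie a ^^ n) (lie x y) = (\<Sum>k\<le>n. of_nat (n choose k) *\<^sub>C lie ((lie a ^^ k) x) ((lie a ^^ (n - k)) y))"
proof (induction n arbitrary: x y)
  case 0 then show ?case by (simp add: scaleC_one)
next
  case (Suc n)
  define L where "L k l = lie ((lie a ^^ k) x) ((lie a ^^ l) y)" for k l
  have "(lie a ^^ Suc n) (lie x y) = (lie a ^^ n) (lie (lie a x) y) + (lie a ^^ n) (lie x (lie a y))"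
    using lie_lie[of a x y]
    by (simp add: funpow_swap1 endomorphism_add[OF endomorphism_funpow[OF endomorphism_lie], symmetric])
  also have "\<dots> = (\<Sum>k\<le>n. of_nat (n choose k) *\<^sub>C L (Suc k) (n - k)) +
      (\<Sum>k\<le>n. of_nat (n choose k) *\<^sub>C L k (Suc n - k))"
    unfolding Suc L_def
    by (intro arg_cong2[where f = "(+)"] sum.cong refl) (simp_all add: funpow_swap1 Suc_diff_le)
  also have "\<dots> = (\<Sum>k\<le>Suc n. of_nat (Suc n choose k) *\<^sub>C L k (Suc n - k))"
  proof -
    have "(\<Sum>k\<le>n. of_nat (n choose k) *\<^sub>C L k (Suc n - k)) = (\<Sum>k\<le>Suc n. of_nat (n choose k) *\<^sub>C L k (Suc n - k))"
      by simp
    also have "\<dots> = L 0 (Suc n) + (\<Sum>k\<le>n. of_nat (n choose Suc k) *\<^sub>C L (Suc k) (n - k))"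
      by (subst sum.atMost_Suc_shift) (simp add: scaleC_one)
    finally show ?thesis
      by (subst sum.atMost_Suc_shift) (simp add: scaleC_one scaleC_add_left sum.distrib algebra_simps)
  qed
  finally show ?case by (simp add: L_def)
qed

text \<open>The exponential of a derivation is an automorphism: dividing the n-th Leibniz rule by
  \<open>fact n\<close> gives the n-th Cauchy coefficient.\<close>

lemma Exp_lie: "Exp a (lie x y) = lie (Exp a x) (Exp a y)"
proof (rule Exp_eqI)
  fix \<xi> :: "'a \<Rightarrow> complex" assume \<xi>: "functional \<xi>"
  have "(\<lambda>n. \<Sum>k\<le>n. \<xi> (lie ((lie a ^^ k) x) ((lie a ^^ (n - k)) y)) / (fact k * fact (n - k)))
      sums \<xi> (lie (Exp a x) (Exp a y))"
    by (rule Exp_bilinear_sums)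
      (simp_all add: functional_comp[OF \<xi>] endomorphism_lie endomorphism_lie_left)
  moreover have "(\<Sum>k\<le>n. \<xi> (lie ((lie a ^^ k) x) ((lie a ^^ (n - k)) y)) / (fact k * fact (n - k)))
      = \<xi> ((lie a ^^ n) (lie x y)) / fact n" for n
    unfolding lie_funpow_leibniz functional_sum[OF \<xi>] sum_divide_distrib
    by (intro sum.cong refl) (simp add: functional_scale[OF \<xi>] binomial_fact)
  ultimately show "(\<lambda>n. \<xi> ((lie a ^^ n) (lie x y)) / fact n) sums \<xi> (lie (Exp a x) (Exp a y))"
    by simp
qed

text \<open>\<open>lie a\<close> is skew for B. Moving all iterates to the second argument costs
  alternating signs, so every Cauchy coefficient but the first cancels.\<close>

lemma Exp_invariant_form:
  assumes B: "invariant_form B"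
  shows "B (Exp a x) (Exp a y) = B x y"
proof -
  have right: "functional (B x)" and sym: "B x y = B y x" and inv: "B (lie x y) z = B x (lie y z)" for x y z
    using B by (auto simp: invariant_form_def)
  have "(\<lambda>x. B x y) = B y" for y by (rule ext) (rule sym)
  then have left: "functional (\<lambda>x. B x y)" for y using right by simp
  have "B (lie a x) y = - B x (lie a y)" for x y
    using inv[of x a y] lie_skew[of x a] functional_neg[OF left] by (simp add: minus_equation_iff)
  then have pow: "B ((lie a ^^ k) x) y = (-1) ^ k * B x ((lie a ^^ k) y)" for k x y
  proof (induction k arbitrary: y)
    case (Suc k) then show ?case by (simp add: funpow_swap1[of "lie a" k y])
  qed simp
  have "(\<lambda>n. \<Sum>k\<le>n. B ((lie a ^^ k) x) ((lie a ^^ (n - k)) y) / (fact k * fact (n - k)))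
      sums B (Exp a x) (Exp a y)"
    by (rule Exp_bilinear_sums[OF left right])
  moreover have "(\<Sum>k\<le>n. B ((lie a ^^ k) x) ((lie a ^^ (n - k)) y) / (fact k * fact (n - k)))
      = (if n = 0 then B x y else 0)" for n
  proof -
    have "(\<Sum>k\<le>n. B ((lie a ^^ k) x) ((lie a ^^ (n - k)) y) / (fact k * fact (n - k)))
      = (\<Sum>k\<le>n. (-1) ^ k * B x ((lie a ^^ n) y) / (fact k * fact (n - k)))"
      by (intro sum.cong refl) (simp add: pow flip: funpow_add[THEN fun_cong, unfolded comp_def])
    then show ?thesis by (simp add: binomial_cancel)
  qed
  ultimately show ?thesis using sums_unique2[OF _ sums_delta_0] by simp
qed

subsection \<open>Derivations of polynomial functions\<close>

text \<open>Differentiability is tested on single vectors and functionals. Neither the path nor X is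
  required to consist of linear maps, so that straight lines and curves inside a group are covered
  alike.\<close>

definition tangent_path ::
  "(complex \<Rightarrow> 'g::complex_lie_algebra \<Rightarrow> 'g) \<Rightarrow> ('g \<Rightarrow> 'g) \<Rightarrow> ('g \<Rightarrow> 'g) \<Rightarrow> bool" where
  "tangent_path \<gamma> g X \<longleftrightarrow> \<gamma> 0 = g \<and>
     (\<forall>\<xi> x. functional \<xi> \<longrightarrow> ((\<lambda>s. \<xi> (\<gamma> s x)) has_field_derivative \<xi> (X x)) (at 0))"

definition dirderiv ::
  "(('g::complex_lie_algebra \<Rightarrow> 'g) \<Rightarrow> complex) \<Rightarrow> ('g \<Rightarrow> 'g) \<Rightarrow> ('g \<Rightarrow> 'g) \<Rightarrow> complex" where
  "dirderiv p g X = deriv (\<lambda>s. p (\<lambda>x. g x + s *\<^sub>C X x)) 0"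

lemma tangent_path_line: "tangent_path (\<lambda>s x. g x + s *\<^sub>C X x) g X"
  by (auto simp: tangent_path_def functional_add functional_scale intro!: derivative_eq_intros)

text \<open>The value d is chosen before the path: all paths with the same tangent give the same
  derivative, which later identifies derivatives along curves in the group with those along straight
  lines.\<close>

lemma poly_has_derivative:
  assumes "p \<in> poly_functions"
  shows "\<exists>d. \<forall>\<gamma>. tangent_path \<gamma> g X \<longrightarrow> ((\<lambda>s. p (\<gamma> s)) has_field_derivative d) (at 0)"
  using assms
proof induction
  case (const c)
  then show ?case by (intro exI[of _ 0]) (simp)
next
  case (coeff \<xi> x)
  then show ?case by (intro exI[of _ "\<xi> (X x)"]) (simp add: tangent_path_def)
next
  case (add p q)
  then obtain d e where
    "\<forall>\<gamma>. tangent_path \<gamma> g X \<longrightarrow> ((\<lambda>s. p (\<gamma> s)) has_field_derivative d) (at 0)"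
    "\<forall>\<gamma>. tangent_path \<gamma> g X \<longrightarrow> ((\<lambda>s. q (\<gamma> s)) has_field_derivative e) (at 0)" by blast
  then show ?case by (intro exI[of _ "d + e"]) (simp add: DERIV_add)
next
  case (mult p q)
  then obtain d e where d:
    "\<forall>\<gamma>. tangent_path \<gamma> g X \<longrightarrow> ((\<lambda>s. p (\<gamma> s)) has_field_derivative d) (at 0)"
    "\<forall>\<gamma>. tangent_path \<gamma> g X \<longrightarrow> ((\<lambda>s. q (\<gamma> s)) has_field_derivative e) (at 0)" by blast
  show ?case
  proof (intro exI allI impI)
    fix \<gamma> assume \<gamma>: "tangent_path \<gamma> g X"
    then have "\<gamma> 0 = g" by (simp add: tangent_path_def)
    then show "((\<lambda>s. p (\<gamma> s) * q (\<gamma> s)) has_field_derivative d * q g + e * p g) (at 0)"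
      using DERIV_mult[OF d(1)[rule_format, OF \<gamma>] d(2)[rule_format, OF \<gamma>]] by simp
  qed
qed

lemma has_field_derivative_dirderiv:
  assumes p: "p \<in> poly_functions" and \<gamma>: "tangent_path \<gamma> g X"
  shows "((\<lambda>s. p (\<gamma> s)) has_field_derivative dirderiv p g X) (at 0)"
proof -
  obtain d where d: "\<forall>\<gamma>. tangent_path \<gamma> g X \<longrightarrow> ((\<lambda>s. p (\<gamma> s)) has_field_derivative d) (at 0)"
    using poly_has_derivative[OF p] by blast
  then have "dirderiv p g X = d"
    unfolding dirderiv_def using tangent_path_line DERIV_imp_deriv by blast
  then show ?thesis using d \<gamma> by blast
qed

lemma deriv_tangent_path:
  "p \<in> poly_functions \<Longrightarrow> tangent_path \<gamma> g X \<Longrightarrow> deriv (\<lambda>s. p (\<gamma> s)) 0 = dirderiv p g X"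
  by (rule DERIV_imp_deriv[OF has_field_derivative_dirderiv])

lemma dirderiv_const [simp]: "dirderiv (\<lambda>_. c) g X = 0"
  by (simp add: dirderiv_def)

lemma dirderiv_coeff: "functional \<xi> \<Longrightarrow> dirderiv (\<lambda>g. \<xi> (g x)) g X = \<xi> (X x)"
  unfolding dirderiv_def
  by (rule DERIV_imp_deriv) (use tangent_path_line[of g X] in \<open>simp add: tangent_path_def\<close>)

lemma dirderiv_add:
  "p \<in> poly_functions \<Longrightarrow> q \<in> poly_functions \<Longrightarrow>
    dirderiv (\<lambda>g. p g + q g) g X = dirderiv p g X + dirderiv q g X"
  unfolding dirderiv_def[of "\<lambda>g. p g + q g"]
  by (rule DERIV_imp_deriv) (intro DERIV_add has_field_derivative_dirderiv tangent_path_line)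

lemma dirderiv_mult:
  "p \<in> poly_functions \<Longrightarrow> q \<in> poly_functions \<Longrightarrow>
    dirderiv (\<lambda>g. p g * q g) g X = dirderiv p g X * q g + p g * dirderiv q g X"
  unfolding dirderiv_def[of "\<lambda>g. p g * q g"]
  using DERIV_mult[OF has_field_derivative_dirderiv[OF _ tangent_path_line]
      has_field_derivative_dirderiv[OF _ tangent_path_line], of p q g X g X]
  by (intro DERIV_imp_deriv) (simp add: cvs.scale_zero_left algebra_simps)

lemma dirderiv_linear:
  assumes "p \<in> poly_functions"
  shows "dirderiv p g (\<lambda>x. X x + Y x) = dirderiv p g X + dirderiv p g Y"
    and "dirderiv p g (\<lambda>x. c *\<^sub>C X x) = c * dirderiv p g X"
  using assms
  by (induction, simp_all add: dirderiv_coeff dirderiv_add dirderiv_mult functional_add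
      functional_scale algebra_simps)

text \<open>The infinitesimal action of \<open>\<gg> \<times> \<gg>\<close> on functions coming from \<open>g \<mapsto> h g k\<inverse>\<close>,
  with the sign that makes it a homomorphism of Lie algebras.\<close>

definition rho ::
  "'g \<times> 'g::complex_lie_algebra \<Rightarrow> (('g \<Rightarrow> 'g) \<Rightarrow> complex) \<Rightarrow> ('g \<Rightarrow> 'g) \<Rightarrow> complex" where
  "rho z p g = dirderiv p g (\<lambda>x. g (lie (snd z) x) - lie (fst z) (g x))"

lemma rho_const [simp]: "rho z (\<lambda>_. c) g = 0"
  by (simp add: rho_def)

lemma rho_coeff:
  "functional \<xi> \<Longrightarrow> rho z (\<lambda>g. \<xi> (g x)) g = \<xi> (g (lie (snd z) x)) - \<xi> (lie (fst z) (g x))"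
  by (simp add: rho_def dirderiv_coeff functional_diff)

lemma rho_add:
  "p \<in> poly_functions \<Longrightarrow> q \<in> poly_functions \<Longrightarrow> rho z (\<lambda>g. p g + q g) g = rho z p g + rho z q g"
  by (simp add: rho_def dirderiv_add)

lemma rho_mult:
  "p \<in> poly_functions \<Longrightarrow> q \<in> poly_functions \<Longrightarrow>
    rho z (\<lambda>g. p g * q g) g = rho z p g * q g + p g * rho z q g"
  by (simp add: rho_def dirderiv_mult)

lemma poly_scale: "p \<in> poly_functions \<Longrightarrow> (\<lambda>g. c * p g) \<in> poly_functions"
  by (intro poly_functions.mult poly_functions.const)

lemma poly_diff: "p \<in> poly_functions \<Longrightarrow> q \<in> poly_functions \<Longrightarrow> (\<lambda>g. p g - q g) \<in> poly_functions"
  using poly_functions.add[OF _ poly_scale[of q "-1"]] by simp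

lemma poly_sum: "(\<And>i. i \<in> I \<Longrightarrow> p i \<in> poly_functions) \<Longrightarrow> (\<lambda>g. \<Sum>i\<in>I. p i g) \<in> poly_functions"
  by (induction I rule: infinite_finite_induct) (auto intro: poly_functions.intros)

lemma rho_scale: "p \<in> poly_functions \<Longrightarrow> rho z (\<lambda>g. c * p g) g = c * rho z p g"
  by (simp add: rho_mult poly_functions.const)

lemma rho_diff:
  "p \<in> poly_functions \<Longrightarrow> q \<in> poly_functions \<Longrightarrow> rho z (\<lambda>g. p g - q g) g = rho z p g - rho z q g"
  using rho_add[OF _ poly_scale[of q "-1"], of p z g] rho_scale[of q z "-1" g] by simp

lemma rho_sum:
  "(\<And>i. i \<in> I \<Longrightarrow> p i \<in> poly_functions) \<Longrightarrow> rho z (\<lambda>g. \<Sum>i\<in>I. p i g) g = (\<Sum>i\<in>I. rho z (p i) g)"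
  by (induction I rule: infinite_finite_induct) (simp_all add: rho_add poly_sum)

lemma rho_poly: "p \<in> poly_functions \<Longrightarrow> rho z p \<in> poly_functions"
proof (induction rule: poly_functions.induct)
  case (const c)
  have "rho z (\<lambda>_. c) = (\<lambda>_. 0)" by (rule ext) simp
  then show ?case using poly_functions.const[of 0] by simp
next
  case (coeff \<xi> x)
  then have "rho z (\<lambda>g. \<xi> (g x)) = (\<lambda>g. \<xi> (g (lie (snd z) x)) - \<xi> (lie (fst z) (g x)))"
    by (simp add: rho_coeff fun_eq_iff)
  then show ?case
    using poly_functions.coeff[OF coeff(1), of "lie (snd z) x"]
      poly_functions.coeff[OF functional_comp[OF coeff(1) endomorphism_lie], of "fst z" x]
    by (simp add: poly_diff)
next
  case (add p q)
  then have "rho z (\<lambda>g. p g + q g) = (\<lambda>g. rho z p g + rho z q g)" by (simp add: rho_add fun_eq_iff)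
  then show ?case using add by (simp add: poly_functions.add)
next
  case (mult p q)
  then have "rho z (\<lambda>g. p g * q g) = (\<lambda>g. rho z p g * q g + p g * rho z q g)"
    by (simp add: rho_mult fun_eq_iff)
  then show ?case using mult by (simp add: poly_functions.add poly_functions.mult)
qed

text \<open>Both sides are derivations in p, so matrix coefficients decide, and for these the claim
  is the Jacobi identity on either side of g. Linearity of g is what allows g to be applied to a
  difference of brackets.\<close>

lemma rho_commutator:
  assumes "p \<in> poly_functions" and g: "endomorphism g"
  shows "rho z (rho w p) g - rho w (rho z p) g = rho (lie_pair z w) p g"
  using assms(1)
proof (induction rule: poly_functions.induct)
  case (const c)
  have "rho z (\<lambda>_. c) = (\<lambda>_. 0)" for z by (rule ext) simp
  then show ?case by simp
next
  case (coeff \<xi> x)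
  have eq: "rho z (\<lambda>g. \<xi> (g x)) = (\<lambda>g. \<xi> (g (lie (snd z) x)) - \<xi> (lie (fst z) (g x)))" for z
    using coeff by (simp add: rho_coeff fun_eq_iff)
  have rho2: "rho z (rho w (\<lambda>g. \<xi> (g x))) g = \<xi> (g (lie (snd z) (lie (snd w) x))) - \<xi> (lie (fst z) (g (lie (snd w) x)))
      - \<xi> (lie (fst w) (g (lie (snd z) x))) + \<xi> (lie (fst w) (lie (fst z) (g x)))" for z w
    unfolding eq[of w]
    by (subst rho_diff)
      (use coeff in \<open>simp_all add: rho_coeff rho_coeff[OF functional_comp[OF coeff endomorphism_lie]]
        poly_functions.coeff poly_functions.coeff[OF functional_comp[OF coeff endomorphism_lie]]\<close>)
  show ?case
    unfolding rho2
    by (simp add: rho_coeff coeff lie_pair_def lie_lie endomorphism_diff[OF g] functional_diff[OF coeff])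
next
  case (add p q)
  have "rho z (\<lambda>g. p g + q g) = (\<lambda>g. rho z p g + rho z q g)" for z
    using add by (simp add: rho_add fun_eq_iff)
  then show ?case using add by (simp add: rho_add rho_poly algebra_simps)
next
  case (mult p q)
  have "rho z (\<lambda>g. p g * q g) = (\<lambda>g. rho z p g * q g + p g * rho z q g)" for z
    using mult by (simp add: rho_mult fun_eq_iff)
  then show ?case using mult
    by (simp add: rho_add rho_mult rho_poly poly_functions.mult flip: mult(3,4)) (simp add: algebra_simps)
qed

text \<open>At an automorphism the action of z depends only on the vector
  \<open>g (snd z) - fst z\<close>, which vanishes exactly for z in the graph of g.\<close>

lemma rho_eq:
  assumes "p \<in> poly_functions" "endomorphism g" "\<And>x y. g (lie x y) = lie (g x) (g y)"
  shows "rho z p g = dirderiv p g (\<lambda>x. lie (g (snd z) - fst z) (g x))"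
  by (simp add: rho_def assms(3) lie_diff_left)

lemma functional_dirderiv:
  assumes "p \<in> poly_functions"
  shows "functional (\<lambda>c. dirderiv p g (\<lambda>x. lie c (g x)))"
  by (rule functionalI)
    (simp_all add: lie_add_left lie_scale_left dirderiv_linear[OF assms])

subsection \<open>Automorphism groups\<close>

lemma
  assumes "g \<in> Aut_form B"
  shows Aut_form_endomorphism: "endomorphism g"
    and Aut_form_bij: "bij g"
    and Aut_form_lie: "g (lie x y) = lie (g x) (g y)"
    and Aut_form_form: "B (g x) (g y) = B x y"
  using assms by (simp_all add: Aut_form_def)

lemma Aut_form_inv_apply:
  assumes "g \<in> Aut_form B"
  shows "g (inv g x) = x" "inv g (g x) = x"
  using Aut_form_bij[OF assms] by (simp_all add: bij_is_surj surj_f_inv_f bij_is_inj)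

lemma Aut_form_comp: "g \<in> Aut_form B \<Longrightarrow> h \<in> Aut_form B \<Longrightarrow> g \<circ> h \<in> Aut_form B"
  by (auto simp: Aut_form_def endomorphism_iff bij_comp)

lemma Aut_form_id: "id \<in> Aut_form B"
  by (simp add: Aut_form_def endomorphism_iff)

lemma Aut_form_inv:
  assumes g: "g \<in> Aut_form B"
  shows "inv g \<in> Aut_form B"
proof -
  note [simp] = Aut_form_inv_apply[OF g]
  have *: "inv g u = v \<longleftrightarrow> u = g v" for u v using Aut_form_inv_apply[OF g] by metis
  have e: "endomorphism g" by (rule Aut_form_endomorphism[OF g])
  have "endomorphism (inv g)"
    by (rule endomorphismI) (simp_all add: * endomorphism_add[OF e] endomorphism_scale[OF e])
  moreover have "inv g (lie x y) = lie (inv g x) (inv g y)" for x y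
    by (simp add: * Aut_form_lie[OF g])
  moreover have "B (inv g x) (inv g y) = B x y" for x y
    using Aut_form_form[OF g, of "inv g x" "inv g y"] by simp
  ultimately show ?thesis using Aut_form_bij[OF g] by (simp add: Aut_form_def bij_imp_bij_inv)
qed

lemma Exp_Aut_form: "invariant_form B \<Longrightarrow> Exp a \<in> Aut_form B"
  by (simp add: Aut_form_def endomorphism_Exp bij_Exp Exp_lie Exp_invariant_form)

lemma Int_group_Aut_form: "invariant_form B \<Longrightarrow> h \<in> Int_group \<Longrightarrow> h \<in> Aut_form B"
  by (rotate_tac, induction rule: Int_group.induct) (auto intro: Aut_form_id Aut_form_comp Exp_Aut_form)

lemma Exp_Int_group: "Exp a \<in> Int_group"
  using Int_group.exp[OF Int_group.id, of a] by (simp add: comp_def)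

lemma Int_group_comp: "h \<in> Int_group \<Longrightarrow> k \<in> Int_group \<Longrightarrow> h \<circ> k \<in> Int_group"
  by (induction rule: Int_group.induct) (auto simp: comp_assoc intro: Int_group.intros)

lemma Int_group_bij: "h \<in> Int_group \<Longrightarrow> bij h"
  by (induction rule: Int_group.induct)
    (simp_all add: bij_comp[unfolded comp_def] bij_Exp bij_id[unfolded id_def])

lemma Int_group_inv: "h \<in> Int_group \<Longrightarrow> inv h \<in> Int_group"
proof (induction rule: Int_group.induct)
  case id show ?case using Int_group.id by (simp add: id_def)
next
  case (exp h a)
  then have "inv (Exp a \<circ> h) \<in> Int_group"
    by (simp only: o_inv_distrib Int_group_bij bij_Exp inv_Exp Int_group_comp Exp_Int_group)
  then show ?case by (simp add: comp_def)
qed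

lemma conjugation_id: "conjugation id g = g"
  by (simp add: conjugation_def)

lemma conjugation_comp:
  "bij h \<Longrightarrow> bij k \<Longrightarrow> conjugation (h \<circ> k) g = conjugation h (conjugation k g)"
  by (simp add: conjugation_def o_inv_distrib comp_assoc)

lemma conjugation_Aut_form:
  "h \<in> Aut_form B \<Longrightarrow> g \<in> Aut_form B \<Longrightarrow> conjugation h g \<in> Aut_form B"
  by (simp add: conjugation_def Aut_form_comp Aut_form_inv)

subsection \<open>Vector fields on regular functions\<close>

lemma regular_iff: "\<phi> \<in> regular S \<longleftrightarrow> (\<exists>p\<in>poly_functions. \<forall>g\<in>S. \<phi> g = p g)"
  by (simp add: regular_def restrictions_def)

lemma poly_regular: "p \<in> poly_functions \<Longrightarrow> p \<in> regular S"
  by (auto simp: regular_iff)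

lemma regular_add: "\<phi> \<in> regular S \<Longrightarrow> \<psi> \<in> regular S \<Longrightarrow> (\<lambda>g. \<phi> g + \<psi> g) \<in> regular S"
  unfolding regular_iff by (metis (no_types, lifting) poly_functions.add)

lemma regular_mult: "\<phi> \<in> regular S \<Longrightarrow> \<psi> \<in> regular S \<Longrightarrow> (\<lambda>g. \<phi> g * \<psi> g) \<in> regular S"
  unfolding regular_iff by (metis (no_types, lifting) poly_functions.mult)

lemma function_algebra_regular: "function_algebra (regular S)"
  by (auto simp: function_algebra_def regular_add regular_mult intro: poly_regular poly_functions.const)

lemma tangent_path_right: "tangent_path (\<lambda>s. Exp (s *\<^sub>C a) \<circ> g) g (\<lambda>x. lie a (g x))"
  by (simp add: tangent_path_def cvs.scale_zero_left has_field_derivative_Exp)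

lemma tangent_path_left:
  "endomorphism g \<Longrightarrow> tangent_path (\<lambda>s. g \<circ> Exp (s *\<^sub>C a)) g (\<lambda>x. g (lie a x))"
  using has_field_derivative_Exp[OF functional_comp]
  by (auto simp add: tangent_path_def cvs.scale_zero_left)

text \<open>The parameter occurs on both sides of g. Expansion in the basis separates the two
  occurrences into products of scalar functions, to which the product rule applies.\<close>

lemma tangent_path_conjugation:
  assumes g: "endomorphism g"
  shows "tangent_path (\<lambda>s. conjugation (Exp (s *\<^sub>C a)) g) g (\<lambda>x. lie a (g x) - g (lie a x))"
  unfolding tangent_path_def
proof (intro conjI allI impI)
  show "conjugation (Exp (0 *\<^sub>C a)) g = g" by (simp add: cvs.scale_zero_left conjugation_id)
next
  fix \<xi> :: "'a \<Rightarrow> complex" and x assume \<xi>: "functional \<xi>"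
  have expand: "\<xi> (conjugation (Exp (s *\<^sub>C a)) g x) =
      (\<Sum>\<mu>\<in>lie_basis. coord \<mu> (g (Exp (s *\<^sub>C (- a)) x)) * \<xi> (Exp (s *\<^sub>C a) \<mu>))" for s
    by (subst functional_expand[OF functional_comp[OF \<xi> endomorphism_Exp], symmetric])
      (simp add: conjugation_def inv_Exp cvs.scale_minus_right)
  have "((\<lambda>s. \<Sum>\<mu>\<in>lie_basis. coord \<mu> (g (Exp (s *\<^sub>C (- a)) x)) * \<xi> (Exp (s *\<^sub>C a) \<mu>)) has_field_derivative
      (\<Sum>\<mu>\<in>lie_basis. coord \<mu> (g (lie (- a) x)) * \<xi> (Exp (0 *\<^sub>C a) \<mu>) + \<xi> (lie a \<mu>) * coord \<mu> (g (Exp (0 *\<^sub>C (- a)) x)))) (at 0)"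
    by (intro DERIV_sum DERIV_mult has_field_derivative_Exp \<xi>
        has_field_derivative_Exp[OF functional_comp[OF functional_coord g]])
  moreover have "(\<Sum>\<mu>\<in>lie_basis. coord \<mu> (g (lie (- a) x)) * \<xi> (Exp (0 *\<^sub>C a) \<mu>) + \<xi> (lie a \<mu>) * coord \<mu> (g (Exp (0 *\<^sub>C (- a)) x)))
      = \<xi> (g (lie (- a) x)) + \<xi> (lie a (g x))"
    unfolding functional_expand[OF \<xi>, of "g (lie (- a) x)"]
      functional_expand[OF functional_comp[OF \<xi> endomorphism_lie], of a "g x"]
    by (simp add: sum.distrib cvs.scale_zero_left mult.commute)
  ultimately show "((\<lambda>s. \<xi> (conjugation (Exp (s *\<^sub>C a)) g x)) has_field_derivative \<xi> (lie a (g x) - g (lie a x))) (at 0)"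
    by (simp add: expand lie_neg_left endomorphism_neg[OF g] functional_neg[OF \<xi>] functional_diff[OF \<xi>])
qed

text \<open>Since \<phi> agrees with p only on S, the curve defining the field must stay in S. The
  sign is that of the first component in \<open>rho\<close>.\<close>

lemma right_inv_field_eq:
  assumes p: "p \<in> poly_functions" "\<And>g. g \<in> S \<Longrightarrow> \<phi> g = p g"
    and g: "endomorphism g" "\<And>s. Exp (s *\<^sub>C a) \<circ> g \<in> S"
  shows "right_inv_field a \<phi> g = - rho (a, 0) p g"
proof -
  have "right_inv_field a \<phi> g = dirderiv p g (\<lambda>x. lie a (g x))"
    unfolding right_inv_field_def
    using deriv_tangent_path[OF p(1) tangent_path_right] by (simp add: p(2) g(2))
  moreover have "rho (a, 0) p g = dirderiv p g (\<lambda>x. (-1) *\<^sub>C lie a (g x))"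
    by (simp add: rho_def endomorphism_0[OF g(1)] scaleC_one cvs.scale_minus_left)
  ultimately show ?thesis unfolding dirderiv_linear[OF p(1)] by simp
qed

lemma left_inv_field_eq:
  assumes p: "p \<in> poly_functions" "\<And>g. g \<in> S \<Longrightarrow> \<phi> g = p g"
    and g: "endomorphism g" "\<And>s. g \<circ> Exp (s *\<^sub>C a) \<in> S"
  shows "left_inv_field a \<phi> g = rho (0, a) p g"
  unfolding left_inv_field_def
  using deriv_tangent_path[OF p(1) tangent_path_left[OF g(1)]] by (simp add: p(2) g(2) rho_def)

lemma differential_conjugation_eq:
  assumes p: "p \<in> poly_functions" "\<And>g. g \<in> S \<Longrightarrow> \<phi> g = p g"
    and g: "endomorphism g" "\<And>s. conjugation (Exp (s *\<^sub>C a)) g \<in> S"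
  shows "differential conjugation \<phi> g a = - rho (a, a) p g"
proof -
  have "differential conjugation \<phi> g a = dirderiv p g (\<lambda>x. lie a (g x) - g (lie a x))"
    unfolding differential_def
    using deriv_tangent_path[OF p(1) tangent_path_conjugation[OF g(1)]] by (simp add: p(2) g(2))
  moreover have "rho (a, a) p g = dirderiv p g (\<lambda>x. (-1) *\<^sub>C (lie a (g x) - g (lie a x)))"
    by (simp add: rho_def scaleC_one cvs.scale_minus_left)
  ultimately show ?thesis unfolding dirderiv_linear[OF p(1)] by simp
qed

subsection \<open>Invariant forms and the Poisson bracket\<close>

lemma rho_add_left:
  assumes "p \<in> poly_functions" "endomorphism g"
  shows "rho (z + w) p g = rho z p g + rho w p g"
proof -
  have "(\<lambda>x. g (lie (snd (z + w)) x) - lie (fst (z + w)) (g x)) =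
      (\<lambda>x. (g (lie (snd z) x) - lie (fst z) (g x)) + (g (lie (snd w) x) - lie (fst w) (g x)))"
    by (simp add: lie_add_left endomorphism_add[OF assms(2)] fun_eq_iff)
  then show ?thesis by (simp add: rho_def dirderiv_linear(1)[OF assms(1)])
qed

lemma rho_scale_left:
  assumes "p \<in> poly_functions" "endomorphism g"
  shows "rho (scale_pair c z) p g = c * rho z p g"
proof -
  have "(\<lambda>x. g (lie (snd (scale_pair c z)) x) - lie (fst (scale_pair c z)) (g x)) =
      (\<lambda>x. c *\<^sub>C (g (lie (snd z) x) - lie (fst z) (g x)))"
    by (simp add: scale_pair_def lie_scale_left endomorphism_scale[OF assms(2)] fun_eq_iff
        cvs.scale_right_diff_distrib)
  then show ?thesis by (simp add: rho_def dirderiv_linear(2)[OF assms(1)])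
qed

lemma rho_zero_left: "p \<in> poly_functions \<Longrightarrow> endomorphism g \<Longrightarrow> rho 0 p g = 0"
  using rho_add_left[of p g 0 0] by simp

lemma rho_sum_left:
  assumes "p \<in> poly_functions" "endomorphism g"
  shows "rho (\<Sum>i\<in>I. scale_pair (c i) (z i)) p g = (\<Sum>i\<in>I. c i * rho (z i) p g)"
  by (induction I rule: infinite_finite_induct)
    (simp_all add: rho_zero_left rho_add_left rho_scale_left assms)

lemma rho_minus_left:
  assumes "p \<in> poly_functions" "endomorphism g"
  shows "rho (- z) p g = - rho z p g"
  using rho_add_left[OF assms, of z "- z"] rho_zero_left[OF assms]
  by (simp add: eq_neg_iff_add_eq_0 add.commute)

lemma scale_pair_simps [simp]:
  "fst (scale_pair c z) = c *\<^sub>C fst z" "snd (scale_pair c z) = c *\<^sub>C snd z"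
  by (simp_all add: scale_pair_def)

lemma lie_pair_simps [simp]:
  "fst (lie_pair z w) = lie (fst z) (fst w)" "snd (lie_pair z w) = lie (snd z) (snd w)"
  by (simp_all add: lie_pair_def)

text \<open>\<open>centerless\<close> is the form in which semisimplicity enters: it makes
  \<open>lie\<close> faithful and, through the form, makes commutators span.\<close>

locale invariant_nondegenerate =
  fixes B :: "'g::complex_lie_algebra \<Rightarrow> 'g \<Rightarrow> complex"
  assumes form_invariant: "invariant_form B"
    and form_nondegenerate: "nondegenerate_form B"
    and centerless: "(\<And>x. lie c x = 0) \<Longrightarrow> c = (0::'g)"
begin

lemma form_functional: "functional (B x)"
  using form_invariant by (simp add: invariant_form_def)

lemma form_sym: "B x y = B y x"
  using form_invariant by (auto simp: invariant_form_def)

lemma form_lie: "B (lie x y) z = B x (lie y z)"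
  using form_invariant by (auto simp: invariant_form_def)

lemma form_functional_left: "functional (\<lambda>x. B x y)"
proof -
  have "(\<lambda>x. B x y) = B y" by (rule ext) (rule form_sym)
  then show ?thesis using form_functional by simp
qed

lemmas form_simps =
  functional_add[OF form_functional] functional_scale[OF form_functional]
  functional_neg[OF form_functional] functional_diff[OF form_functional]
  functional_0[OF form_functional]
  functional_add[OF form_functional_left] functional_scale[OF form_functional_left]
  functional_neg[OF form_functional_left] functional_diff[OF form_functional_left]
  functional_0[OF form_functional_left]

lemma form_eqI:
  assumes "\<And>y. B x y = B x' y"
  shows "x = x'"
proof -
  have "\<forall>y. B (x - x') y = 0" using assms by (simp add: form_simps)
  then have "x - x' = 0" using form_nondegenerate unfolding nondegenerate_form_def by blast
  then show ?thesis by simp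
qed

lemma form_eqI_basis:
  assumes "\<And>\<nu>. \<nu> \<in> lie_basis \<Longrightarrow> B x \<nu> = B x' \<nu>"
  shows "x = x'"
proof (rule form_eqI)
  fix y
  show "B x y = B x' y"
    unfolding functional_expand[OF form_functional, of x y] functional_expand[OF form_functional, of x' y]
    using assms by (intro sum.cong refl) simp
qed

text \<open>The map f, which uses the values \<open>B x \<mu>\<close> as coordinates, is injective
  and hence surjective; u is a preimage of the vector with coordinates
  \<open>\<xi> \<mu>\<close>.\<close>

lemma riesz:
  assumes \<xi>: "functional \<xi>"
  shows "\<exists>u. \<xi> = B u"
proof -
  define f where "f x = (\<Sum>\<mu>\<in>lie_basis. B x \<mu> *\<^sub>C \<mu>)" for x
  have f: "endomorphism f"
    by (rule endomorphismI)
      (simp_all add: f_def form_simps scaleC_add_left sum.distrib cvs.scale_sum_right scaleC_scaleC)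
  have coord_f: "coord \<nu> (f x) = B x \<nu>" if "\<nu> \<in> lie_basis" for \<nu> x
    using that by (simp add: f_def functional_sum[OF functional_coord] coord_scale coord_basis
        finite_lie_basis if_distrib cong: if_cong)
  have "inj f"
  proof (rule injI)
    fix x y assume "f x = f y"
    then have "B x \<nu> = B y \<nu>" if "\<nu> \<in> lie_basis" for \<nu> using coord_f[OF that] by metis
    then show "x = y" by (rule form_eqI_basis)
  qed
  then have "surj f" using cvs.linear_inj_imp_surj[OF f] by simp
  then obtain u where u: "(\<Sum>\<mu>\<in>lie_basis. \<xi> \<mu> *\<^sub>C \<mu>) = f u" by (metis surj_def)
  have "B u \<nu> = \<xi> \<nu>" if "\<nu> \<in> lie_basis" for \<nu>
    using coord_f[OF that, of u] that
    by (simp add: u[symmetric] functional_sum[OF functional_coord] coord_scale coord_basis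
        finite_lie_basis if_distrib cong: if_cong)
  then have "\<xi> x = B u x" for x
    by (simp add: functional_expand[OF \<xi>, of x] functional_expand[OF form_functional, of u x])
  then show ?thesis by blast
qed

lemma form_dual_vector:
  assumes "\<mu> \<in> lie_basis"
  shows "B (dual_vector B \<mu>) x = coord \<mu> x"
proof -
  obtain u where u: "coord \<mu> = B u" using riesz[OF functional_coord] by blast
  have "\<forall>\<nu>\<in>lie_basis. B \<nu> (dual_vector B \<mu>) = (if \<nu> = \<mu> then 1 else 0)"
    unfolding dual_vector_def
  proof (rule theI[of _ u])
    show *: "\<forall>\<nu>\<in>lie_basis. B \<nu> u = (if \<nu> = \<mu> then 1 else 0)"
      using coord_basis[of _ \<mu>] form_sym[of _ u] by (auto simp: u)
    fix v assume "\<forall>\<nu>\<in>lie_basis. B \<nu> v = (if \<nu> = \<mu> then 1 else 0)"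
    then have "B v \<nu> = B u \<nu>" if "\<nu> \<in> lie_basis" for \<nu>
      using * that form_sym[of \<nu>] by metis
    then show "v = u" by (rule form_eqI_basis)
  qed
  then have "B (dual_vector B \<mu>) \<nu> = (if \<nu> = \<mu> then 1 else 0)" if "\<nu> \<in> lie_basis" for \<nu>
    using that form_sym by metis
  then have "(\<Sum>\<nu>\<in>lie_basis. coord \<nu> x * B (dual_vector B \<mu>) \<nu>) =
      (\<Sum>\<nu>\<in>lie_basis. if \<nu> = \<mu> then coord \<nu> x else 0)"
    by (intro sum.cong refl) simp
  then show ?thesis
    using assms functional_expand[OF form_functional, of "dual_vector B \<mu>" x]
    by (simp add: finite_lie_basis)
qed

lemma sum_form_dual_vector: "(\<Sum>\<mu>\<in>lie_basis. B u \<mu> *\<^sub>C dual_vector B \<mu>) = u"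
  by (rule form_eqI_basis)
    (simp add: functional_sum[OF form_functional_left] form_simps form_dual_vector coord_basis
      finite_lie_basis if_distrib cong: if_cong)

lemma form_tensor_eq: "\<mu> \<in> lie_basis \<Longrightarrow> form_tensor B \<mu> \<nu> = coord \<nu> (dual_vector B \<mu>)"
  by (simp add: form_tensor_def tensor_def coord_basis finite_lie_basis if_distrib[of "\<lambda>c. c * _"] cong: if_cong)

lemma sum_form_tensor: "\<mu> \<in> lie_basis \<Longrightarrow> (\<Sum>\<nu>\<in>lie_basis. form_tensor B \<mu> \<nu> *\<^sub>C \<nu>) = dual_vector B \<mu>"
  by (simp add: form_tensor_eq sum_coord)

lemma pairing_form_tensor:
  assumes \<eta>: "functional \<eta>"
  shows "pairing (form_tensor B) (B u) \<eta> = \<eta> u"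
proof -
  have "pairing (form_tensor B) (B u) \<eta> = (\<Sum>\<mu>\<in>lie_basis. B u \<mu> * \<eta> (dual_vector B \<mu>))"
    unfolding pairing_def
    by (intro sum.cong refl)
      (simp add: form_tensor_eq functional_expand[OF \<eta>, of "dual_vector B _"] sum_distrib_left mult_ac)
  also have "\<dots> = \<eta> (\<Sum>\<mu>\<in>lie_basis. B u \<mu> *\<^sub>C dual_vector B \<mu>)"
    by (simp add: functional_sum[OF \<eta>] functional_scale[OF \<eta>])
  finally show ?thesis by (simp add: sum_form_dual_vector)
qed

text \<open>In terms of Riesz vectors, composing the first functional with h replaces u by
  \<open>inv h u\<close>, and evaluating the second one after h undoes this.\<close>

lemma pairing_form_tensor_Aut:
  assumes h: "h \<in> Aut_form B" and \<xi>: "functional \<xi>" and \<eta>: "functional \<eta>"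
  shows "pairing (form_tensor B) (\<lambda>a. \<xi> (h a)) (\<lambda>a. \<eta> (h a)) = pairing (form_tensor B) \<xi> \<eta>"
proof -
  obtain u where u: "\<xi> = B u" using riesz[OF \<xi>] by blast
  have "(\<lambda>a. \<xi> (h a)) = B (inv h u)"
    using Aut_form_form[OF h, of "inv h u"] by (simp add: u Aut_form_inv_apply[OF h] fun_eq_iff)
  then show ?thesis
    using pairing_form_tensor[OF functional_comp[OF \<eta> Aut_form_endomorphism[OF h]]]
    by (simp add: u pairing_form_tensor[OF \<eta>] Aut_form_inv_apply[OF h])
qed

section \<open>The form on the double and gradients of functions\<close>

abbreviation dform where "dform \<equiv> double_form B"

lemma dform_add_left: "dform (z + z') w = dform z w + dform z' w"
  and dform_add_right: "dform w (z + z') = dform w z + dform w z'"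
  and dform_neg_right: "dform w (- z) = - dform w z"
  and dform_scale_left: "dform (scale_pair c z) w = c * dform z w"
  and dform_0_left: "dform 0 w = 0"
  by (simp_all add: double_form_def form_simps algebra_simps)

lemma dform_sum_left: "dform (\<Sum>i\<in>I. z i) w = (\<Sum>i\<in>I. dform (z i) w)"
  by (induction I rule: infinite_finite_induct) (simp_all add: dform_0_left dform_add_left)

lemma dform_sym: "dform z w = dform w z"
  by (simp add: double_form_def form_sym)

lemma dform_lie: "dform (lie_pair x y) z = dform x (lie_pair y z)"
  by (simp add: double_form_def form_lie)

lemma lie_pair_skew: "lie_pair z w = - lie_pair w z"
  using lie_skew[of "fst z"] lie_skew[of "snd z"] by (simp add: prod_eq_iff)

lemma lie_pair_add_left: "lie_pair (z + z') w = lie_pair z w + lie_pair z' w"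
  and lie_pair_add_right: "lie_pair w (z + z') = lie_pair w z + lie_pair w z'"
  by (simp_all add: prod_eq_iff lie_add_left lie_add_right)

lemma graph_isotropic: "g \<in> Aut_form B \<Longrightarrow> z \<in> graph_subalgebra g \<Longrightarrow> w \<in> graph_subalgebra g \<Longrightarrow> dform z w = 0"
  by (auto simp: graph_subalgebra_def double_form_def Aut_form_form)

lemma graph_lie: "g \<in> Aut_form B \<Longrightarrow> z \<in> graph_subalgebra g \<Longrightarrow> w \<in> graph_subalgebra g \<Longrightarrow> lie_pair z w \<in> graph_subalgebra g"
  by (auto simp: graph_subalgebra_def lie_pair_def Aut_form_lie)

text \<open>The cotangent space of \<open>Aut_form B\<close> at \<open>g\<close>, carried into \<open>\<gg> \<times> \<gg>\<close> by the action, is the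
  Lagrangian subalgebra given by the graph of \<open>g\<close>.\<close>

definition gradient :: "(('g \<Rightarrow> 'g) \<Rightarrow> complex) \<Rightarrow> ('g \<Rightarrow> 'g) \<Rightarrow> 'g \<times> 'g" where
  "gradient p g = (SOME d. d \<in> graph_subalgebra g \<and> (\<forall>z. rho z p g = dform d z))"

lemma gradient:
  assumes p: "p \<in> poly_functions" and g: "g \<in> Aut_form B"
  shows gradient_graph: "gradient p g \<in> graph_subalgebra g"
    and rho_gradient: "rho z p g = dform (gradient p g) z"
proof -
  obtain u where u: "(\<lambda>c. dirderiv p g (\<lambda>x. lie c (g x))) = B u"
    using riesz[OF functional_dirderiv[OF p]] by blast
  \<comment> \<open>For \<open>z = (x, y)\<close> the derivative is \<open>B u (g y - x)\<close>.
    Moving g to the other argument gives \<open>B (inv g u) y - B u x\<close>, which is the double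
    form of \<open>(- u, - inv g u)\<close> with z.\<close>
  have "(- u, - inv g u) \<in> graph_subalgebra g"
    using Aut_form_endomorphism[OF g] by (simp add: graph_subalgebra_def endomorphism_neg Aut_form_inv_apply[OF g])
  moreover have "rho z p g = dform (- u, - inv g u) z" for z
    using rho_eq[OF p Aut_form_endomorphism[OF g] Aut_form_lie[OF g], of z] fun_cong[OF u]
      Aut_form_form[OF g, of "inv g u" "snd z"]
    by (simp add: double_form_def form_simps Aut_form_inv_apply[OF g])
  ultimately have "\<exists>d. d \<in> graph_subalgebra g \<and> (\<forall>z. rho z p g = dform d z)" by blast
  then have "gradient p g \<in> graph_subalgebra g \<and> (\<forall>z. rho z p g = dform (gradient p g) z)"
    unfolding gradient_def by (rule someI_ex)
  then show "gradient p g \<in> graph_subalgebra g" "rho z p g = dform (gradient p g) z" by blast+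
qed

lemma rho_graph_eq_0:
  assumes p: "p \<in> poly_functions" and g: "g \<in> Aut_form B" and z: "z \<in> graph_subalgebra g"
  shows "rho z p g = 0"
  using rho_gradient[OF p g] graph_isotropic[OF g gradient_graph[OF p g] z] by simp

text \<open>Since the Lie algebra has no centre, commutators span it, and already linear functions have
  arbitrary differentials.\<close>

lemma dirderiv_surj:
  assumes \<zeta>: "functional \<zeta>" and g: "g \<in> Aut_form B"
  shows "\<exists>p\<in>poly_functions. \<forall>c. dirderiv p g (\<lambda>x. lie c (g x)) = \<zeta> c"
proof -
  define U where "U = {u. \<exists>p\<in>poly_functions. \<forall>c. dirderiv p g (\<lambda>x. lie c (g x)) = B u c}"
  have U: "cvs.subspace U"
    unfolding cvs.subspace_def
  proof (intro conjI ballI allI)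
    show "0 \<in> U"
      unfolding U_def by (intro CollectI bexI[of _ "\<lambda>_. 0"]) (simp_all add: form_simps poly_functions.const)
  next
    fix x y assume "x \<in> U" "y \<in> U"
    then obtain p q where "p \<in> poly_functions" "\<forall>c. dirderiv p g (\<lambda>x. lie c (g x)) = B x c"
      "q \<in> poly_functions" "\<forall>c. dirderiv q g (\<lambda>x. lie c (g x)) = B y c"
      unfolding U_def by blast
    then show "x + y \<in> U"
      unfolding U_def
      by (intro CollectI bexI[OF _ poly_functions.add[of p q]]) (simp_all add: dirderiv_add form_simps)
  next
    fix c x assume "x \<in> U"
    then show "c *\<^sub>C x \<in> U"
      unfolding U_def
      by (clarify, intro bexI[OF _ poly_scale[of _ c]])
        (auto simp add: dirderiv_mult poly_functions.const form_simps)
  qed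
  \<comment> \<open>The witness is the matrix coefficient sending a map f to
    \<open>B y (f (inv g x))\<close>; its derivative in direction c is
    \<open>B y (lie c x) = B (lie x y) c\<close>.\<close>
  have comm: "lie x y \<in> U" for x y
  proof -
    have "dirderiv (\<lambda>g. B y (g (inv g' x))) g (\<lambda>x. lie c (g x)) = B y (lie c (g (inv g' x)))" for c g'
      by (simp add: dirderiv_coeff form_functional)
    moreover have "B y (lie c x) = B (lie x y) c" for c
      using form_sym[of y "lie c x"] form_sym[of c "lie x y"] by (simp add: form_lie)
    ultimately show ?thesis
      unfolding U_def
      by (intro CollectI bexI[OF _ poly_functions.coeff[OF form_functional[of y], of "inv g x"]])
        (simp add: Aut_form_inv_apply[OF g])
  qed
  obtain u where u: "\<zeta> = B u" using riesz[OF \<zeta>] by blast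
  have "u \<in> U"
  proof (rule ccontr)
    assume "u \<notin> U"
    then obtain \<xi> where \<xi>: "functional \<xi>" "\<And>v. v \<in> U \<Longrightarrow> \<xi> v = 0" "\<xi> u = 1"
      using functional_separates[OF U] by metis
    obtain c where c: "\<xi> = B c" using riesz[OF \<xi>(1)] by blast
    have "B (lie c x) y = B 0 y" for x y
      using \<xi>(2)[OF comm, of x y] by (simp add: c form_lie form_simps)
    then have "lie c x = 0" for x by (rule form_eqI)
    then have "c = 0" by (rule centerless)
    then show False using \<xi>(3) by (simp add: c form_simps)
  qed
  then show ?thesis by (simp add: U_def u)
qed

end

text \<open>All that is used about the complement \<open>\<mm>\<close> of the diagonal and about \<open>r\<close>.\<close>

locale manin_complement = invariant_nondegenerate B
  for B :: "'g::complex_lie_algebra \<Rightarrow> 'g \<Rightarrow> complex" +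
  fixes \<mm> :: "('g \<times> 'g) set" and r :: "'g tensor"
  assumes mm_0: "0 \<in> \<mm>"
    and mm_add: "z \<in> \<mm> \<Longrightarrow> w \<in> \<mm> \<Longrightarrow> z + w \<in> \<mm>"
    and mm_scale: "z \<in> \<mm> \<Longrightarrow> scale_pair c z \<in> \<mm>"
    and mm_isotropic: "z \<in> \<mm> \<Longrightarrow> w \<in> \<mm> \<Longrightarrow> double_form B z w = 0"
    and mm_lie: "z \<in> \<mm> \<Longrightarrow> w \<in> \<mm> \<Longrightarrow> lie_pair z w \<in> \<mm>"
    and mm_r: "\<mu> \<in> lie_basis \<Longrightarrow>
      (- (\<Sum>\<nu>\<in>lie_basis. r \<mu> \<nu> *\<^sub>C \<nu>), \<Sum>\<nu>\<in>lie_basis. r \<nu> \<mu> *\<^sub>C \<nu>) \<in> \<mm>"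
    and r_sym: "\<mu> \<in> lie_basis \<Longrightarrow> \<nu> \<in> lie_basis \<Longrightarrow> r \<mu> \<nu> + r \<nu> \<mu> = form_tensor B \<mu> \<nu>"
begin

text \<open>Up to sign, the basis of \<mm> dual to the diagonal vectors
  \<open>(\<mu>, \<mu>)\<close> under the double form, built from the two contractions of r.\<close>

definition mdual :: "'g \<Rightarrow> 'g \<times> 'g" where
  "mdual \<mu> = (- (\<Sum>\<nu>\<in>lie_basis. r \<mu> \<nu> *\<^sub>C \<nu>), \<Sum>\<nu>\<in>lie_basis. r \<nu> \<mu> *\<^sub>C \<nu>)"

lemma mdual_mm: "\<mu> \<in> lie_basis \<Longrightarrow> mdual \<mu> \<in> \<mm>"
  by (simp add: mdual_def mm_r)

lemma dform_mdual:
  assumes "\<mu> \<in> lie_basis"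
  shows "dform (a, a) (mdual \<mu>) = - coord \<mu> a"
proof -
  have "(\<Sum>\<nu>\<in>lie_basis. r \<mu> \<nu> *\<^sub>C \<nu>) + (\<Sum>\<nu>\<in>lie_basis. r \<nu> \<mu> *\<^sub>C \<nu>) = dual_vector B \<mu>"
    unfolding sum_form_tensor[OF assms, symmetric]
    using assms by (simp add: r_sym[symmetric] scaleC_add_left sum.distrib)
  then have "dform (a, a) (mdual \<mu>) = - B a (dual_vector B \<mu>)"
    using form_simps(1)[of a "\<Sum>\<nu>\<in>lie_basis. r \<mu> \<nu> *\<^sub>C \<nu>" "\<Sum>\<nu>\<in>lie_basis. r \<nu> \<mu> *\<^sub>C \<nu>"]
    unfolding mdual_def double_form_def by (simp add: form_simps)
  then show ?thesis using form_dual_vector[OF assms] form_sym by metis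
qed

text \<open>The projection of \<open>\<gg> \<times> \<gg>\<close> to \<open>\<mm>\<close> along the diagonal.\<close>

definition mpart :: "'g \<times> 'g \<Rightarrow> 'g \<times> 'g" where
  "mpart d = (\<Sum>\<mu>\<in>lie_basis. scale_pair (- dform d (\<mu>, \<mu>)) (mdual \<mu>))"

lemma mm_sum: "(\<And>i. i \<in> I \<Longrightarrow> z i \<in> \<mm>) \<Longrightarrow> (\<Sum>i\<in>I. z i) \<in> \<mm>"
  by (induction I rule: infinite_finite_induct) (auto simp: mm_0 mm_add)

lemma mpart_mm: "mpart d \<in> \<mm>"
  unfolding mpart_def by (intro mm_sum mm_scale mdual_mm)

lemma dform_mpart_diag: "dform (mpart d) (a, a) = dform d (a, a)"
proof -
  have "dform (mpart d) (a, a) = (\<Sum>\<mu>\<in>lie_basis. dform d (\<mu>, \<mu>) * coord \<mu> a)"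
    using dform_mdual by (simp add: mpart_def dform_sum_left dform_scale_left dform_sym[of "mdual _"])
  also have "\<dots> = dform d (a, a)"
  proof -
    have "functional (\<lambda>a. dform d (a, a))"
      by (rule functionalI) (simp_all add: double_form_def form_simps algebra_simps)
    then show ?thesis using functional_expand[of "\<lambda>a. dform d (a, a)" a] by (simp add: mult.commute)
  qed
  finally show ?thesis .
qed

lemma dform_diag: "dform d (a, a) = B (fst d - snd d) a"
  by (simp add: double_form_def form_simps)

lemma mpart_diff: "fst (mpart d) - snd (mpart d) = fst d - snd d"
  by (rule form_eqI) (simp add: dform_mpart_diag flip: dform_diag)

definition dpart :: "'g \<times> 'g \<Rightarrow> 'g \<times> 'g" where
  "dpart d = d - mpart d"

lemma mpart_dpart: "mpart d + dpart d = d"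
  by (simp add: dpart_def)

lemma dpart_diag: "dpart d = (fst d - fst (mpart d), fst d - fst (mpart d))"
  using mpart_diff[of d] by (simp add: dpart_def prod_eq_iff algebra_simps)

lemma dpart_isotropic: "dform (dpart d) (dpart e) = 0"
  unfolding dpart_diag by (simp add: double_form_def)

text \<open>The difference y lies in \<mm> and on the diagonal, so it is orthogonal to every
  \<open>mpart (a, 0)\<close>. Since the two components of \<open>mpart (a, 0)\<close> differ by the
  arbitrary vector a, nondegeneracy forces y to vanish.\<close>

lemma mpart_unique:
  assumes "z \<in> \<mm>" "fst z - snd z = fst d - snd d"
  shows "z = mpart d"
proof -
  define y where "y = z + scale_pair (-1) (mpart d)"
  have y: "y \<in> \<mm>" unfolding y_def by (intro mm_add mm_scale assms mpart_mm)
  have "fst z = snd z + (fst (mpart d) - snd (mpart d))"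
    using assms(2) mpart_diff[of d] by (metis diff_add_cancel add.commute)
  then have "fst z - fst (mpart d) = snd z - snd (mpart d)" by simp
  then have y1: "y = (fst y, fst y)"
    by (simp add: y_def prod_eq_iff cvs.scale_minus_left scaleC_one)
  have "B (fst y) a = B 0 a" for a
  proof -
    have "dform y (mpart (a, 0)) = 0" using y mpart_mm by (rule mm_isotropic)
    then show ?thesis
      using mpart_diff[of "(a, 0)"] by (subst (asm) y1) (simp add: double_form_def form_simps flip: form_simps(4))
  qed
  then have "fst y = 0" by (rule form_eqI)
  then have "y = 0" using y1 by (metis zero_prod_def)
  then show ?thesis by (simp add: y_def prod_eq_iff cvs.scale_minus_left scaleC_one eq_neg_iff_add_eq_0)
qed

text \<open>The bivector is minus the canonical element of the double, diagonal tensor \<mm>, acting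
  through \<open>rho\<close>. Being polynomial on all maps, the bracket can be nested without
  choosing extensions.\<close>

definition pbracket :: "('g \<Rightarrow> 'g) bracket" where
  "pbracket p q g = (\<Sum>\<mu>\<in>lie_basis. rho (\<mu>, \<mu>) p g * rho (mdual \<mu>) q g)"

lemma pbracket_poly: "p \<in> poly_functions \<Longrightarrow> q \<in> poly_functions \<Longrightarrow> pbracket p q \<in> poly_functions"
  unfolding pbracket_def[abs_def] by (intro poly_sum poly_functions.mult rho_poly)

lemma pbracket_eq_rho:
  assumes "p \<in> poly_functions" "q \<in> poly_functions" "g \<in> Aut_form B"
  shows "pbracket p q g = - rho (mpart (gradient p g)) q g"
proof -
  have "pbracket p q g = (\<Sum>\<mu>\<in>lie_basis. dform (gradient p g) (\<mu>, \<mu>) * rho (mdual \<mu>) q g)"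
    using rho_gradient[OF assms(1,3)] by (simp add: pbracket_def)
  then show ?thesis
    by (simp add: mpart_def rho_sum_left[OF assms(2) Aut_form_endomorphism[OF assms(3)]] sum_negf)
qed

lemma pbracket_skew:
  assumes p: "p \<in> poly_functions" and q: "q \<in> poly_functions" and g: "g \<in> Aut_form B"
  shows "pbracket p q g = - pbracket q p g"
proof -
  let ?d = "gradient p g" and ?e = "gradient q g"
  have "0 = dform (mpart ?d + dpart ?d) (mpart ?e + dpart ?e)"
    unfolding mpart_dpart using graph_isotropic[OF g gradient_graph[OF p g] gradient_graph[OF q g]] by simp
  also have "\<dots> = dform (mpart ?d) (dpart ?e) + dform (dpart ?d) (mpart ?e)"
    by (simp add: dform_add_left dform_add_right mm_isotropic mpart_mm dpart_isotropic)
  finally have "dform (dpart ?e) (mpart ?d) = - dform (dpart ?d) (mpart ?e)"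
    by (simp add: dform_sym eq_neg_iff_add_eq_0)
  moreover have "dform ?e (mpart ?d) = dform (dpart ?e) (mpart ?d)"
    by (subst mpart_dpart[of ?e, symmetric]) (simp add: dform_add_left mm_isotropic mpart_mm)
  moreover have "dform ?d (mpart ?e) = dform (dpart ?d) (mpart ?e)"
    by (subst mpart_dpart[of ?d, symmetric]) (simp add: dform_add_left mm_isotropic mpart_mm)
  ultimately show ?thesis by (simp add: pbracket_eq_rho p q g rho_gradient)
qed

lemma pbracket_add_left:
  "p \<in> poly_functions \<Longrightarrow> p' \<in> poly_functions \<Longrightarrow> pbracket (\<lambda>g. c * p g + p' g) q g = c * pbracket p q g + pbracket p' q g"
  by (simp add: pbracket_def rho_add rho_scale poly_scale sum.distrib sum_distrib_left algebra_simps)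

lemma pbracket_mult_right:
  "q \<in> poly_functions \<Longrightarrow> q' \<in> poly_functions \<Longrightarrow> pbracket p (\<lambda>g. q g * q' g) g = pbracket p q g * q' g + q g * pbracket p q' g"
  by (simp add: pbracket_def rho_mult sum.distrib sum_distrib_left sum_distrib_right algebra_simps)

text \<open>The gradients of q and t vary with the point. Leibniz' rule for the inner sum
  differentiates one factor at a time and leaves the other evaluated at g, so that the coefficients
  become constants and the sums over the basis collapse to projections at g.\<close>

lemma pbracket_pbracket:
  assumes p: "p \<in> poly_functions" and q: "q \<in> poly_functions" and t: "t \<in> poly_functions"
    and g: "g \<in> Aut_form B"
  shows "pbracket p (pbracket q t) g =
    rho (mpart (gradient p g)) (rho (dpart (gradient t g)) q) g +
    rho (mpart (gradient p g)) (rho (mpart (gradient q g)) t) g"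
proof -
  define P where "P = mpart (gradient p g)"
  define Q where "Q = mpart (gradient q g)"
  define D where "D = dpart (gradient t g)"
  have e: "endomorphism g" by (rule Aut_form_endomorphism[OF g])
  note sums = rho_sum_left[OF _ e, symmetric]
  have comm: "rho P (rho w f) g = rho w (rho P f) g + rho (lie_pair P w) f g" if "f \<in> poly_functions" for w f
    using rho_commutator[OF that e, of P w] by (simp add: algebra_simps)
  have lin: "lie_pair P (\<Sum>i\<in>I. scale_pair (c i) (w i)) = (\<Sum>i\<in>I. scale_pair (c i) (lie_pair P (w i)))"
    for I :: "'g set" and c w
    by (induction I rule: infinite_finite_induct)
      (simp_all add: lie_pair_add_right prod_eq_iff lie_scale_right lie_add_right)
  \<comment> \<open>\<open>rho\<close> is linear in its first argument at endomorphisms only, so the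
    inner occurrence cannot simply be rewritten as a function. The commutator brings it to the
    outside, where it is evaluated at g.\<close>
  have collapse: "(\<Sum>\<nu>\<in>I. c \<nu> * rho P (rho (w \<nu>) f) g) = rho P (rho (\<Sum>\<nu>\<in>I. scale_pair (c \<nu>) (w \<nu>)) f) g"
    if f: "f \<in> poly_functions" for I :: "'g set" and c w f
    unfolding comm[OF f] lin by (simp add: distrib_left sum.distrib sums f rho_poly)
  \<comment> \<open>Pairing with \<mm> sees only the diagonal part of the gradient, and the dual
    basis \<open>mdual\<close> reads off its coordinates with a minus sign.\<close>
  have D: "(\<Sum>\<nu>\<in>lie_basis. scale_pair (rho (mdual \<nu>) t g) (\<nu>, \<nu>)) = - D"
  proof -
    have "rho (mdual \<nu>) t g = - coord \<nu> (fst D)" if "\<nu> \<in> lie_basis" for \<nu>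
    proof -
      have "rho (mdual \<nu>) t g = dform (mpart (gradient t g) + D) (mdual \<nu>)"
        by (simp add: D_def mpart_dpart rho_gradient t g)
      also have "\<dots> = dform D (mdual \<nu>)"
        by (simp add: dform_add_left mm_isotropic mpart_mm mdual_mm that)
      also have "\<dots> = - coord \<nu> (fst D)"
        using dform_mdual[OF that] by (simp add: D_def dpart_diag)
      finally show ?thesis .
    qed
    then have "(\<Sum>\<nu>\<in>lie_basis. scale_pair (rho (mdual \<nu>) t g) (\<nu>, \<nu>)) =
        - ((\<Sum>\<nu>\<in>lie_basis. coord \<nu> (fst D) *\<^sub>C \<nu>), (\<Sum>\<nu>\<in>lie_basis. coord \<nu> (fst D) *\<^sub>C \<nu>))"
      by (simp add: prod_eq_iff fst_sum snd_sum cvs.scale_minus_left sum_negf)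
    also have "\<dots> = - (fst D, fst D)" by (simp only: sum_coord)
    also have "(fst D, fst D) = D" by (simp add: D_def dpart_diag)
    finally show ?thesis .
  qed
  have Q: "(\<Sum>\<nu>\<in>lie_basis. scale_pair (rho (\<nu>, \<nu>) q g) (mdual \<nu>)) = - Q"
    by (simp add: Q_def mpart_def rho_gradient q g prod_eq_iff fst_sum snd_sum cvs.scale_minus_left sum_negf)
  have neg: "rho P (rho (- w) f) g = - rho P (rho w f) g" if "f \<in> poly_functions" for w f
    unfolding comm[OF that]
    using lin[of "\<lambda>_. -1" "\<lambda>_. w" "{0}"]
    by (simp add: rho_minus_left[OF _ e] rho_poly that prod_eq_iff lie_neg_right
        rho_minus_left[OF that e, symmetric] lie_pair_def)
  have "pbracket p (pbracket q t) g = - rho P (pbracket q t) g"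
    by (simp add: pbracket_eq_rho P_def p g pbracket_poly q t)
  also have "rho P (pbracket q t) g =
      (\<Sum>\<nu>\<in>lie_basis. rho (mdual \<nu>) t g * rho P (rho (\<nu>, \<nu>) q) g) +
      (\<Sum>\<nu>\<in>lie_basis. rho (\<nu>, \<nu>) q g * rho P (rho (mdual \<nu>) t) g)"
    unfolding pbracket_def[abs_def]
    by (subst rho_sum)
      (simp_all add: rho_mult rho_poly q t poly_functions.mult sum.distrib mult.commute)
  also have "\<dots> = rho P (rho (- D) q) g + rho P (rho (- Q) t) g"
    unfolding collapse[OF q] collapse[OF t] D Q ..
  also have "\<dots> = - (rho P (rho D q) g + rho P (rho Q t) g)"
    by (simp add: neg[OF q] neg[OF t])
  finally show ?thesis by (simp add: P_def Q_def D_def)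
qed

lemma pbracket_jacobi:
  assumes p: "p \<in> poly_functions" and q: "q \<in> poly_functions" and t: "t \<in> poly_functions"
    and g: "g \<in> Aut_form B"
  shows "pbracket p (pbracket q t) g + pbracket q (pbracket t p) g + pbracket t (pbracket p q) g = 0"
proof -
  define P where "P = mpart (gradient p g)"
  define Q where "Q = mpart (gradient q g)"
  define T where "T = mpart (gradient t g)"
  define P' where "P' = dpart (gradient p g)"
  define Q' where "Q' = dpart (gradient q g)"
  define T' where "T' = dpart (gradient t g)"
  have e: "endomorphism g" by (rule Aut_form_endomorphism[OF g])
  \<comment> \<open>The whole gradient acts by zero at g, so there its \<mm>-part acts as minus its
    diagonal part. Applied to the outer field in three of the six second-order terms, this makes the
    six pair off into commutators.\<close>
  have kill: "rho (mpart (gradient f g)) h g = - rho (dpart (gradient f g)) h g"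
    if "f \<in> poly_functions" "h \<in> poly_functions" for f h
    using rho_add_left[OF that(2) e, of "mpart (gradient f g)" "dpart (gradient f g)"]
      rho_graph_eq_0[OF that(2) g gradient_graph[OF that(1) g]]
    by (simp add: mpart_dpart eq_neg_iff_add_eq_0)
  have comm: "rho z (rho w f) g = rho w (rho z f) g + rho (lie_pair z w) f g" if "f \<in> poly_functions" for z w f
    using rho_commutator[OF that e, of z w] by (simp add: algebra_simps)
  have "pbracket p (pbracket q t) g + pbracket q (pbracket t p) g + pbracket t (pbracket p q) g
     = rho P (rho T' q) g + rho P (rho Q t) g + (rho Q (rho P' t) g + rho Q (rho T p) g)
      + (rho T (rho Q' p) g + rho T (rho P q) g)"
    by (simp add: pbracket_pbracket p q t g P_def Q_def T_def P'_def Q'_def T'_def)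
  also have "\<dots> = rho (lie_pair P T') q g + rho (lie_pair Q P') t g + rho (lie_pair T Q') p g"
    using kill[OF p rho_poly[OF t], of Q] kill[OF q rho_poly[OF p], of T] kill[OF t rho_poly[OF q], of P]
      comm[OF q, of P T'] comm[OF t, of Q P'] comm[OF p, of T Q']
    unfolding P_def[symmetric] Q_def[symmetric] T_def[symmetric] P'_def[symmetric] Q'_def[symmetric] T'_def[symmetric]
    by simp
  also have "\<dots> = dform (Q + Q') (lie_pair P T') + dform (T + T') (lie_pair Q P') + dform (P + P') (lie_pair T Q')"
    by (simp add: rho_gradient p q t g P_def Q_def T_def P'_def Q'_def T'_def mpart_dpart)
  \<comment> \<open>The right-hand side expands into eight terms. The two lying purely in \<mm> or
    purely on the diagonal vanish, both being isotropic subalgebras; invariance and skewness match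
    the other six with the left.\<close>
  also have "\<dots> = - dform (P + P') (lie_pair (Q + Q') (T + T'))"
  proof -
    have rot: "dform x (lie_pair y z) = dform y (lie_pair z x)" for x y z
      using dform_lie[of y z x] dform_sym[of x "lie_pair y z"] by simp
    have flip: "dform x (lie_pair y z) = - dform x (lie_pair z y)" for x y z
      by (subst lie_pair_skew) (rule dform_neg_right)
    have m0: "dform P (lie_pair Q T) = 0"
      by (simp add: P_def Q_def T_def mm_isotropic mm_lie mpart_mm)
    have d0: "dform P' (lie_pair Q' T') = 0"
      by (simp add: P'_def Q'_def T'_def dpart_diag double_form_def)
    have 1: "dform Q (lie_pair P T') = - dform P (lie_pair Q T')" using rot flip by metis
    have 2: "dform Q' (lie_pair P T') = - dform P (lie_pair Q' T')" using rot flip by metis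
    have 3: "dform T (lie_pair Q P') = - dform P' (lie_pair Q T)" using rot flip by metis
    have 4: "dform T' (lie_pair Q P') = - dform P' (lie_pair Q T')" using rot flip by metis
    have 5: "dform P (lie_pair T Q') = - dform P (lie_pair Q' T)" by (rule flip)
    have 6: "dform P' (lie_pair T Q') = - dform P' (lie_pair Q' T)" by (rule flip)
    show ?thesis
      by (simp add: dform_add_left dform_add_right lie_pair_add_left lie_pair_add_right 1 2 3 4 5 6 m0 d0)
  qed
  also have "\<dots> = 0"
    using graph_isotropic[OF g _ graph_lie[OF g]] gradient_graph[OF _ g] p q t
    by (simp add: P_def Q_def T_def P'_def Q'_def T'_def mpart_dpart)
  finally show ?thesis .
qed

end

subsection \<open>The action by conjugation\<close>

lemma finite_enumeration:
  assumes "finite I"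
  obtains e where "bij_betw e {..<card I} I"
  using ex_bij_betw_nat_finite[OF assms] by (auto simp: atLeast0LessThan)

text \<open>Members of \<open>product_functions\<close> are sums over an initial segment of the
  naturals; this allows any finite index set, such as pairs of basis vectors.\<close>

lemma product_functionsI:
  assumes "finite I" and mem: "\<And>i. i \<in> I \<Longrightarrow> \<phi> i \<in> A" "\<And>i. i \<in> I \<Longrightarrow> \<psi> i \<in> C"
    and eq: "\<And>x y. x \<in> M \<Longrightarrow> y \<in> N \<Longrightarrow> \<Phi> (x, y) = (\<Sum>i\<in>I. \<phi> i x * \<psi> i y)"
  shows "\<Phi> \<in> product_functions M N A C"
proof -
  obtain e where e: "bij_betw e {..<card I} I" using finite_enumeration[OF assms(1)] .
  have "(\<Sum>i\<in>I. \<phi> i x * \<psi> i y) = (\<Sum>k<card I. \<phi> (e k) x * \<psi> (e k) y)" for x y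
    by (rule sum.reindex_bij_betw[OF e, symmetric])
  moreover have "e k \<in> I" if "k < card I" for k using e that by (auto simp: bij_betw_def)
  ultimately show ?thesis
    unfolding product_functions_def using mem eq
    by (intro CollectI exI[of _ "card I"] exI[of _ "\<lambda>k. \<phi> (e k)"] exI[of _ "\<lambda>k. \<psi> (e k)"]) auto
qed

lemma product_functions_add:
  assumes "\<Phi> \<in> product_functions M N A C" "\<Psi> \<in> product_functions M N A C"
  shows "(\<lambda>z. \<Phi> z + \<Psi> z) \<in> product_functions M N A C"
proof -
  obtain n :: nat and \<phi> \<psi> where 1: "\<And>i. i < n \<Longrightarrow> \<phi> i \<in> A" "\<And>i. i < n \<Longrightarrow> \<psi> i \<in> C"
    "\<And>x y. x \<in> M \<Longrightarrow> y \<in> N \<Longrightarrow> \<Phi> (x, y) = (\<Sum>i<n. \<phi> i x * \<psi> i y)"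
    using assms(1) unfolding product_functions_def by blast
  obtain n' :: nat and \<phi>' \<psi>' where 2: "\<And>i. i < n' \<Longrightarrow> \<phi>' i \<in> A" "\<And>i. i < n' \<Longrightarrow> \<psi>' i \<in> C"
    "\<And>x y. x \<in> M \<Longrightarrow> y \<in> N \<Longrightarrow> \<Psi> (x, y) = (\<Sum>i<n'. \<phi>' i x * \<psi>' i y)"
    using assms(2) unfolding product_functions_def by blast
  show ?thesis
    by (rule product_functionsI[of "{..<n} <+> {..<n'}" "case_sum \<phi> \<phi>'" A "case_sum \<psi> \<psi>'"])
      (auto simp: 1 2 sum.Plus)
qed

lemma product_functions_mult:
  assumes A: "function_algebra A" and C: "function_algebra C"
    and "\<Phi> \<in> product_functions M N A C" "\<Psi> \<in> product_functions M N A C"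
  shows "(\<lambda>z. \<Phi> z * \<Psi> z) \<in> product_functions M N A C"
proof -
  obtain n :: nat and \<phi> \<psi> where 1: "\<And>i. i < n \<Longrightarrow> \<phi> i \<in> A" "\<And>i. i < n \<Longrightarrow> \<psi> i \<in> C"
    "\<And>x y. x \<in> M \<Longrightarrow> y \<in> N \<Longrightarrow> \<Phi> (x, y) = (\<Sum>i<n. \<phi> i x * \<psi> i y)"
    using assms(3) unfolding product_functions_def by blast
  obtain n' :: nat and \<phi>' \<psi>' where 2: "\<And>i. i < n' \<Longrightarrow> \<phi>' i \<in> A" "\<And>i. i < n' \<Longrightarrow> \<psi>' i \<in> C"
    "\<And>x y. x \<in> M \<Longrightarrow> y \<in> N \<Longrightarrow> \<Psi> (x, y) = (\<Sum>i<n'. \<phi>' i x * \<psi>' i y)"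
    using assms(4) unfolding product_functions_def by blast
  show ?thesis
  proof (rule product_functionsI[of "{..<n} \<times> {..<n'}" "\<lambda>(i, j) x. \<phi> i x * \<phi>' j x" A "\<lambda>(i, j) y. \<psi> i y * \<psi>' j y"])
    fix x y assume "x \<in> M" "y \<in> N"
    then have "\<Phi> (x, y) * \<Psi> (x, y) = (\<Sum>i<n. \<Sum>j<n'. (\<phi> i x * \<psi> i y) * (\<phi>' j x * \<psi>' j y))"
      by (simp add: 1 2 sum_product)
    also have "\<dots> = (\<Sum>i<n. \<Sum>j<n'. (\<phi> i x * \<phi>' j x) * (\<psi> i y * \<psi>' j y))"
      by (intro sum.cong refl) (simp add: mult_ac)
    finally show "\<Phi> (x, y) * \<Psi> (x, y) = (\<Sum>i\<in>{..<n} \<times> {..<n'}.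
        (case i of (i, j) \<Rightarrow> \<lambda>x. \<phi> i x * \<phi>' j x) x * (case i of (i, j) \<Rightarrow> \<lambda>y. \<psi> i y * \<psi>' j y) y)"
      by (simp add: sum.cartesian_product split_beta)
  qed (use A C in \<open>auto simp: 1 2 function_algebra_def\<close>)
qed

lemma poly_conjugation:
  assumes h: "endomorphism h"
  shows "p \<in> poly_functions \<Longrightarrow> (\<lambda>m. p (conjugation h m)) \<in> poly_functions"
proof (induction rule: poly_functions.induct)
  case (coeff \<xi> x)
  then show ?case
    using poly_functions.coeff[OF functional_comp[OF coeff h], of "inv h x"]
    by (simp add: conjugation_def)
qed (simp_all add: poly_functions.intros)

text \<open>Conjugation is linear in m, so it carries a tangent vector X at m to h X
  \<open>inv h\<close>; as h is an automorphism, this is again a vector of the action, with both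
  components moved by h.\<close>

lemma rho_conjugation:
  assumes h: "h \<in> Aut_form B"
  shows "rho z (\<lambda>m. p (conjugation h m)) m = rho (h (fst z), h (snd z)) p (conjugation h m)"
proof -
  have e: "endomorphism h" using h by (rule Aut_form_endomorphism)
  have "dirderiv (\<lambda>m. p (conjugation h m)) m X = dirderiv p (conjugation h m) (\<lambda>x. h (X (inv h x)))" for X
    by (simp add: dirderiv_def conjugation_def comp_def endomorphism_add[OF e] endomorphism_scale[OF e])
  moreover have "conjugation h m (lie (h y) x) = h (m (lie y (inv h x)))" for y x
    by (simp add: conjugation_def Aut_form_lie[OF Aut_form_inv[OF h]] Aut_form_inv_apply[OF h])
  ultimately show ?thesis
    by (simp add: rho_def endomorphism_diff[OF e] Aut_form_lie[OF h]) (simp add: conjugation_def)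
qed

text \<open>Moving h past the exponential replaces a by \<open>h a\<close>. This is why
  left-invariant fields on the group appear on the space as differentials evaluated at
  \<open>h a\<close>.\<close>

lemma conjugation_Exp:
  assumes h: "h \<in> Aut_form B"
  shows "conjugation (h \<circ> Exp a) m = conjugation (Exp (h a)) (conjugation h m)"
proof -
  have "h \<circ> Exp a = Exp (h a) \<circ> h"
    using lie_hom_Exp[OF Aut_form_endomorphism[OF h] Aut_form_lie[OF h]] by (simp add: fun_eq_iff)
  then show ?thesis using Aut_form_bij[OF h] by (simp add: conjugation_comp bij_Exp)
qed

lemma pairing_contract: "functional \<eta> \<Longrightarrow> pairing T \<xi> \<eta> = \<eta> (contract \<xi> T)"
  by (simp add: pairing_def contract_def functional_sum functional_scale)

lemma pairing_add_tensor: "pairing (\<lambda>\<mu> \<nu>. S \<mu> \<nu> + T \<mu> \<nu>) \<xi> \<eta> = pairing S \<xi> \<eta> + pairing T \<xi> \<eta>"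
  by (simp add: pairing_def algebra_simps sum.distrib)

lemma sum_tensor_space: "finite I \<Longrightarrow> (\<lambda>\<mu> \<nu>. \<Sum>i\<in>I. tensor (u i) (v i) \<mu> \<nu>) \<in> tensor_space UNIV UNIV"
proof -
  assume "finite I"
  then obtain e where e: "bij_betw e {..<card I} I" using finite_enumeration by blast
  have "(\<Sum>i\<in>I. tensor (u i) (v i) \<mu> \<nu>) = (\<Sum>k<card I. tensor (u (e k)) (v (e k)) \<mu> \<nu>)" for \<mu> \<nu>
    by (rule sum.reindex_bij_betw[OF e, symmetric])
  then show ?thesis
    unfolding tensor_space_def
    by (intro CollectI exI[of _ "card I"] exI[of _ "\<lambda>k. u (e k)"] exI[of _ "\<lambda>k. v (e k)"]) simp
qed

context invariant_nondegenerate
begin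

lemma Int_group_Aut: "h \<in> Int_group \<Longrightarrow> h \<in> Aut_form B"
  using Int_group_Aut_form[OF form_invariant] .

lemma Exp_comp_Aut: "g \<in> Aut_form B \<Longrightarrow> Exp a \<circ> g \<in> Aut_form B" "g \<in> Aut_form B \<Longrightarrow> g \<circ> Exp a \<in> Aut_form B"
  by (simp_all add: Aut_form_comp Exp_Aut_form form_invariant)


text \<open>Differentiating the stabilizer condition at 0 makes \<open>a - m a\<close> central,
  hence zero. Conversely, an automorphism fixing a commutes with the whole one-parameter group of
  a.\<close>

lemma stabilizer_algebra_conjugation:
  assumes m: "m \<in> Aut_form B"
  shows "stabilizer_algebra conjugation m = {a. m a = a}"
proof (intro set_eqI iffI; clarify?)
  fix a assume "a \<in> stabilizer_algebra conjugation m"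
  then have st: "conjugation (Exp (s *\<^sub>C a)) m = m" for s by (simp add: stabilizer_algebra_def)
  have e: "endomorphism m" using m by (rule Aut_form_endomorphism)
  have "lie a (m x) - m (lie a x) = 0" for x
  proof (rule functional_eqI)
    fix \<xi> :: "'g \<Rightarrow> complex" assume \<xi>: "functional \<xi>"
    have "((\<lambda>s. \<xi> (conjugation (Exp (s *\<^sub>C a)) m x)) has_field_derivative \<xi> (lie a (m x) - m (lie a x))) (at 0)"
      using tangent_path_conjugation[OF e, of a] \<xi> by (simp add: tangent_path_def)
    then have "((\<lambda>s. \<xi> (m x)) has_field_derivative \<xi> (lie a (m x) - m (lie a x))) (at 0)"
      by (simp add: st)
    from DERIV_unique[OF this DERIV_const] show "\<xi> (lie a (m x) - m (lie a x)) = \<xi> 0"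
      by (simp add: functional_0[OF \<xi>])
  qed
  then have "lie (a - m a) (m x) = 0" for x by (simp add: lie_diff_left Aut_form_lie[OF m])
  then have "lie (a - m a) x = 0" for x using Aut_form_inv_apply(1)[OF m, of x] by metis
  then have "a - m a = 0" by (rule centerless)
  then show "m a = a" by simp
next
  fix a assume a: "m a = a"
  have "conjugation (Exp (s *\<^sub>C a)) m x = m x" for s x
  proof -
    have "m (Exp (- (s *\<^sub>C a)) x) = Exp (- (s *\<^sub>C a)) (m x)"
      using lie_hom_Exp[OF Aut_form_endomorphism[OF m] Aut_form_lie[OF m], of "- (s *\<^sub>C a)" x]
      by (simp add: a endomorphism_neg[OF Aut_form_endomorphism[OF m]] endomorphism_scale[OF Aut_form_endomorphism[OF m]])
    then show ?thesis
      using Exp_minus[of "- (s *\<^sub>C a)" "m x"] by (simp add: conjugation_def inv_Exp)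
  qed
  then show "a \<in> stabilizer_algebra conjugation m" by (simp add: stabilizer_algebra_def fun_eq_iff)
qed

lemma rho_diag:
  assumes "p \<in> poly_functions" "m \<in> Aut_form B"
  shows "rho (a, a) p m = dirderiv p m (\<lambda>x. lie (m a - a) (m x))"
  using rho_eq[OF assms(1) Aut_form_endomorphism Aut_form_lie, OF assms(2) assms(2)] by simp

lemma functional_rho_diag:
  assumes "p \<in> poly_functions" "endomorphism m"
  shows "functional (\<lambda>a. rho (a, a) p m)" "functional (\<lambda>a. rho (- a, a) p m)"
proof -
  have "rho (- (x + y), x + y) p m = rho (- x, x) p m + rho (- y, y) p m"
    "rho (x + y, x + y) p m = rho (x, x) p m + rho (y, y) p m" for x y
    using rho_add_left[OF assms, of "(- x, x)" "(- y, y)"] rho_add_left[OF assms, of "(x, x)" "(y, y)"]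
    by simp_all
  moreover have "rho (- (c *\<^sub>C x), c *\<^sub>C x) p m = c * rho (- x, x) p m"
    "rho (c *\<^sub>C x, c *\<^sub>C x) p m = c * rho (x, x) p m" for c x
    using rho_scale_left[OF assms, of c "(- x, x)"] rho_scale_left[OF assms, of c "(x, x)"]
    by (simp_all add: scale_pair_def cvs.scale_minus_right)
  ultimately show "functional (\<lambda>a. rho (a, a) p m)" "functional (\<lambda>a. rho (- a, a) p m)"
    by (simp_all add: functional_iff del: minus_add_distrib)
qed

text \<open>Converse of \<open>rho_graph_eq_0\<close>: by \<open>dirderiv_surj\<close> there are
  enough polynomials to detect the vector \<open>m (snd z) - fst z\<close>.\<close>

lemma rho_eq_0_imp_graph:
  assumes m: "m \<in> Aut_form B" and 0: "\<And>q. q \<in> poly_functions \<Longrightarrow> rho z q m = 0"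
  shows "z \<in> graph_subalgebra m"
proof -
  have "m (snd z) - fst z = 0"
  proof (rule functional_eqI)
    fix \<zeta> :: "'g \<Rightarrow> complex" assume \<zeta>: "functional \<zeta>"
    obtain q where q: "q \<in> poly_functions" "\<And>c. dirderiv q m (\<lambda>x. lie c (m x)) = \<zeta> c"
      using dirderiv_surj[OF \<zeta> m] by blast
    have "rho z q m = \<zeta> (m (snd z) - fst z)"
      using rho_eq[OF q(1) Aut_form_endomorphism[OF m] Aut_form_lie[OF m], of z] by (simp add: q(2))
    then show "\<zeta> (m (snd z) - fst z) = \<zeta> 0" using 0[OF q(1)] by (simp add: functional_0[OF \<zeta>])
  qed
  then show ?thesis by (cases z) (simp add: graph_subalgebra_def)
qed

text \<open>A matrix coefficient of the conjugate is separated by inserting the basis on both sides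
  of m. The inverse of h disappears by orthogonality: \<open>coord \<mu> (inv h x)\<close> equals
  \<open>B (h (dual_vector B \<mu>)) x\<close>, which is polynomial in h.\<close>

lemma poly_conjugation_product:
  fixes p :: "('g \<Rightarrow> 'g) \<Rightarrow> complex"
  assumes "p \<in> poly_functions" and M: "\<And>m. m \<in> M \<Longrightarrow> endomorphism m"
  shows "(\<lambda>(h, m). p (conjugation h m)) \<in> product_functions Int_group M (regular Int_group) (regular M)"
  using assms(1)
proof (induction rule: poly_functions.induct)
  case (const c)
  show ?case
    by (rule product_functionsI[of "{()}" "\<lambda>_ _. c" _ "\<lambda>_ _. 1"])
      (auto intro: poly_regular poly_functions.const)
next
  case (coeff \<xi> x)
  show ?case
  proof (rule product_functionsI[of "lie_basis \<times> lie_basis"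
        "\<lambda>(\<mu>, \<nu>) h. B (h (dual_vector B \<mu>)) x * \<xi> (h \<nu>)" _ "\<lambda>(\<mu>, \<nu>) m. coord \<nu> (m \<mu>)"])
    show "finite (lie_basis \<times> lie_basis :: ('g \<times> 'g) set)" by (simp add: finite_lie_basis)
  next
    fix i :: "'g \<times> 'g"
    show "(case i of (\<mu>, \<nu>) \<Rightarrow> \<lambda>h. B (h (dual_vector B \<mu>)) x * \<xi> (h \<nu>)) \<in> regular Int_group"
      using coeff by (cases i) (auto intro!: poly_regular poly_functions.mult poly_functions.coeff[where \<xi> = \<xi>]
        poly_functions.coeff[OF form_functional_left])
    show "(case i of (\<mu>, \<nu>) \<Rightarrow> \<lambda>m. coord \<nu> (m \<mu>)) \<in> regular M"
      by (cases i) (auto intro!: poly_regular poly_functions.coeff functional_coord)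
  next
    fix h m :: "'g \<Rightarrow> 'g" assume "h \<in> Int_group" and m: "m \<in> M"
    then have h: "h \<in> Aut_form B" by (simp add: Int_group_Aut)
    have "coord \<mu> (inv h x) = B (h (dual_vector B \<mu>)) x" if "\<mu> \<in> lie_basis" for \<mu>
      using Aut_form_form[OF h, of "dual_vector B \<mu>" "inv h x"] form_dual_vector[OF that, of "inv h x"]
      by (simp add: Aut_form_inv_apply[OF h])
    then have "\<xi> (h (m (inv h x))) = (\<Sum>\<mu>\<in>lie_basis. B (h (dual_vector B \<mu>)) x * \<xi> (h (m \<mu>)))"
      by (subst functional_expand[OF functional_comp[OF functional_comp[OF coeff Aut_form_endomorphism[OF h]] M[OF m]]]) simp
    also have "\<dots> = (\<Sum>\<mu>\<in>lie_basis. \<Sum>\<nu>\<in>lie_basis. B (h (dual_vector B \<mu>)) x * \<xi> (h \<nu>) * coord \<nu> (m \<mu>))"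
      by (subst functional_expand[OF functional_comp[OF coeff Aut_form_endomorphism[OF h]]])
        (simp add: sum_distrib_left mult_ac)
    finally show "(\<lambda>(h, m). \<xi> (conjugation h m x)) (h, m) = (\<Sum>i\<in>lie_basis \<times> lie_basis.
        (case i of (\<mu>, \<nu>) \<Rightarrow> \<lambda>h. B (h (dual_vector B \<mu>)) x * \<xi> (h \<nu>)) h *
        (case i of (\<mu>, \<nu>) \<Rightarrow> \<lambda>m. coord \<nu> (m \<mu>)) m)"
      by (simp add: conjugation_def sum.cartesian_product split_beta)
  qed
next
  case (add p q)
  then show ?case using product_functions_add[OF add.IH] by (simp add: case_prod_unfold)
next
  case (mult p q)
  then show ?case
    using product_functions_mult[OF function_algebra_regular function_algebra_regular mult.IH]
    by (simp add: case_prod_unfold)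
qed

end

section \<open>The bracket in terms of the symmetric and skew parts of r\<close>

context manin_complement
begin

text \<open>The two components of \<open>mdual\<close> carry r with opposite index order and
  opposite sign. Passing to diagonal and antidiagonal directions sorts this into the skew and the
  symmetric part, which accounts for the uneven shape of \<open>X_bracket\<close>.\<close>

lemma pbracket_pairing:
  assumes p: "p \<in> poly_functions" and q: "q \<in> poly_functions" and g: "endomorphism g"
  shows "pbracket p q g =
    - pairing (alt_part r) (\<lambda>a. rho (a, a) p g) (\<lambda>a. rho (a, a) q g) +
    pairing (sym_part r) (\<lambda>a. rho (a, a) p g) (\<lambda>a. rho (- a, a) q g)"
proof -
  have diag: "rho (a, a) q g = rho (a, 0) q g + rho (0, a) q g" for a
    using rho_add_left[OF q g, of "(a, 0)" "(0, a)"] by simp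
  have antidiag: "rho (- a, a) q g = rho (0, a) q g - rho (a, 0) q g" for a
    using rho_add_left[OF q g, of "(- a, 0)" "(0, a)"] rho_minus_left[OF q g, of "(a, 0)"] by simp
  have "mdual \<mu> = (\<Sum>\<nu>\<in>lie_basis. scale_pair (- r \<mu> \<nu>) (\<nu>, 0)) + (\<Sum>\<nu>\<in>lie_basis. scale_pair (r \<nu> \<mu>) (0, \<nu>))" for \<mu>
    by (simp add: mdual_def prod_eq_iff fst_sum snd_sum cvs.scale_minus_left sum_negf)
  then have md: "rho (mdual \<mu>) q g = (\<Sum>\<nu>\<in>lie_basis. r \<nu> \<mu> * rho (0, \<nu>) q g - r \<mu> \<nu> * rho (\<nu>, 0) q g)" for \<mu>
    by (simp add: rho_add_left[OF q g] rho_sum_left[OF q g] sum_subtractf sum_negf)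
  show ?thesis
    unfolding pairing_def pbracket_def md sum_negf[symmetric] sum.distrib[symmetric] sum_distrib_left
    unfolding diag antidiag alt_part_def sym_part_def
    by (intro sum.cong refl) (simp add: field_simps)
qed

lemma X_bracket_eq:
  assumes p: "p \<in> poly_functions" "\<And>g. g \<in> Aut_form B \<Longrightarrow> \<phi> g = p g"
    and q: "q \<in> poly_functions" "\<And>g. g \<in> Aut_form B \<Longrightarrow> \<psi> g = q g"
    and g: "g \<in> Aut_form B"
  shows "X_bracket r \<phi> \<psi> g = pbracket p q g"
proof -
  have e: "endomorphism g" using g by (rule Aut_form_endomorphism)
  note fields = right_inv_field_eq[OF p e] left_inv_field_eq[OF p e]
    right_inv_field_eq[OF q e] left_inv_field_eq[OF q e]
  have split: "rho (a, b) f g = rho (a, 0) f g + rho (0, b) f g" if "f \<in> poly_functions" for a b f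
    using rho_add_left[OF that e, of "(a, 0)" "(0, b)"] by simp
  have neg: "rho (- a, 0) q g = - rho (a, 0) q g" for a
    using rho_minus_left[OF q(1) e, of "(a, 0)"] by simp
  have 1: "left_inv_field a \<phi> g - right_inv_field a \<phi> g = rho (a, a) p g" for a
    using split[OF p(1), of a a] by (simp add: fields Exp_comp_Aut g)
  have 2: "left_inv_field a \<psi> g - right_inv_field a \<psi> g = rho (a, a) q g" for a
    using split[OF q(1), of a a] by (simp add: fields Exp_comp_Aut g)
  have 3: "left_inv_field a \<psi> g + right_inv_field a \<psi> g = rho (- a, a) q g" for a
    using split[OF q(1), of "- a" a] by (simp add: fields Exp_comp_Aut g neg)
  show ?thesis
    unfolding X_bracket_def 1 2 3 pbracket_pairing[OF p(1) q(1) e] pairing_def ..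
qed

lemma alt_plus_sym: "r = (\<lambda>\<mu> \<nu>. alt_part r \<mu> \<nu> + sym_part r \<mu> \<nu>)"
  by (simp add: fun_eq_iff alt_part_def sym_part_def field_simps)

lemma pairing_sym_part: "pairing (sym_part r) \<xi> \<eta> = pairing (form_tensor B) \<xi> \<eta> / 2"
  unfolding pairing_def sum_divide_distrib
  by (intro sum.cong refl) (simp add: sym_part_def r_sym)

lemma pairing_sym_part_Aut:
  "h \<in> Aut_form B \<Longrightarrow> functional \<xi> \<Longrightarrow> functional \<eta> \<Longrightarrow>
    pairing (sym_part r) (\<lambda>a. \<xi> (h a)) (\<lambda>a. \<eta> (h a)) = pairing (sym_part r) \<xi> \<eta>"
  unfolding pairing_sym_part by (simp add: pairing_form_tensor_Aut)

end

text \<open>Treats \<open>Aut_form B\<close> and its conjugacy classes at once.\<close>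

locale conjugation_space = manin_complement B \<mm> r
  for B :: "'g::complex_lie_algebra \<Rightarrow> 'g \<Rightarrow> complex" and \<mm> r +
  fixes M :: "('g \<Rightarrow> 'g) set" and P :: "('g \<Rightarrow> 'g) bracket"
  assumes M_Aut: "m \<in> M \<Longrightarrow> m \<in> Aut_form B"
    and M_conjugation: "h \<in> Int_group \<Longrightarrow> m \<in> M \<Longrightarrow> conjugation h m \<in> M"
    and P_eq: "p \<in> poly_functions \<Longrightarrow> q \<in> poly_functions \<Longrightarrow>
      (\<And>m. m \<in> M \<Longrightarrow> \<phi> m = p m) \<Longrightarrow> (\<And>m. m \<in> M \<Longrightarrow> \<psi> m = q m) \<Longrightarrow> m \<in> M \<Longrightarrow>
      P \<phi> \<psi> m = pbracket p q m"
begin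

lemma regularE:
  assumes "\<phi> \<in> regular M"
  obtains p where "p \<in> poly_functions" "\<And>m. m \<in> M \<Longrightarrow> \<phi> m = p m"
  using assms unfolding regular_iff by blast

lemma poisson_bracket_P: "poisson_bracket M (regular M) P"
  unfolding poisson_bracket_def
proof (intro conjI ballI allI impI)
  show "function_algebra (regular M)" by (rule function_algebra_regular)
next
  fix \<phi> \<psi> assume \<phi>: "\<phi> \<in> regular M" and \<psi>: "\<psi> \<in> regular M"
  obtain p where p: "p \<in> poly_functions" "\<And>m. m \<in> M \<Longrightarrow> \<phi> m = p m" using regularE[OF \<phi>] by blast
  obtain q where q: "q \<in> poly_functions" "\<And>m. m \<in> M \<Longrightarrow> \<psi> m = q m" using regularE[OF \<psi>] by blast
  note eq = P_eq[OF p(1) q(1) p(2) q(2)] P_eq[OF q(1) p(1) q(2) p(2)]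
  show "P \<phi> \<psi> \<in> regular M"
    unfolding regular_iff using pbracket_poly[OF p(1) q(1)] eq(1) by blast
  fix m assume m: "m \<in> M"
  show "P \<phi> \<psi> m = - P \<psi> \<phi> m"
    using pbracket_skew[OF p(1) q(1) M_Aut[OF m]] eq m by simp
next
  fix \<phi> \<phi>' \<psi> m
  assume \<phi>: "\<phi> \<in> regular M" and \<psi>: "\<psi> \<in> regular M"
    and \<phi>': "\<forall>m\<in>M. \<phi> m = \<phi>' m" and m: "m \<in> M"
  obtain p where p: "p \<in> poly_functions" "\<And>m. m \<in> M \<Longrightarrow> \<phi> m = p m" using regularE[OF \<phi>] by blast
  obtain q where q: "q \<in> poly_functions" "\<And>m. m \<in> M \<Longrightarrow> \<psi> m = q m" using regularE[OF \<psi>] by blast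
  have "\<phi>' m = p m" if "m \<in> M" for m using p(2) \<phi>' that by simp
  from P_eq[OF p(1) q(1) this q(2) m] P_eq[OF p(1) q(1) p(2) q(2) m]
  show "P \<phi> \<psi> m = P \<phi>' \<psi> m" by simp
next
  fix \<phi> \<psi> \<theta> c m
  assume \<phi>: "\<phi> \<in> regular M" and \<psi>: "\<psi> \<in> regular M" and \<theta>: "\<theta> \<in> regular M"
    and m: "m \<in> M"
  obtain p where p: "p \<in> poly_functions" "\<And>m. m \<in> M \<Longrightarrow> \<phi> m = p m" using regularE[OF \<phi>] by blast
  obtain q where q: "q \<in> poly_functions" "\<And>m. m \<in> M \<Longrightarrow> \<psi> m = q m" using regularE[OF \<psi>] by blast
  obtain t where t: "t \<in> poly_functions" "\<And>m. m \<in> M \<Longrightarrow> \<theta> m = t m" using regularE[OF \<theta>] by blast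
  show "P (\<lambda>x. c * \<phi> x + \<psi> x) \<theta> m = c * P \<phi> \<theta> m + P \<psi> \<theta> m"
    using P_eq[OF poly_functions.add[OF poly_scale[OF p(1)] q(1)] t(1), of "\<lambda>x. c * \<phi> x + \<psi> x" c \<theta> m]
      P_eq[OF p(1) t(1) p(2) t(2) m] P_eq[OF q(1) t(1) q(2) t(2) m]
    by (simp add: p q t m pbracket_add_left)
  show "P \<phi> (\<lambda>x. \<psi> x * \<theta> x) m = P \<phi> \<psi> m * \<theta> m + \<psi> m * P \<phi> \<theta> m"
    using P_eq[OF p(1) poly_functions.mult[OF q(1) t(1)], of \<phi> "\<lambda>x. \<psi> x * \<theta> x" m]
      P_eq[OF p(1) t(1) p(2) t(2) m] P_eq[OF p(1) q(1) p(2) q(2) m]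
    by (simp add: p q t m pbracket_mult_right)
  note eq = P_eq[OF p(1) q(1) p(2) q(2)] P_eq[OF q(1) t(1) q(2) t(2)] P_eq[OF t(1) p(1) t(2) p(2)]
  show "P \<phi> (P \<psi> \<theta>) m + P \<psi> (P \<theta> \<phi>) m + P \<theta> (P \<phi> \<psi>) m = 0"
    using P_eq[OF p(1) pbracket_poly[OF q(1) t(1)] p(2) eq(2) m]
      P_eq[OF q(1) pbracket_poly[OF t(1) p(1)] q(2) eq(3) m]
      P_eq[OF t(1) pbracket_poly[OF p(1) q(1)] t(2) eq(1) m]
      pbracket_jacobi[OF p(1) q(1) t(1) M_Aut[OF m]]
    by simp
qed

lemma differential_eq:
  assumes "p \<in> poly_functions" "\<And>m. m \<in> M \<Longrightarrow> \<phi> m = p m" "m \<in> M"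
  shows "differential conjugation \<phi> m = (\<lambda>a. - rho (a, a) p m)"
  using differential_conjugation_eq[of p M \<phi> m] assms Aut_form_endomorphism[OF M_Aut]
    M_conjugation[OF Exp_Int_group] by (simp add: fun_eq_iff)

lemma poisson_action_P: "poisson_action r M (regular M) P conjugation"
  unfolding poisson_action_def
proof
  show "action Int_group M conjugation"
    by (auto simp: action_def M_conjugation conjugation_id conjugation_comp Int_group_bij)
  let ?f = "\<lambda>(h, m). conjugation h m :: 'g \<Rightarrow> 'g"
  show "poisson_map (Int_group \<times> M) (product_functions Int_group M (regular Int_group) (regular M))
      (product_bracket (sklyanin_bracket r) P) M (regular M) P ?f"
    unfolding poisson_map_def
  proof (intro conjI ballI)
    show "?f ` (Int_group \<times> M) \<subseteq> M" by (auto simp: M_conjugation)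
  next
    fix \<phi> assume \<phi>: "\<phi> \<in> regular M"
    obtain p where p: "p \<in> poly_functions" "\<And>m. m \<in> M \<Longrightarrow> \<phi> m = p m" using regularE[OF \<phi>] by blast
    show "\<phi> \<circ> ?f \<in> product_functions Int_group M (regular Int_group) (regular M)"
      using poly_conjugation_product[OF p(1) Aut_form_endomorphism[OF M_Aut]] p(2) M_conjugation
      unfolding product_functions_def by (simp add: comp_def)
  next
    fix \<phi> \<psi> and z :: "('g \<Rightarrow> 'g) \<times> ('g \<Rightarrow> 'g)"
    assume \<phi>: "\<phi> \<in> regular M" and \<psi>: "\<psi> \<in> regular M" and "z \<in> Int_group \<times> M"
    obtain p where p: "p \<in> poly_functions" "\<And>m. m \<in> M \<Longrightarrow> \<phi> m = p m" using regularE[OF \<phi>] by blast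
    obtain q where q: "q \<in> poly_functions" "\<And>m. m \<in> M \<Longrightarrow> \<psi> m = q m" using regularE[OF \<psi>] by blast
    obtain h m where z: "z = (h, m)" and h: "h \<in> Int_group" and m: "m \<in> M"
      using \<open>z \<in> Int_group \<times> M\<close> by blast
    define g where "g = conjugation h m"
    have hA: "h \<in> Aut_form B" using h by (rule Int_group_Aut)
    have eh: "endomorphism h" using hA by (rule Aut_form_endomorphism)
    have gM: "g \<in> M" unfolding g_def using h m by (rule M_conjugation)
    have eg: "endomorphism g" using Aut_form_endomorphism[OF M_Aut[OF gM]] .
    have em: "endomorphism m" using Aut_form_endomorphism[OF M_Aut[OF m]] .
    \<comment> \<open>\<xi> and \<eta> are minus the differentials of the two functions at g. The
      antidiagonal derivative \<eta>' accompanies only the symmetric part of r.\<close>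
    define \<xi> where "\<xi> a = rho (a, a) p g" for a
    define \<eta> where "\<eta> a = rho (a, a) q g" for a
    define \<eta>' where "\<eta>' a = rho (- a, a) q g" for a
    have lin: "functional \<xi>" "functional \<eta>" "functional \<eta>'"
      unfolding \<xi>_def[abs_def] \<eta>_def[abs_def] \<eta>'_def[abs_def]
      using functional_rho_diag p(1) q(1) eg by auto
    have right: "right_inv_field a (\<lambda>h. f (conjugation h m)) h = differential conjugation f g a" for a and f :: "('g \<Rightarrow> 'g) \<Rightarrow> complex"
      unfolding right_inv_field_def differential_def g_def
      by (simp add: conjugation_comp bij_Exp Int_group_bij[OF h])
    have left: "left_inv_field a (\<lambda>h. f (conjugation h m)) h = differential conjugation f g (h a)" for a and f :: "('g \<Rightarrow> 'g) \<Rightarrow> complex"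
      unfolding left_inv_field_def differential_def g_def
      by (simp add: conjugation_Exp[OF hA] endomorphism_scale[OF eh])
    have diff: "differential conjugation \<phi> g = (\<lambda>a. - \<xi> a)" "differential conjugation \<psi> g = (\<lambda>a. - \<eta> a)"
      using differential_eq[OF p gM] differential_eq[OF q gM] by (simp_all add: \<xi>_def \<eta>_def)
    have "sklyanin_bracket r (\<lambda>h. \<phi> (conjugation h m)) (\<lambda>h. \<psi> (conjugation h m)) h =
        pairing r (\<lambda>a. \<xi> (h a)) (\<lambda>a. \<eta> (h a)) - pairing r \<xi> \<eta>"
      unfolding sklyanin_bracket_def pairing_def left right diff sum_subtractf[symmetric]
      by (simp add: algebra_simps)
    also have "\<dots> = pairing (alt_part r) (\<lambda>a. \<xi> (h a)) (\<lambda>a. \<eta> (h a)) - pairing (alt_part r) \<xi> \<eta>"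
      by (subst (1 2) alt_plus_sym) (simp add: pairing_add_tensor pairing_sym_part_Aut hA lin)
    finally have sk: "sklyanin_bracket r (\<lambda>h. \<phi> (conjugation h m)) (\<lambda>h. \<psi> (conjugation h m)) h =
        pairing (alt_part r) (\<lambda>a. \<xi> (h a)) (\<lambda>a. \<eta> (h a)) - pairing (alt_part r) \<xi> \<eta>" .
    have "P (\<lambda>m. \<phi> (conjugation h m)) (\<lambda>m. \<psi> (conjugation h m)) m =
        pbracket (\<lambda>m. p (conjugation h m)) (\<lambda>m. q (conjugation h m)) m"
      using m h by (intro P_eq poly_conjugation eh p q M_conjugation)
    also have "\<dots> = - pairing (alt_part r) (\<lambda>a. \<xi> (h a)) (\<lambda>a. \<eta> (h a)) +
        pairing (sym_part r) (\<lambda>a. \<xi> (h a)) (\<lambda>a. \<eta>' (h a))"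
      unfolding pbracket_pairing[OF poly_conjugation[OF eh p(1)] poly_conjugation[OF eh q(1)] em]
      by (simp add: rho_conjugation[OF hA] \<xi>_def \<eta>_def \<eta>'_def g_def endomorphism_neg[OF eh])
    also have "\<dots> = - pairing (alt_part r) (\<lambda>a. \<xi> (h a)) (\<lambda>a. \<eta> (h a)) + pairing (sym_part r) \<xi> \<eta>'"
      by (simp add: pairing_sym_part_Aut hA lin)
    finally have "sklyanin_bracket r (\<lambda>h. \<phi> (conjugation h m)) (\<lambda>h. \<psi> (conjugation h m)) h +
        P (\<lambda>m. \<phi> (conjugation h m)) (\<lambda>m. \<psi> (conjugation h m)) m = pbracket p q g"
      unfolding sk pbracket_pairing[OF p(1) q(1) eg] \<xi>_def \<eta>_def \<eta>'_def by simp
    then show "product_bracket (sklyanin_bracket r) P (\<phi> \<circ> ?f) (\<psi> \<circ> ?f) z = P \<phi> \<psi> (?f z)"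
      using P_eq[OF p(1) q(1) p(2) q(2) gM] by (simp add: product_bracket_def z g_def)
  qed
qed

text \<open>Differentials kill the stabilizer because the graph of m acts by zero at m. Conversely,
  a functional vanishing on the fixed vectors of m factors through
  \<open>\<lambda>a. a - m a\<close>, and \<open>dirderiv_surj\<close> realizes the factor by a
  polynomial.\<close>

lemma differentials:
  assumes m: "m \<in> M"
  shows "{differential conjugation \<phi> m | \<phi>. \<phi> \<in> regular M} = annihilator (stabilizer_algebra conjugation m)"
proof -
  have mA: "m \<in> Aut_form B" using m by (rule M_Aut)
  have e: "endomorphism m" using mA by (rule Aut_form_endomorphism)
  have st: "stabilizer_algebra conjugation m = {a. m a = a}"
    by (rule stabilizer_algebra_conjugation[OF mA])
  show ?thesis
  proof (intro set_eqI iffI; clarify?)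
    fix \<phi> assume \<phi>: "\<phi> \<in> regular M"
    obtain p where p: "p \<in> poly_functions" "\<And>m. m \<in> M \<Longrightarrow> \<phi> m = p m" using regularE[OF \<phi>] by blast
    have "functional (\<lambda>a. - rho (a, a) p m)"
      using functional_rho_diag(1)[OF p(1) e] by (simp add: functional_iff)
    moreover have "rho (a, a) p m = 0" if "m a = a" for a
      by (rule rho_graph_eq_0[OF p(1) mA]) (simp add: graph_subalgebra_def that)
    ultimately show "differential conjugation \<phi> m \<in> annihilator (stabilizer_algebra conjugation m)"
      using differential_eq[of p \<phi> m] p m by (simp add: annihilator_def st)
  next
    fix \<xi> assume "\<xi> \<in> annihilator (stabilizer_algebra conjugation m)"
    then have \<xi>: "functional \<xi>" "\<And>a. m a = a \<Longrightarrow> \<xi> a = 0" by (auto simp: annihilator_def st)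
    have e': "endomorphism (\<lambda>a. a - m a)"
      by (rule endomorphismI) (simp_all add: endomorphism_add[OF e] endomorphism_scale[OF e] cvs.scale_right_diff_distrib)
    have "\<xi> a = 0" if "a - m a = 0" for a using that by (intro \<xi>(2)) simp
    from functional_factors[OF e' \<xi>(1) this]
    obtain \<zeta> where \<zeta>: "functional \<zeta>" "\<And>a. \<xi> a = \<zeta> (a - m a)" by blast
    obtain p where p: "p \<in> poly_functions" "\<And>c. dirderiv p m (\<lambda>x. lie c (m x)) = \<zeta> c"
      using dirderiv_surj[OF \<zeta>(1) mA] by blast
    have "differential conjugation p m = \<xi>"
      using functional_neg[OF \<zeta>(1), of "_ - _"]
      by (simp add: differential_eq[OF p(1) refl m] rho_diag[OF p(1) mA] p(2) \<zeta>(2) fun_eq_iff flip: functional_neg[OF \<zeta>(1)])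
    then show "\<exists>\<phi>. \<xi> = differential conjugation \<phi> m \<and> \<phi> \<in> regular M"
      using poly_regular[OF p(1)] by blast
  qed
qed

lemma mpart_scale: "mpart (scale_pair c d) = scale_pair c (mpart d)"
  by (simp add: mpart_def dform_scale_left prod_eq_iff fst_sum snd_sum cvs.scale_sum_right scaleC_scaleC)

lemma mpart_add: "mpart (d + e) = mpart d + mpart e"
  by (simp add: mpart_def dform_add_left prod_eq_iff fst_sum snd_sum sum.distrib scaleC_add_left cvs.scale_left_diff_distrib sum_subtractf cvs.scale_minus_left sum_negf)

text \<open>The bracket determines the bivector only modulo the stabilizer, so a lift has to be
  chosen. It suffices to prescribe linearly, for each w, the contraction \<open>c w\<close> of the
  tensor with \<open>B w\<close>.\<close>

lemma exists_bivector:
  assumes m: "m \<in> M"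
  shows "\<exists>T. represents_bivector conjugation (regular M) P m T"
proof -
  have mA: "m \<in> Aut_form B" using m by (rule M_Aut)
  have ei: "endomorphism (inv m)" using Aut_form_endomorphism[OF Aut_form_inv[OF mA]] .
  have "endomorphism (\<lambda>a. a - inv m a)"
    by (rule endomorphismI) (simp_all add: endomorphism_add[OF ei] endomorphism_scale[OF ei] cvs.scale_right_diff_distrib)
  from right_inverse_on_range[OF this] obtain S
    where S: "endomorphism S" "\<And>x. S (x - inv m x) - inv m (S (x - inv m x)) = x - inv m x" by blast
  \<comment> \<open>Chosen so that \<open>mpart (w, 0) + (c w, c w)\<close> equals
    \<open>(S w, inv m (S w))\<close> for w in the range of 1 - \<open>inv m\<close>. This pair is
    in the graph, so the diagonal field of \<open>c w\<close> is minus the field of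
    \<open>mpart (w, 0)\<close> at m.\<close>
  define c where "c w = S w - fst (mpart (w, 0))" for w
  have c: "endomorphism c"
    unfolding c_def[abs_def]
    using mpart_add[of "(_, 0)" "(_, 0)"] mpart_scale[of _ "(_, 0)"]
    by (intro endomorphismI) (simp_all add: endomorphism_add[OF S(1)] endomorphism_scale[OF S(1)]
        scale_pair_def cvs.scale_right_diff_distrib)
  define T where "T = (\<lambda>\<alpha> \<beta>. \<Sum>\<mu>\<in>lie_basis. tensor \<mu> (c (dual_vector B \<mu>)) \<alpha> \<beta>)"
  have T: "pairing T (B w) \<eta> = \<eta> (c w)" if \<eta>: "functional \<eta>" for w \<eta>
  proof -
    have "pairing T (B w) \<eta> = (\<Sum>\<alpha>\<in>lie_basis. \<Sum>\<beta>\<in>lie_basis. coord \<beta> (c (dual_vector B \<alpha>)) * B w \<alpha> * \<eta> \<beta>)"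
      unfolding pairing_def T_def tensor_def
      by (intro sum.cong refl) (simp add: coord_basis finite_lie_basis if_distrib[of "\<lambda>c. c * _"] cong: if_cong)
    also have "\<dots> = (\<Sum>\<alpha>\<in>lie_basis. B w \<alpha> * \<eta> (c (dual_vector B \<alpha>)))"
      by (intro sum.cong refl) (simp add: functional_expand[OF \<eta>, of "c _"] sum_distrib_left mult_ac)
    also have "\<dots> = \<eta> (c (\<Sum>\<alpha>\<in>lie_basis. B w \<alpha> *\<^sub>C dual_vector B \<alpha>))"
      by (simp add: endomorphism_sum[OF c] endomorphism_scale[OF c] functional_sum[OF \<eta>] functional_scale[OF \<eta>])
    finally show ?thesis by (simp add: sum_form_dual_vector)
  qed
  have "P \<phi> \<psi> m = pairing T (differential conjugation \<phi> m) (differential conjugation \<psi> m)"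
    if \<phi>: "\<phi> \<in> regular M" and \<psi>: "\<psi> \<in> regular M" for \<phi> \<psi>
  proof -
    obtain p where p: "p \<in> poly_functions" "\<And>m. m \<in> M \<Longrightarrow> \<phi> m = p m" using regularE[OF \<phi>] by blast
    obtain q where q: "q \<in> poly_functions" "\<And>m. m \<in> M \<Longrightarrow> \<psi> m = q m" using regularE[OF \<psi>] by blast
    define d where "d = gradient p m"
    \<comment> \<open>The Riesz vector of the differential of \<phi>. That d lies in the graph puts
      w into the range of 1 - \<open>inv m\<close>, where S is a genuine right inverse.\<close>
    define w where "w = snd d - fst d"
    have "fst d = m (snd d)"
      using gradient_graph[OF p(1) mA] by (auto simp: graph_subalgebra_def d_def)
    then have "w = - fst d - inv m (- fst d)"
      by (simp add: w_def Aut_form_inv_apply[OF mA] endomorphism_neg[OF ei])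
    then have w: "S w - inv m (S w) = w" using S(2)[of "- fst d"] by simp
    have dp: "differential conjugation \<phi> m = B w"
      using differential_eq[of p \<phi> m] p m
      by (simp add: rho_gradient[OF p(1) mA] dform_diag d_def[symmetric] w_def form_simps fun_eq_iff)
    have mp: "mpart (w, 0) = - mpart d"
      using mpart_unique[of "scale_pair (-1) (mpart d)" "(w, 0)"] mpart_diff[of d] mm_scale[OF mpart_mm]
      by (simp add: prod_eq_iff w_def cvs.scale_minus_left scaleC_one algebra_simps)
    have "mpart (w, 0) + (c w, c w) \<in> graph_subalgebra m"
    proof -
      have "snd (mpart (w, 0)) + c w = S w - w"
        using mpart_diff[of "(w, 0)"] by (simp add: c_def algebra_simps)
      also have "\<dots> = S w - (S w - inv m (S w))" by (simp only: w)
      also have "\<dots> = inv m (S w)" by (simp only: diff_diff_eq2 add_diff_cancel_left')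
      finally show ?thesis
        by (simp add: graph_subalgebra_def Aut_form_inv_apply[OF mA] c_def plus_prod_def)
    qed
    then have "rho (mpart (w, 0)) q m + rho (c w, c w) q m = 0"
      using rho_graph_eq_0[OF q(1) mA] rho_add_left[OF q(1) Aut_form_endomorphism[OF mA]] by metis
    then have "pbracket p q m = - rho (c w, c w) q m"
      by (simp add: pbracket_eq_rho[OF p(1) q(1) mA] mp d_def[symmetric]
          rho_minus_left[OF q(1) Aut_form_endomorphism[OF mA]])
    also have "\<dots> = pairing T (B w) (differential conjugation \<psi> m)"
    proof (subst T)
      show "functional (differential conjugation \<psi> m)"
        using differentials[OF m] \<psi> by (auto simp: annihilator_def)
    qed (simp add: differential_eq[OF q m])
    finally show ?thesis using P_eq[OF p(1) q(1) p(2) q(2) m] dp by simp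
  qed
  moreover have "T \<in> tensor_space UNIV UNIV"
    unfolding T_def by (rule sum_tensor_space[OF finite_lie_basis])
  ultimately show ?thesis unfolding represents_bivector_def by blast
qed

lemma poisson_homogeneous_space_P:
  assumes "M \<noteq> {}" "\<And>m m'. m \<in> M \<Longrightarrow> m' \<in> M \<Longrightarrow> \<exists>h\<in>Int_group. conjugation h m = m'"
  shows "poisson_homogeneous_space r M (regular M) P conjugation"
  unfolding poisson_homogeneous_space_def
  using assms poisson_bracket_P differentials exists_bivector poisson_action_P by blast

text \<open>Proved for every representing tensor, since \<open>drinfeld_subalgebra\<close> picks one
  by choice. Both sides say that a certain element of the double acts by zero at m, and the two
  actions agree up to sign.\<close>

lemma bivector_graph:
  assumes m: "m \<in> M" and T: "represents_bivector conjugation (regular M) P m T"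
    and z: "z \<in> \<mm>" and ann: "functional_of B z \<in> annihilator (stabilizer_algebra conjugation m)"
  shows "contract (functional_of B z) T - a \<in> stabilizer_algebra conjugation m \<longleftrightarrow>
    (a, a) + z \<in> graph_subalgebra m"
proof -
  have mA: "m \<in> Aut_form B" using m by (rule M_Aut)
  have e: "endomorphism m" using mA by (rule Aut_form_endomorphism)
  obtain \<phi> where \<phi>: "\<phi> \<in> regular M" "functional_of B z = differential conjugation \<phi> m"
    using ann differentials[OF m] by blast
  obtain p where p: "p \<in> poly_functions" "\<And>m. m \<in> M \<Longrightarrow> \<phi> m = p m" using regularE[OF \<phi>(1)] by blast
  let ?b = "contract (functional_of B z) T"
  \<comment> \<open>The pairing with the diagonal determines an element of \<mm>, and z pairs with
    it as minus the gradient does; the minus is the one relating \<open>differential\<close> and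
    \<open>rho\<close>.\<close>
  have zp: "z = scale_pair (-1) (mpart (gradient p m))"
  proof -
    have "B (fst z - snd z) a = B (- (fst (gradient p m) - snd (gradient p m))) a" for a
      using fun_cong[OF \<phi>(2), of a] differential_eq[of p \<phi> m] p m rho_gradient[OF p(1) mA]
      by (simp add: functional_of_def dform_diag form_simps)
    then have "fst z - snd z = - (fst (gradient p m) - snd (gradient p m))" by (rule form_eqI)
    then have "z = mpart (scale_pair (-1) (gradient p m))"
      using z by (intro mpart_unique) (simp_all add: cvs.scale_minus_left scaleC_one)
    then show ?thesis by (simp add: mpart_scale)
  qed
  have key: "- rho (?b - a, ?b - a) q m = rho ((a, a) + z) q m" if q: "q \<in> poly_functions" for q
  proof -
    have \<eta>: "functional (\<lambda>a. - rho (a, a) q m)"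
      using functional_rho_diag(1)[OF q e] by (simp add: functional_iff)
    have "- rho (?b, ?b) q m = pairing T (functional_of B z) (differential conjugation q m)"
      unfolding differential_eq[OF q refl m] pairing_contract[OF \<eta>] ..
    also have "\<dots> = P \<phi> q m"
      using T \<phi> poly_regular[OF q] by (simp add: represents_bivector_def)
    also have "\<dots> = pbracket p q m" using P_eq[OF p(1) q p(2) refl m] .
    also have "\<dots> = rho z q m"
      using rho_scale_left[OF q e, of "-1" "mpart (gradient p m)"]
      by (simp add: pbracket_eq_rho[OF p(1) q mA] zp)
    finally show ?thesis
      using functional_diff[OF \<eta>, of ?b a] rho_add_left[OF q e, of "(a, a)" z] by simp
  qed
  have st: "b \<in> stabilizer_algebra conjugation m \<longleftrightarrow> (b, b) \<in> graph_subalgebra m" for b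
    by (auto simp: stabilizer_algebra_conjugation[OF mA] graph_subalgebra_def)
  show ?thesis
    unfolding st
    using key rho_graph_eq_0[OF _ mA] rho_eq_0_imp_graph[OF mA] neg_equal_0_iff_equal by metis
qed

text \<open>One inclusion is \<open>bivector_graph\<close>. For the other, x in the graph is split
  along the diagonal and \<mm>; isotropy of the graph puts the functional of the \<mm>-part into the
  annihilator, which makes \<open>bivector_graph\<close> applicable.\<close>

lemma drinfeld_graph:
  assumes m: "m \<in> M"
  shows "(let T = SOME T. represents_bivector conjugation (regular M) P m T in
    {(a, a) + z | a z. z \<in> \<mm> \<and>
         functional_of B z \<in> annihilator (stabilizer_algebra conjugation m) \<and>
         contract (functional_of B z) T - a \<in> stabilizer_algebra conjugation m}) = graph_subalgebra m"
proof -
  define T where "T = (SOME T. represents_bivector conjugation (regular M) P m T)"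
  have T: "represents_bivector conjugation (regular M) P m T"
    unfolding T_def using exists_bivector[OF m] by (rule someI_ex)
  have mA: "m \<in> Aut_form B" using m by (rule M_Aut)
  have "\<exists>a z. x = (a, a) + z \<and> z \<in> \<mm> \<and>
         functional_of B z \<in> annihilator (stabilizer_algebra conjugation m) \<and>
         contract (functional_of B z) T - a \<in> stabilizer_algebra conjugation m"
    if x: "x \<in> graph_subalgebra m" for x
  proof -
    define a where "a = fst x - fst (mpart x)"
    have eq: "x = (a, a) + mpart x"
      using dpart_diag[of x] by (simp add: dpart_def a_def diff_eq_eq)
    have "functional_of B (mpart x) = (\<lambda>b. dform x (b, b))"
      by (simp add: functional_of_def dform_mpart_diag)
    moreover have "functional (\<lambda>b. dform x (b, b))"
      by (rule functionalI) (simp_all add: double_form_def form_simps algebra_simps)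
    moreover have "dform x (b, b) = 0" if "m b = b" for b
      by (rule graph_isotropic[OF mA x]) (simp add: graph_subalgebra_def that)
    ultimately have ann: "functional_of B (mpart x) \<in> annihilator (stabilizer_algebra conjugation m)"
      by (simp add: annihilator_def stabilizer_algebra_conjugation[OF mA])
    moreover have "contract (functional_of B (mpart x)) T - a \<in> stabilizer_algebra conjugation m"
      using bivector_graph[OF m T mpart_mm ann, of a] x unfolding eq[symmetric] by blast
    ultimately show ?thesis using eq mpart_mm by blast
  qed
  then show ?thesis
    unfolding T_def[symmetric] Let_def using bivector_graph[OF m T] by blast
qed

end

section \<open>Restriction to conjugation-invariant sets, and triviality of the centre\<close>

context manin_complement
begin

text \<open>The first argument enters only through diagonal fields, whose flow is conjugation and
  stays in M, so its values on M suffice. Skew symmetry transfers this to the second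
  argument.\<close>

lemma pbracket_cong:
  assumes poly: "p \<in> poly_functions" "p' \<in> poly_functions" "q \<in> poly_functions" "q' \<in> poly_functions"
    and M: "M \<subseteq> Aut_form B" "\<And>h m. h \<in> Int_group \<Longrightarrow> m \<in> M \<Longrightarrow> conjugation h m \<in> M"
    and eq: "\<And>m. m \<in> M \<Longrightarrow> p m = p' m" "\<And>m. m \<in> M \<Longrightarrow> q m = q' m"
    and m: "m \<in> M"
  shows "pbracket p q m = pbracket p' q' m"
proof -
  have mA: "m \<in> Aut_form B" using m M(1) by blast
  have rho: "rho (a, a) f m = rho (a, a) f' m"
    if "f \<in> poly_functions" "f' \<in> poly_functions" "\<And>m. m \<in> M \<Longrightarrow> f m = f' m" for a f f'
    using differential_conjugation_eq[of f M f m a] differential_conjugation_eq[of f' M f m a] that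
      Aut_form_endomorphism[OF mA] M(2)[OF Exp_Int_group m] by simp
  have "pbracket p q m = pbracket p' q m"
    unfolding pbracket_def using rho[OF poly(1,2) eq(1)] by simp
  also have "\<dots> = - pbracket q p' m" by (rule pbracket_skew[OF poly(2,3) mA])
  also have "\<dots> = - pbracket q' p' m"
    unfolding pbracket_def using rho[OF poly(3,4) eq(2)] by simp
  also have "\<dots> = pbracket p' q' m" using pbracket_skew[OF poly(2,4) mA] by simp
  finally show ?thesis .
qed

end

text \<open>The centre is an ideal with zero derived algebra, hence a solvable one.\<close>

lemma semisimple_centerless:
  fixes c :: "'g::complex_lie_algebra"
  assumes "semisimple TYPE('g)" and c: "\<And>x. lie c x = 0"
  shows "c = 0"
proof -
  define Z where "Z = {c::'g. \<forall>x. lie c x = 0}"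
  have sub: "cvs.subspace Z"
    by (auto simp: cvs.subspace_def Z_def lie_add_left lie_scale_left)
  have "lie x y = 0" if "y \<in> Z" for x y
    using that lie_skew[of x y] by (simp add: Z_def)
  then have "lie_ideal Z"
    using sub by (simp add: lie_ideal_def) (simp add: Z_def)
  moreover have "{lie x y |x y. x \<in> Z \<and> y \<in> Z} = {0}"
    by (auto simp: Z_def intro!: exI[of _ 0])
  then have "(derived_algebra ^^ 1) Z = {0}" by (simp add: derived_algebra_def)
  then have "solvable Z" unfolding solvable_def by blast
  ultimately have "Z = {0}" using assms(1) by (simp add: semisimple_def)
  then show ?thesis using c by (auto simp: Z_def)
qed

subsection \<open>Triangular decomposition\<close>

text \<open>Applying f - a removes the component at a and multiplies the others by nonzero factors,
  so the induction hypothesis applies. Components are indexed by their eigenvalue and may be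
  zero.\<close>

lemma eigenvectors_independent:
  assumes f: "endomorphism f" and "finite \<Lambda>"
  shows "(\<And>\<kappa>. \<kappa> \<in> \<Lambda> \<Longrightarrow> f (y \<kappa>) = \<kappa> *\<^sub>C y \<kappa>) \<Longrightarrow> (\<Sum>\<kappa>\<in>\<Lambda>. y \<kappa>) = 0 \<Longrightarrow> \<kappa> \<in> \<Lambda> \<Longrightarrow> y \<kappa> = 0"
  using assms(2)
proof (induction \<Lambda> arbitrary: y \<kappa>)
  case empty then show ?case by simp
next
  case (insert a \<Lambda>)
  have "(\<Sum>\<kappa>\<in>\<Lambda>. (\<kappa> - a) *\<^sub>C y \<kappa>) = f (\<Sum>\<kappa>\<in>insert a \<Lambda>. y \<kappa>) - a *\<^sub>C (\<Sum>\<kappa>\<in>insert a \<Lambda>. y \<kappa>)"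
    using insert.hyps insert.prems(1)
    by (simp add: endomorphism_sum[OF f] endomorphism_add[OF f] cvs.scale_right_distrib cvs.scale_sum_right
        cvs.scale_left_diff_distrib sum_subtractf)
  also have "\<dots> = 0" using insert.prems(2) by (simp add: endomorphism_0[OF f])
  finally have "(\<kappa> - a) *\<^sub>C y \<kappa> = 0" if "\<kappa> \<in> \<Lambda>" for \<kappa>
    using that insert.prems(1)
    by (intro insert.IH[of "\<lambda>\<kappa>. (\<kappa> - a) *\<^sub>C y \<kappa>"])
      (simp_all add: endomorphism_scale[OF f] scaleC_scaleC mult.commute)
  then have 0: "y \<kappa> = 0" if "\<kappa> \<in> \<Lambda>" for \<kappa> using that insert.hyps(2) by auto
  then have "y a = 0" using insert.prems(2) insert.hyps by simp
  then show ?case using 0 insert.prems(3) by auto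
qed

lemma eigenvector_decomposition:
  assumes f: "endomorphism f" and "x \<in> cvs.span {x. \<exists>c. f x = c *\<^sub>C x}"
  shows "\<exists>\<Lambda> y. finite \<Lambda> \<and> (\<forall>\<kappa>. f (y \<kappa>) = \<kappa> *\<^sub>C y \<kappa>) \<and> x = (\<Sum>\<kappa>\<in>\<Lambda>. y \<kappa>)"
  using assms(2)
proof (induction rule: cvs.span_induct_alt)
  case base
  show ?case by (intro exI[of _ "{}"] exI[of _ "\<lambda>_. 0"]) (simp add: endomorphism_0[OF f])
next
  case (step c v w)
  then obtain l \<Lambda> y where v: "f v = l *\<^sub>C v"
    and y: "finite \<Lambda>" "\<And>\<kappa>. f (y \<kappa>) = \<kappa> *\<^sub>C y \<kappa>" "w = (\<Sum>\<kappa>\<in>\<Lambda>. y \<kappa>)" by blast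
  \<comment> \<open>Outside \<Lambda> the old family may take nonzero values, in particular at l;
    these are cut off before the multiple of v is added.\<close>
  define y' where "y' \<kappa> = (if \<kappa> = l then c *\<^sub>C v else 0) + (if \<kappa> \<in> \<Lambda> then y \<kappa> else 0)" for \<kappa>
  have "(\<Sum>\<kappa>\<in>insert l \<Lambda>. if \<kappa> \<in> \<Lambda> then y \<kappa> else 0) = w"
    unfolding y(3) using y(1) by (intro sum.mono_neutral_cong_right) auto
  then have "(\<Sum>\<kappa>\<in>insert l \<Lambda>. y' \<kappa>) = c *\<^sub>C v + w"
    unfolding y'_def sum.distrib using y(1) by (simp add: sum.delta del: sum.insert)
  moreover have "f (y' \<kappa>) = \<kappa> *\<^sub>C y' \<kappa>" for \<kappa>
    by (simp add: y'_def endomorphism_add[OF f] endomorphism_scale[OF f] endomorphism_0[OF f] v y(2)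
        cvs.scale_right_distrib scaleC_scaleC mult.commute)
  ultimately show ?case using y(1) by (intro exI[of _ "insert l \<Lambda>"] exI[of _ y']) auto
qed

text \<open>The k-components of a common eigenvector x of F are again eigenvectors for F: for h in F
  with eigenvalue c, the vectors \<open>lie h (y \<kappa>) - c *\<^sub>C y \<kappa>\<close> are
  k-eigenvectors for distinct eigenvalues with sum zero, so each vanishes.\<close>

lemma simultaneous_eigenvectors:
  assumes F: "finite F" and comm: "\<And>h k. h \<in> F \<Longrightarrow> k \<in> F \<Longrightarrow> lie h k = 0"
    and diag: "\<And>h. h \<in> F \<Longrightarrow> cvs.span {x. \<exists>c. lie h x = c *\<^sub>C x} = UNIV"
  shows "cvs.span {x. \<forall>h\<in>F. \<exists>c. lie h x = c *\<^sub>C x} = UNIV"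
  using assms
proof induction
  case empty then show ?case by simp
next
  case (insert k F)
  have "x \<in> cvs.span {x. \<forall>h\<in>insert k F. \<exists>c. lie h x = c *\<^sub>C x}"
    if x: "\<forall>h\<in>F. \<exists>c. lie h x = c *\<^sub>C x" for x
  proof -
    have "x \<in> cvs.span {x. \<exists>c. lie k x = c *\<^sub>C x}" using insert.prems(2)[of k] by simp
    then obtain \<Lambda> y where y: "finite \<Lambda>" "\<And>\<kappa>. lie k (y \<kappa>) = \<kappa> *\<^sub>C y \<kappa>" "x = (\<Sum>\<kappa>\<in>\<Lambda>. y \<kappa>)"
      using eigenvector_decomposition[OF endomorphism_lie] by blast
    have "\<exists>c. lie h (y \<kappa>) = c *\<^sub>C y \<kappa>" if h: "h \<in> F" and \<kappa>: "\<kappa> \<in> \<Lambda>" for h \<kappa>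
    proof -
      obtain c where c: "lie h x = c *\<^sub>C x" using x h by blast
      have "lie k (lie h z) = lie h (lie k z)" for z
        using lie_lie[of k h z] insert.prems(1)[of k h] h by simp
      then have "lie h (y \<kappa>) - c *\<^sub>C y \<kappa> = 0"
        using c \<kappa> y
        by (intro eigenvectors_independent[OF endomorphism_lie[of k] y(1), of "\<lambda>\<kappa>. lie h (y \<kappa>) - c *\<^sub>C y \<kappa>"])
          (simp_all add: lie_diff_right lie_scale_right cvs.scale_right_diff_distrib scaleC_scaleC mult.commute
            sum_subtractf endomorphism_sum[OF endomorphism_lie] cvs.scale_sum_right)
      then show ?thesis by auto
    qed
    then have "y \<kappa> \<in> {x. \<forall>h\<in>insert k F. \<exists>c. lie h x = c *\<^sub>C x}" if "\<kappa> \<in> \<Lambda>" for \<kappa>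
      using that y(2) by blast
    then show ?thesis unfolding y(3) by (intro cvs.span_sum cvs.span_base)
  qed
  then have "cvs.span {x. \<forall>h\<in>F. \<exists>c. lie h x = c *\<^sub>C x} \<subseteq> cvs.span {x. \<forall>h\<in>insert k F. \<exists>c. lie h x = c *\<^sub>C x}"
    by (intro cvs.span_minimal) auto
  then show ?case using insert by auto
qed

lemma span_closed_lie:
  assumes "\<And>x y. x \<in> X \<Longrightarrow> y \<in> Y \<Longrightarrow> lie x y \<in> W" and W: "cvs.subspace W"
    and x: "x \<in> cvs.span X" and y: "y \<in> cvs.span Y"
  shows "lie x y \<in> W"
proof -
  have 1: "lie u y \<in> W" if "u \<in> X" for u
    using y by (induction rule: cvs.span_induct_alt)
      (auto simp: lie_add_right lie_scale_right assms(1) that cvs.subspace_0[OF W] cvs.subspace_add[OF W] cvs.subspace_scale[OF W])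
  show ?thesis
    using x by (induction rule: cvs.span_induct_alt)
      (auto simp: lie_add_left lie_scale_left 1 cvs.subspace_0[OF W] cvs.subspace_add[OF W] cvs.subspace_scale[OF W])
qed

section \<open>Root spaces, nilpotent subalgebras and the complement of the diagonal\<close>

locale triangular = invariant_nondegenerate B
  for B :: "'g::complex_lie_algebra \<Rightarrow> 'g \<Rightarrow> complex" +
  fixes H :: "'g set" and R :: "('g \<Rightarrow> complex) set"
  assumes cartan: "cartan_subalgebra H" and positive: "positive_roots H R"
begin

abbreviation N where "N \<equiv> n_plus H R"
abbreviation N' where "N' \<equiv> n_minus H R"

lemma H_subspace: "cvs.subspace H"
  and H_commutative: "h \<in> H \<Longrightarrow> k \<in> H \<Longrightarrow> lie h k = 0"
  and H_centralizer: "(\<And>h. h \<in> H \<Longrightarrow> lie h x = 0) \<Longrightarrow> x \<in> H"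
  and H_diagonalizable: "h \<in> H \<Longrightarrow> cvs.span {x. \<exists>c. lie h x = c *\<^sub>C x} = UNIV"
  using cartan unfolding cartan_subalgebra_def by blast+

text \<open>Diagonalizability is given for single elements of H; a basis of H reduces the
  simultaneous problem to a finite commuting family.\<close>

lemma weight_vectors_span: "cvs.span (\<Union>\<alpha>\<in>dual_of H. root_space H \<alpha>) = UNIV"
proof -
  obtain F where F: "F \<subseteq> H" "cvs.independent F" "H \<subseteq> cvs.span F"
    using cvs.basis_exists[of H] by metis
  have "finite F" using F(2) by (rule cvs.finiteI_independent)
  then have span: "cvs.span {x. \<forall>h\<in>F. \<exists>c. lie h x = c *\<^sub>C x} = UNIV"
    by (rule simultaneous_eigenvectors) (use F(1) H_commutative H_diagonalizable in blast)+
  have "x \<in> (\<Union>\<alpha>\<in>dual_of H. root_space H \<alpha>)" if x: "\<forall>h\<in>F. \<exists>c. lie h x = c *\<^sub>C x" for x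
  proof -
    have "cvs.subspace {h. \<exists>c. lie h x = c *\<^sub>C x}"
      unfolding cvs.subspace_def
    proof (intro conjI ballI allI)
      show "0 \<in> {h. \<exists>c. lie h x = c *\<^sub>C x}" by (auto intro: exI[of _ 0])
    next
      fix h k assume "h \<in> {h. \<exists>c. lie h x = c *\<^sub>C x}" "k \<in> {h. \<exists>c. lie h x = c *\<^sub>C x}"
      then show "h + k \<in> {h. \<exists>c. lie h x = c *\<^sub>C x}" by (auto simp: lie_add_left simp flip: scaleC_add_left)
    next
      fix c h assume "h \<in> {h. \<exists>c. lie h x = c *\<^sub>C x}"
      then show "c *\<^sub>C h \<in> {h. \<exists>c. lie h x = c *\<^sub>C x}" by (auto simp: lie_scale_left scaleC_scaleC)
    qed
    then have "cvs.span F \<subseteq> {h. \<exists>c. lie h x = c *\<^sub>C x}" using x by (intro cvs.span_minimal) auto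
    then have "\<forall>h\<in>H. \<exists>c. lie h x = c *\<^sub>C x" using F(3) by blast
    then obtain a where a: "\<And>h. h \<in> H \<Longrightarrow> lie h x = a h *\<^sub>C x" by metis
    \<comment> \<open>Outside H, and everywhere if \<open>x = 0\<close>, the eigenvalue function a
      is arbitrary; the value 0 there makes \<alpha> a member of \<open>dual_of H\<close>.\<close>
    define \<alpha> where "\<alpha> h = (if h \<in> H \<and> x \<noteq> 0 then a h else 0)" for h
    have "x \<in> root_space H \<alpha>" using a by (auto simp: root_space_def \<alpha>_def)
    moreover have "\<alpha> \<in> dual_of H"
    proof (cases "x = 0")
      case True then show ?thesis by (simp add: \<alpha>_def dual_of_def)
    next
      case False
      have "a (h + k) *\<^sub>C x = (a h + a k) *\<^sub>C x" if "h \<in> H" "k \<in> H" for h k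
        using that a[of "h + k"] cvs.subspace_add[OF H_subspace] by (simp add: lie_add_left a scaleC_add_left)
      moreover have "a (c *\<^sub>C h) *\<^sub>C x = (c * a h) *\<^sub>C x" if "h \<in> H" for c h
        using that a[of "c *\<^sub>C h"] cvs.subspace_scale[OF H_subspace]
        by (simp add: lie_scale_left a scaleC_scaleC eq_commute[of "a (c *\<^sub>C h)"])
      ultimately show ?thesis
        using False cvs.subspace_add[OF H_subspace] cvs.subspace_scale[OF H_subspace]
        by (simp add: \<alpha>_def dual_of_def)
    qed
    ultimately show ?thesis by blast
  qed
  then have "{x. \<forall>h\<in>F. \<exists>c. lie h x = c *\<^sub>C x} \<subseteq> (\<Union>\<alpha>\<in>dual_of H. root_space H \<alpha>)" by blast
  then show ?thesis using span cvs.span_mono by blast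
qed

lemma root_in_roots: "\<alpha> \<in> R \<Longrightarrow> \<alpha> \<in> roots H"
  using positive unfolding positive_roots_def by (elim conjE) (rule subsetD)

lemma root_in_dual: "\<alpha> \<in> R \<Longrightarrow> \<alpha> \<in> dual_of H"
  using root_in_roots by (simp add: roots_def)

lemma positive_xor: "\<alpha> \<in> roots H \<Longrightarrow> (\<alpha> \<in> R) \<noteq> (neg_root \<alpha> \<in> R)"
  using positive unfolding positive_roots_def
  by (elim conjE) (rule bspec[where P = "\<lambda>\<alpha>. (\<alpha> \<in> R) \<noteq> (neg_root \<alpha> \<in> R)"])

lemma positive_cases: "\<alpha> \<in> roots H \<Longrightarrow> \<alpha> \<in> R \<or> neg_root \<alpha> \<in> R"
  using positive_xor by blast

lemma positive_exclusive: "\<alpha> \<in> R \<Longrightarrow> neg_root \<alpha> \<notin> R"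
  using positive_xor root_in_roots by blast

lemma positive_add:
  "\<alpha> \<in> R \<Longrightarrow> \<beta> \<in> R \<Longrightarrow> (\<lambda>h. \<alpha> h + \<beta> h) \<in> roots H \<Longrightarrow> (\<lambda>h. \<alpha> h + \<beta> h) \<in> R"
  using positive unfolding positive_roots_def by (elim conjE) simp

lemma dual_of_eq_0: "\<alpha> \<in> dual_of H \<Longrightarrow> (\<And>h. h \<in> H \<Longrightarrow> \<alpha> h = 0) \<Longrightarrow> \<alpha> = (\<lambda>_. 0)"
  by (auto simp: dual_of_def fun_eq_iff)

lemma dual_of_add: "\<alpha> \<in> dual_of H \<Longrightarrow> \<beta> \<in> dual_of H \<Longrightarrow> (\<lambda>h. \<alpha> h + \<beta> h) \<in> dual_of H"
  by (auto simp: dual_of_def algebra_simps)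

lemma root_nonzero: "\<alpha> \<in> R \<Longrightarrow> \<exists>h\<in>H. \<alpha> h \<noteq> 0"
  using dual_of_eq_0[OF root_in_dual] root_in_roots by (fastforce simp: roots_def)

lemma root_add_nonzero:
  assumes "\<alpha> \<in> R" "\<beta> \<in> R"
  shows "\<exists>h\<in>H. \<alpha> h + \<beta> h \<noteq> 0"
proof (rule ccontr)
  assume "\<not> ?thesis"
  then have "(\<lambda>h. \<alpha> h + \<beta> h) = (\<lambda>_. 0)"
    by (intro dual_of_eq_0 dual_of_add root_in_dual assms) auto
  then have "\<beta> = neg_root \<alpha>"
    by (simp add: neg_root_def fun_eq_iff) (metis add.commute add_eq_0_iff)
  then show False using positive_exclusive assms by blast
qed

text \<open>Invariance moves h from one argument of B to the other, so multiplying
  \<open>B x y\<close> by - \<alpha> h and by \<beta> h gives the same result.\<close>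

lemma root_space_orthogonal:
  assumes x: "x \<in> root_space H \<alpha>" and y: "y \<in> root_space H \<beta>" and h: "h \<in> H" "\<alpha> h + \<beta> h \<noteq> 0"
  shows "B x y = 0"
proof -
  have "B (lie x h) y = B x (lie h y)" by (rule form_lie)
  then have "- (\<alpha> h * B x y) = \<beta> h * B x y"
    using x y h lie_skew[of x h] by (simp add: root_space_def form_simps)
  then have "(\<alpha> h + \<beta> h) * B x y = 0" by (simp only: distrib_right neg_eq_iff_add_eq_0)
  then show ?thesis using h by simp
qed

lemma H_root_space: "H \<subseteq> root_space H (\<lambda>_. 0)"
  by (auto simp: root_space_def H_commutative)

lemma span_orthogonal:
  assumes "\<And>x y. x \<in> X \<Longrightarrow> y \<in> Y \<Longrightarrow> B x y = 0" "x \<in> cvs.span X" "y \<in> cvs.span Y"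
  shows "B x y = 0"
proof -
  have 1: "B u y = 0" if "u \<in> X" for u
    using assms(3) by (induction rule: cvs.span_induct_alt) (auto simp: form_simps assms(1) that)
  show ?thesis
    using assms(2) by (induction rule: cvs.span_induct_alt) (auto simp: form_simps 1)
qed

lemma span_H: "h \<in> H \<Longrightarrow> h \<in> cvs.span H"
  by (rule cvs.span_base)

lemma
  shows form_H_N: "h \<in> H \<Longrightarrow> p \<in> N \<Longrightarrow> B h p = 0"
    and form_H_N': "h \<in> H \<Longrightarrow> q \<in> N' \<Longrightarrow> B h q = 0"
    and form_N_N: "p \<in> N \<Longrightarrow> p' \<in> N \<Longrightarrow> B p p' = 0"
    and form_N'_N': "q \<in> N' \<Longrightarrow> q' \<in> N' \<Longrightarrow> B q q' = 0"
proof -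
  have "B h x = 0" if "h \<in> H" "\<alpha> \<in> R" "x \<in> root_space H \<alpha>" for h \<alpha> x
    using root_nonzero[OF that(2)] that H_root_space root_space_orthogonal[of h "\<lambda>_. 0" x \<alpha>] by auto
  then show "h \<in> H \<Longrightarrow> p \<in> N \<Longrightarrow> B h p = 0"
    unfolding n_plus_def by (intro span_orthogonal[of H _ h p] span_H) auto
  have "B h x = 0" if "h \<in> H" "\<alpha> \<in> R" "x \<in> root_space H (neg_root \<alpha>)" for h \<alpha> x
    using root_nonzero[OF that(2)] that H_root_space root_space_orthogonal[of h "\<lambda>_. 0" x "neg_root \<alpha>"]
    by (auto simp: neg_root_def)
  then show "h \<in> H \<Longrightarrow> q \<in> N' \<Longrightarrow> B h q = 0"
    unfolding n_minus_def by (intro span_orthogonal[of H _ h q] span_H) auto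
  have "B x y = 0" if "\<alpha> \<in> R" "\<beta> \<in> R" "x \<in> root_space H \<alpha>" "y \<in> root_space H \<beta>" for x y \<alpha> \<beta>
    using root_add_nonzero[OF that(1,2)] root_space_orthogonal that(3,4) by blast
  then show "p \<in> N \<Longrightarrow> p' \<in> N \<Longrightarrow> B p p' = 0"
    unfolding n_plus_def
    by (intro span_orthogonal[of "\<Union>\<alpha>\<in>R. root_space H \<alpha>" "\<Union>\<alpha>\<in>R. root_space H \<alpha>" p p']) auto
  have "B x y = 0" if "\<alpha> \<in> R" "\<beta> \<in> R" "x \<in> root_space H (neg_root \<alpha>)" "y \<in> root_space H (neg_root \<beta>)" for x y \<alpha> \<beta>
  proof -
    have "\<exists>h\<in>H. \<alpha> h + \<beta> h \<noteq> 0" using that(1,2) by (rule root_add_nonzero)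
    then obtain h where "h \<in> H" "\<alpha> h + \<beta> h \<noteq> 0" by blast
    then have "neg_root \<alpha> h + neg_root \<beta> h \<noteq> 0"
      by (simp add: neg_root_def) (metis add.commute add_eq_0_iff neg_eq_iff_add_eq_0)
    then show ?thesis using root_space_orthogonal[OF that(3,4) \<open>h \<in> H\<close>] by blast
  qed
  then show "q \<in> N' \<Longrightarrow> q' \<in> N' \<Longrightarrow> B q q' = 0"
    unfolding n_minus_def
    by (intro span_orthogonal[of "\<Union>\<alpha>\<in>R. root_space H (neg_root \<alpha>)"
          "\<Union>\<alpha>\<in>R. root_space H (neg_root \<alpha>)" q q']) auto
qed

lemma form_N_H: "p \<in> N \<Longrightarrow> h \<in> H \<Longrightarrow> B p h = 0"
  and form_N'_H: "q \<in> N' \<Longrightarrow> h \<in> H \<Longrightarrow> B q h = 0"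
  using form_H_N form_H_N' form_sym by metis+

lemma N_subspace: "cvs.subspace N" and N'_subspace: "cvs.subspace N'"
  by (simp_all add: n_plus_def n_minus_def cvs.subspace_span)

lemma root_space_lie:
  "x \<in> root_space H \<alpha> \<Longrightarrow> y \<in> root_space H \<beta> \<Longrightarrow> lie x y \<in> root_space H (\<lambda>h. \<alpha> h + \<beta> h)"
proof -
  assume x: "x \<in> root_space H \<alpha>" and y: "y \<in> root_space H \<beta>"
  have "lie h (lie x y) = lie (lie h x) y + lie x (lie h y)" for h
    using lie_lie[of h x y] by simp
  then show ?thesis
    using x y by (simp add: root_space_def lie_scale_left lie_scale_right scaleC_add_left)
qed

text \<open>Otherwise z would be orthogonal to all weight spaces, since only opposite weights pair
  nontrivially. The lemma is needed for brackets in \<open>N'\<close>: \<open>positive_roots\<close>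
  closes R itself under addition, so a nonzero vector of weight - (\<alpha> + \<beta>) must first
  yield the root \<alpha> + \<beta>.\<close>

lemma opposite_root_space_nonzero:
  assumes \<gamma>: "\<gamma> \<in> dual_of H" and z: "z \<in> root_space H (neg_root \<gamma>)" "z \<noteq> 0"
  shows "root_space H \<gamma> \<noteq> {0}"
proof
  assume 0: "root_space H \<gamma> = {0}"
  have "B z v = 0" if v: "v \<in> root_space H \<delta>" "\<delta> \<in> dual_of H" for v \<delta>
  proof (cases "\<exists>h\<in>H. neg_root \<gamma> h + \<delta> h \<noteq> 0")
    case True then show ?thesis using root_space_orthogonal[OF z(1) v(1)] by blast
  next
    case False
    then have "\<delta> = \<gamma>" using v(2) \<gamma> by (auto simp: neg_root_def dual_of_def fun_eq_iff)
    then show ?thesis using 0 v(1) by (simp add: form_simps)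
  qed
  then have "B z v = 0" for v
  proof (intro span_orthogonal[of "{z}" "\<Union>\<alpha>\<in>dual_of H. root_space H \<alpha>" z v])
    show "z \<in> cvs.span {z}" by (rule cvs.span_base) simp
    show "v \<in> cvs.span (\<Union>\<alpha>\<in>dual_of H. root_space H \<alpha>)" by (simp only: weight_vectors_span UNIV_I)
  qed blast
  then have "z = 0" by (intro form_eqI) (simp add: form_simps)
  then show False using z(2) by simp
qed

lemma lie_H_N:
  assumes h: "h \<in> H" and p: "p \<in> N"
  shows "lie h p \<in> N"
proof (rule span_closed_lie[OF _ N_subspace span_H[OF h] p[unfolded n_plus_def]])
  fix k x assume k: "k \<in> H" and "x \<in> (\<Union>\<alpha>\<in>R. root_space H \<alpha>)"
  then obtain \<alpha> where \<alpha>: "\<alpha> \<in> R" "x \<in> root_space H \<alpha>" by blast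
  then have "x \<in> N" unfolding n_plus_def by (intro cvs.span_base) blast
  then show "lie k x \<in> N" using k \<alpha>(2) cvs.subspace_scale[OF N_subspace] by (simp add: root_space_def)
qed

lemma lie_H_N':
  assumes h: "h \<in> H" and q: "q \<in> N'"
  shows "lie h q \<in> N'"
proof (rule span_closed_lie[OF _ N'_subspace span_H[OF h] q[unfolded n_minus_def]])
  fix k x assume k: "k \<in> H" and "x \<in> (\<Union>\<alpha>\<in>R. root_space H (neg_root \<alpha>))"
  then obtain \<alpha> where \<alpha>: "\<alpha> \<in> R" "x \<in> root_space H (neg_root \<alpha>)" by blast
  then have "x \<in> N'" unfolding n_minus_def by (intro cvs.span_base) blast
  then show "lie k x \<in> N'" using k \<alpha>(2) cvs.subspace_scale[OF N'_subspace] by (simp add: root_space_def)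
qed

lemma lie_N_N:
  assumes p: "p \<in> N" and p': "p' \<in> N"
  shows "lie p p' \<in> N"
proof -
  have "lie x y \<in> N" if "\<alpha> \<in> R" "\<beta> \<in> R" "x \<in> root_space H \<alpha>" "y \<in> root_space H \<beta>" for x y \<alpha> \<beta>
  proof (cases "lie x y = 0")
    case True then show ?thesis using cvs.subspace_0[OF N_subspace] by simp
  next
    case False
    have xy: "lie x y \<in> root_space H (\<lambda>h. \<alpha> h + \<beta> h)" using root_space_lie that by blast
    then have "root_space H (\<lambda>h. \<alpha> h + \<beta> h) \<noteq> {0}" using False by blast
    then have "(\<lambda>h. \<alpha> h + \<beta> h) \<in> roots H"
      using root_add_nonzero[OF that(1,2)] dual_of_add[OF root_in_dual root_in_dual, OF that(1,2)]
      unfolding roots_def by (simp add: fun_eq_iff) blast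
    then show ?thesis
      using xy positive_add[OF that(1,2)] unfolding n_plus_def by (intro cvs.span_base) blast
  qed
  then show "lie p p' \<in> N"
    by (intro span_closed_lie[OF _ N_subspace p[unfolded n_plus_def] p'[unfolded n_plus_def]]) blast
qed

lemma lie_N'_N':
  assumes q: "q \<in> N'" and q': "q' \<in> N'"
  shows "lie q q' \<in> N'"
proof -
  have "lie x y \<in> N'"
    if "\<alpha> \<in> R" "\<beta> \<in> R" "x \<in> root_space H (neg_root \<alpha>)" "y \<in> root_space H (neg_root \<beta>)" for x y \<alpha> \<beta>
  proof (cases "lie x y = 0")
    case True then show ?thesis using cvs.subspace_0[OF N'_subspace] by simp
  next
    case False
    let ?\<gamma> = "\<lambda>h. \<alpha> h + \<beta> h"
    have dual: "?\<gamma> \<in> dual_of H" using dual_of_add root_in_dual that by blast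
    have "lie x y \<in> root_space H (\<lambda>h. neg_root \<alpha> h + neg_root \<beta> h)" using root_space_lie that by blast
    then have xy: "lie x y \<in> root_space H (neg_root ?\<gamma>)" by (simp add: neg_root_def)
    then have "root_space H ?\<gamma> \<noteq> {0}" using opposite_root_space_nonzero[OF dual] False by blast
    then have "?\<gamma> \<in> roots H"
      using root_add_nonzero[OF that(1,2)] dual unfolding roots_def by (simp add: fun_eq_iff) blast
    then show ?thesis
      using xy positive_add[OF that(1,2)] unfolding n_minus_def by (intro cvs.span_base) blast
  qed
  then show "lie q q' \<in> N'"
    by (intro span_closed_lie[OF _ N'_subspace q[unfolded n_minus_def] q'[unfolded n_minus_def]]) blast
qed

text \<open>Weight vectors span, and each lies in one summand: weight 0 because H is its own
  centralizer, any other weight according to the sign of the root.\<close>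

lemma triangular_decomposition: "\<exists>h\<in>H. \<exists>p\<in>N. \<exists>q\<in>N'. x = h + p + q"
proof -
  define U where "U = {h + p + q | h p q. h \<in> H \<and> p \<in> N \<and> q \<in> N'}"
  have memU: "h + p + q \<in> U" if "h \<in> H" "p \<in> N" "q \<in> N'" for h p q using that by (auto simp: U_def)
  note 0 = cvs.subspace_0[OF H_subspace] cvs.subspace_0[OF N_subspace] cvs.subspace_0[OF N'_subspace]
  have sub: "cvs.subspace U"
    unfolding cvs.subspace_def
  proof (intro conjI ballI allI)
    show "0 \<in> U" using memU[OF 0] by simp
  next
    fix x y assume "x \<in> U" "y \<in> U"
    then obtain h p q h' p' q' where
      "x = h + p + q" "y = h' + p' + q'" "h \<in> H" "p \<in> N" "q \<in> N'" "h' \<in> H" "p' \<in> N" "q' \<in> N'"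
      unfolding U_def by blast
    moreover from this have "h + h' + (p + p') + (q + q') \<in> U"
      by (intro memU cvs.subspace_add H_subspace N_subspace N'_subspace)
    ultimately show "x + y \<in> U" by (simp add: add_ac)
  next
    fix c x assume "x \<in> U"
    then obtain h p q where "x = h + p + q" "h \<in> H" "p \<in> N" "q \<in> N'" unfolding U_def by blast
    moreover from this have "c *\<^sub>C h + c *\<^sub>C p + c *\<^sub>C q \<in> U"
      by (intro memU cvs.subspace_scale H_subspace N_subspace N'_subspace)
    ultimately show "c *\<^sub>C x \<in> U" by (simp add: scaleC_add_right)
  qed
  have "x \<in> U" if "\<alpha> \<in> dual_of H" and x: "x \<in> root_space H \<alpha>" for \<alpha> x
  proof (cases "x = 0")
    case True then show ?thesis using cvs.subspace_0[OF sub] by simp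
  next
    case False
    show ?thesis
    proof (cases "\<alpha> = (\<lambda>_. 0)")
      case True
      then have "x \<in> H" using x by (intro H_centralizer) (simp add: root_space_def)
      then show ?thesis using memU[OF _ 0(2,3)] by simp
    next
      case nz: False
      then have "\<alpha> \<in> roots H" using that False by (auto simp: roots_def)
      then consider "\<alpha> \<in> R" | "neg_root \<alpha> \<in> R" using positive_cases by blast
      then show ?thesis
      proof cases
        case 1
        then have "x \<in> N" unfolding n_plus_def using x by (intro cvs.span_base) blast
        then show ?thesis using memU[OF 0(1) _ 0(3)] by simp
      next
        case 2
        have "neg_root (neg_root \<alpha>) = \<alpha>" by (simp add: neg_root_def)
        then have "x \<in> N'" unfolding n_minus_def using x 2 by (intro cvs.span_base) force
        then show ?thesis using memU[OF 0(1,2)] by simp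
      qed
    qed
  qed
  then have "cvs.span (\<Union>\<alpha>\<in>dual_of H. root_space H \<alpha>) \<subseteq> U" by (intro cvs.span_minimal sub) blast
  then show ?thesis unfolding weight_vectors_span U_def by blast
qed

lemma orthogonal_all:
  assumes "\<And>h. h \<in> H \<Longrightarrow> B x h = 0" "\<And>p. p \<in> N \<Longrightarrow> B x p = 0" "\<And>q. q \<in> N' \<Longrightarrow> B x q = 0"
  shows "x = 0"
proof (rule form_eqI)
  fix y
  obtain h p q where "h \<in> H" "p \<in> N" "q \<in> N'" "y = h + p + q" using triangular_decomposition by blast
  then show "B x y = B 0 y" using assms by (simp add: form_simps)
qed

lemma H_N_disjoint: "x \<in> H \<Longrightarrow> x \<in> N \<Longrightarrow> x = 0"
  by (rule orthogonal_all) (simp_all add: form_N_H form_H_N form_H_N')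

lemma H_N'_disjoint: "x \<in> H \<Longrightarrow> x \<in> N' \<Longrightarrow> x = 0"
  by (rule orthogonal_all) (simp_all add: form_N'_H form_H_N form_H_N')

lemma cartan_part_eq:
  assumes U: "cvs.subspace U" "\<And>x. x \<in> H \<Longrightarrow> x \<in> U \<Longrightarrow> x = 0" and h: "h \<in> H" and n: "n \<in> U"
  shows "cartan_part H U (h + n) = h"
  unfolding cartan_part_def
proof (rule the_equality)
  show "h \<in> H \<and> h + n - h \<in> U" using h n by simp
  fix k assume k: "k \<in> H \<and> h + n - k \<in> U"
  then have "h - k \<in> H" using h H_subspace cvs.subspace_diff by blast
  moreover have "(h + n - k) - n \<in> U" using k n U(1) cvs.subspace_diff by blast
  then have "h - k \<in> U" by (simp add: algebra_simps)
  ultimately have "h - k = 0" by (rule U(2))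
  then show "k = h" by simp
qed

lemma manin_m_iff: "z \<in> manin_m H R \<longleftrightarrow> (\<exists>h\<in>H. \<exists>p\<in>N. \<exists>q\<in>N'. z = (h + q, - h + p))"
proof
  assume "z \<in> manin_m H R"
  then obtain h q k p where z: "z = (h + q, k + p)" "h \<in> H" "q \<in> N'" "k \<in> H" "p \<in> N"
    "cartan_part H N' (h + q) + cartan_part H N (k + p) = 0"
    by (auto simp: manin_m_def b_minus_def b_plus_def)
  then have "k = - h"
    by (simp add: cartan_part_eq[OF N_subspace H_N_disjoint] cartan_part_eq[OF N'_subspace H_N'_disjoint]
        eq_neg_iff_add_eq_0 add.commute)
  then show "\<exists>h\<in>H. \<exists>p\<in>N. \<exists>q\<in>N'. z = (h + q, - h + p)" using z by blast
next
  assume "\<exists>h\<in>H. \<exists>p\<in>N. \<exists>q\<in>N'. z = (h + q, - h + p)"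
  then obtain h p q where z: "z = (h + q, - h + p)" "h \<in> H" "p \<in> N" "q \<in> N'" by blast
  moreover have "- h \<in> H" using z(2) H_subspace cvs.subspace_neg by blast
  ultimately have "h + q \<in> b_minus H R" "- h + p \<in> b_plus H R"
    "cartan_part H N' (h + q) = h" "cartan_part H N (- h + p) = - h"
    using cartan_part_eq[OF N'_subspace H_N'_disjoint, of h q] cartan_part_eq[OF N_subspace H_N_disjoint, of "- h" p]
    unfolding b_minus_def b_plus_def by blast+
  then show "z \<in> manin_m H R" by (simp add: manin_m_def z(1))
qed

lemma manin_m_add: "z \<in> manin_m H R \<Longrightarrow> w \<in> manin_m H R \<Longrightarrow> z + w \<in> manin_m H R"
proof -
  assume "z \<in> manin_m H R" "w \<in> manin_m H R"
  then obtain h p q h' p' q' where zw: "z = (h + q, - h + p)" "w = (h' + q', - h' + p')"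
    and mem: "h \<in> H" "p \<in> N" "q \<in> N'" "h' \<in> H" "p' \<in> N" "q' \<in> N'"
    unfolding manin_m_iff by blast
  have "z + w = ((h + h') + (q + q'), - (h + h') + (p + p'))" by (simp add: zw algebra_simps)
  moreover have "h + h' \<in> H" "p + p' \<in> N" "q + q' \<in> N'"
    using mem by (auto intro: cvs.subspace_add H_subspace N_subspace N'_subspace)
  ultimately show ?thesis unfolding manin_m_iff by blast
qed

lemma manin_m_scale: "z \<in> manin_m H R \<Longrightarrow> scale_pair c z \<in> manin_m H R"
proof -
  assume "z \<in> manin_m H R"
  then obtain h p q where z: "z = (h + q, - h + p)" and mem: "h \<in> H" "p \<in> N" "q \<in> N'"
    unfolding manin_m_iff by blast
  have "scale_pair c z = (c *\<^sub>C h + c *\<^sub>C q, - (c *\<^sub>C h) + c *\<^sub>C p)"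
    by (simp add: z scale_pair_def scaleC_add_right cvs.scale_minus_right cvs.scale_right_diff_distrib)
  moreover have "c *\<^sub>C h \<in> H" "c *\<^sub>C p \<in> N" "c *\<^sub>C q \<in> N'"
    using mem by (auto intro: cvs.subspace_scale H_subspace N_subspace N'_subspace)
  ultimately show ?thesis unfolding manin_m_iff by blast
qed

text \<open>The root parts are isotropic and orthogonal to H; the Cartan contributions of the two
  components cancel because h enters them with opposite signs while the double form is a
  difference.\<close>

lemma manin_m_isotropic:
  assumes "z \<in> manin_m H R" "w \<in> manin_m H R"
  shows "dform z w = 0"
  using assms unfolding manin_m_iff
  by (auto simp: double_form_def form_simps form_H_N form_H_N' form_N_H form_N'_H form_N_N form_N'_N')

lemma manin_m_lie:
  assumes "z \<in> manin_m H R" "w \<in> manin_m H R"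
  shows "lie_pair z w \<in> manin_m H R"
proof -
  obtain h p q h' p' q' where zw: "z = (h + q, - h + p)" "w = (h' + q', - h' + p')"
    and mem: "h \<in> H" "p \<in> N" "q \<in> N'" "h' \<in> H" "p' \<in> N" "q' \<in> N'"
    using assms unfolding manin_m_iff by blast
  \<comment> \<open>As H is commutative, both Cartan parts of the bracket are 0 and hence opposite
    to each other.\<close>
  have "lie_pair z w = (0 + (lie h q' - lie h' q + lie q q'), - 0 + (- lie h p' + lie h' p + lie p p'))"
    using H_commutative[OF mem(1,4)] lie_skew[of q h'] lie_skew[of p h']
    by (simp add: zw lie_pair_def lie_add_left lie_add_right lie_neg_left lie_neg_right lie_diff_right lie_diff_left)
  moreover have "lie h q' - lie h' q + lie q q' \<in> N'" "- lie h p' + lie h' p + lie p p' \<in> N"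
    by (intro cvs.subspace_add cvs.subspace_diff cvs.subspace_neg N_subspace N'_subspace
        lie_H_N[OF mem(1,5)] lie_H_N[OF mem(4,2)] lie_H_N'[OF mem(1,6)] lie_H_N'[OF mem(4,3)]
        lie_N_N[OF mem(2,5)] lie_N'_N'[OF mem(3,6)])+
  ultimately show ?thesis unfolding manin_m_iff using cvs.subspace_0[OF H_subspace] by blast
qed

lemma pairing_tensor_space:
  assumes "T \<in> tensor_space X Y" and \<xi>: "functional \<xi>" and \<eta>: "functional \<eta>"
    and 0: "(\<forall>x\<in>X. \<xi> x = 0) \<or> (\<forall>y\<in>Y. \<eta> y = 0)"
  shows "pairing T \<xi> \<eta> = 0"
proof -
  obtain n :: nat and u v where uv: "\<And>i. i < n \<Longrightarrow> u i \<in> X" "\<And>i. i < n \<Longrightarrow> v i \<in> Y"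
    and T: "T = (\<lambda>\<mu> \<nu>. \<Sum>i<n. tensor (u i) (v i) \<mu> \<nu>)"
    using assms(1) unfolding tensor_space_def by blast
  have "pairing T \<xi> \<eta> = (\<Sum>\<mu>\<in>lie_basis. \<Sum>\<nu>\<in>lie_basis. \<Sum>i<n. (coord \<mu> (u i) * \<xi> \<mu>) * (coord \<nu> (v i) * \<eta> \<nu>))"
    unfolding pairing_def T tensor_def sum_distrib_right by (intro sum.cong refl) (simp add: mult_ac)
  also have "\<dots> = (\<Sum>i<n. \<Sum>\<mu>\<in>lie_basis. \<Sum>\<nu>\<in>lie_basis. (coord \<mu> (u i) * \<xi> \<mu>) * (coord \<nu> (v i) * \<eta> \<nu>))"
    by (simp add: sum.swap[of _ "{..<n}"])
  also have "\<dots> = (\<Sum>i<n. \<xi> (u i) * \<eta> (v i))"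
    by (intro sum.cong refl) (simp only: functional_expand[OF \<xi>, of "u _"] functional_expand[OF \<eta>, of "v _"] sum_product)
  also have "\<dots> = 0" using 0 uv by (intro sum.neutral) auto
  finally show ?thesis .
qed

end

section \<open>The tensor r and its contractions\<close>

lemma pairing_add_left:
  "pairing T (\<lambda>a. \<xi> a + \<xi>' a) \<eta> = pairing T \<xi> \<eta> + pairing T \<xi>' \<eta>"
  and pairing_add_right:
  "pairing T \<xi> (\<lambda>a. \<eta> a + \<eta>' a) = pairing T \<xi> \<eta> + pairing T \<xi> \<eta>'"
  by (simp_all add: pairing_def algebra_simps sum.distrib)

lemma pairing_coord:
  assumes "\<mu> \<in> lie_basis" "\<nu> \<in> lie_basis"
  shows "pairing T (coord \<mu>) (coord \<nu>) = T \<mu> \<nu>"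
proof -
  have "pairing T (coord \<mu>) (coord \<nu>) = (\<Sum>\<alpha>\<in>lie_basis. if \<alpha> = \<mu> then T \<mu> \<nu> else 0)"
    unfolding pairing_def
    by (intro sum.cong refl) (simp add: coord_basis assms finite_lie_basis if_distrib cong: if_cong)
  then show ?thesis using assms by (simp add: finite_lie_basis)
qed

locale triangular_tensor = triangular B H R
  for B :: "'g::complex_lie_algebra \<Rightarrow> 'g \<Rightarrow> complex" and H R +
  fixes t0 t1 t2 r :: "'g tensor"
  assumes t0: "t0 \<in> tensor_space H H" and t1: "t1 \<in> tensor_space N N'" and t2: "t2 \<in> tensor_space N' N"
    and t: "form_tensor B = (\<lambda>\<mu> \<nu>. t0 \<mu> \<nu> + t1 \<mu> \<nu> + t2 \<mu> \<nu>)"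
    and r: "r = (\<lambda>\<mu> \<nu>. t0 \<mu> \<nu> / 2 + t1 \<mu> \<nu>)"
begin

lemma pairing_t: "pairing t0 (B x) (B y) + pairing t1 (B x) (B y) + pairing t2 (B x) (B y) = B x y"
  using pairing_form_tensor[OF form_functional, of x y] form_sym[of x y] unfolding t
  by (simp add: pairing_add_tensor)

text \<open>B pairs H with itself and N with \<open>N'\<close>. Hence on \<open>B x\<close> and
  \<open>B y\<close> the tensor \<open>t0\<close> sees only the H-parts, \<open>t1\<close> only x in
  \<open>N'\<close> and y in N, and \<open>t2\<close> only x in N and y in
  \<open>N'\<close>.\<close>

lemma pairing_0 [simp]:
  shows "p \<in> N \<Longrightarrow> pairing t0 (B p) (B x) = 0" "p \<in> N \<Longrightarrow> pairing t0 (B x) (B p) = 0"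
    "q \<in> N' \<Longrightarrow> pairing t0 (B q) (B x) = 0" "q \<in> N' \<Longrightarrow> pairing t0 (B x) (B q) = 0"
    "h \<in> H \<Longrightarrow> pairing t1 (B h) (B x) = 0" "h \<in> H \<Longrightarrow> pairing t1 (B x) (B h) = 0"
    "p \<in> N \<Longrightarrow> pairing t1 (B p) (B x) = 0" "q \<in> N' \<Longrightarrow> pairing t1 (B x) (B q) = 0"
    "h \<in> H \<Longrightarrow> pairing t2 (B h) (B x) = 0" "h \<in> H \<Longrightarrow> pairing t2 (B x) (B h) = 0"
    "q \<in> N' \<Longrightarrow> pairing t2 (B q) (B x) = 0" "p \<in> N \<Longrightarrow> pairing t2 (B x) (B p) = 0"
  by (auto intro!: pairing_tensor_space[OF t0 form_functional form_functional]
      pairing_tensor_space[OF t1 form_functional form_functional]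
      pairing_tensor_space[OF t2 form_functional form_functional]
      simp: form_H_N form_H_N' form_N_H form_N'_H form_N_N form_N'_N')

lemma form_add_fun: "B (x + y) = (\<lambda>a. B x a + B y a)"
  by (simp add: fun_eq_iff form_simps)

lemma pairing_r:
  assumes "h \<in> H" "p \<in> N" "q \<in> N'" "h' \<in> H" "p' \<in> N" "q' \<in> N'"
  shows "pairing r (B (h + p + q)) (B (h' + p' + q')) = B h h' / 2 + B q p'"
proof -
  have "pairing r \<xi> \<eta> = pairing t0 \<xi> \<eta> / 2 + pairing t1 \<xi> \<eta>" for \<xi> \<eta>
    unfolding r pairing_def sum_divide_distrib sum.distrib[symmetric]
    by (intro sum.cong refl) (simp add: algebra_simps)
  moreover have "pairing t0 (B h) (B h') = B h h'" using pairing_t[of h h'] assms by simp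
  moreover have "pairing t1 (B q) (B p') = B q p'" using pairing_t[of q p'] assms by simp
  ultimately show ?thesis
    unfolding form_add_fun pairing_add_left pairing_add_right using assms by simp
qed

lemma coord_form: "\<mu> \<in> lie_basis \<Longrightarrow> coord \<mu> = B (dual_vector B \<mu>)"
  by (simp add: fun_eq_iff form_dual_vector)

text \<open>Compared block by block: the two halves of the Cartan pairing add up to one, and the
  transposed copy of \<open>t1\<close> supplies the block of the form tensor that \<open>t2\<close>
  carries.\<close>

lemma r_plus_transpose:
  assumes \<mu>: "\<mu> \<in> lie_basis" and \<nu>: "\<nu> \<in> lie_basis"
  shows "r \<mu> \<nu> + r \<nu> \<mu> = form_tensor B \<mu> \<nu>"
proof -
  obtain h p q where x: "dual_vector B \<mu> = h + p + q" "h \<in> H" "p \<in> N" "q \<in> N'"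
    using triangular_decomposition by blast
  obtain h' p' q' where y: "dual_vector B \<nu> = h' + p' + q'" "h' \<in> H" "p' \<in> N" "q' \<in> N'"
    using triangular_decomposition by blast
  have "r \<mu> \<nu> + r \<nu> \<mu> = pairing r (B (h + p + q)) (B (h' + p' + q')) + pairing r (B (h' + p' + q')) (B (h + p + q))"
    using pairing_coord[OF \<mu> \<nu>, of r] pairing_coord[OF \<nu> \<mu>, of r]
    by (simp add: coord_form[OF \<mu>] coord_form[OF \<nu>] x(1) y(1))
  also have "\<dots> = B (h + p + q) (h' + p' + q')"
    unfolding pairing_r[OF x(2-4) y(2-4)] pairing_r[OF y(2-4) x(2-4)]
    using x(2-4) y(2-4) form_sym[of h' h] form_sym[of q' p]
    by (simp add: form_simps form_H_N form_H_N' form_N_H form_N'_H form_N_N form_N'_N')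
  also have "\<dots> = form_tensor B \<mu> \<nu>"
    using form_tensor_eq[OF \<mu>, of \<nu>] form_sym[of "dual_vector B \<nu>" "dual_vector B \<mu>"]
    by (simp add: form_dual_vector[OF \<nu>, symmetric] x(1) y(1))
  finally show ?thesis .
qed

text \<open>If the dual vector of \<mu> is h + p + q, the row of r at \<mu> is h/2 + q and the
  column is h/2 + p. The minus sign in front of the row makes the Cartan parts - h/2 and h/2
  opposite, as \<open>manin_m\<close> demands.\<close>

lemma r_manin_m:
  assumes \<mu>: "\<mu> \<in> lie_basis"
  shows "(- (\<Sum>\<nu>\<in>lie_basis. r \<mu> \<nu> *\<^sub>C \<nu>), \<Sum>\<nu>\<in>lie_basis. r \<nu> \<mu> *\<^sub>C \<nu>) \<in> manin_m H R"
proof -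
  obtain h p q where x: "dual_vector B \<mu> = h + p + q" "h \<in> H" "p \<in> N" "q \<in> N'"
    using triangular_decomposition by blast
  have row: "B (\<Sum>\<nu>\<in>lie_basis. r \<mu> \<nu> *\<^sub>C \<nu>) y = pairing r (coord \<mu>) (B y)" for y
  proof -
    have "pairing r (coord \<mu>) (B y) = (\<Sum>\<alpha>\<in>lie_basis. if \<alpha> = \<mu> then \<Sum>\<nu>\<in>lie_basis. r \<mu> \<nu> * B y \<nu> else 0)"
      unfolding pairing_def by (intro sum.cong refl) (simp add: coord_basis)
    then show ?thesis
      using \<mu> by (simp add: finite_lie_basis functional_sum[OF form_functional] form_simps form_sym[of _ y])
  qed
  have col: "B (\<Sum>\<nu>\<in>lie_basis. r \<nu> \<mu> *\<^sub>C \<nu>) y = pairing r (B y) (coord \<mu>)" for y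
  proof -
    have "pairing r (B y) (coord \<mu>) = (\<Sum>\<nu>\<in>lie_basis. r \<nu> \<mu> * B y \<nu>)"
      unfolding pairing_def
      by (intro sum.cong refl) (simp add: coord_basis \<mu> finite_lie_basis if_distrib cong: if_cong)
    then show ?thesis
      by (simp add: functional_sum[OF form_functional] form_simps form_sym[of _ y])
  qed
  have v: "(\<Sum>\<nu>\<in>lie_basis. r \<mu> \<nu> *\<^sub>C \<nu>) = (1/2) *\<^sub>C h + q"
  proof (rule form_eqI)
    fix y
    obtain h' p' q' where y: "y = h' + p' + q'" "h' \<in> H" "p' \<in> N" "q' \<in> N'"
      using triangular_decomposition by blast
    show "B (\<Sum>\<nu>\<in>lie_basis. r \<mu> \<nu> *\<^sub>C \<nu>) y = B ((1/2) *\<^sub>C h + q) y"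
      unfolding row coord_form[OF \<mu>] x(1) y(1) pairing_r[OF x(2-4) y(2-4)]
      using x(2-4) y(2-4) by (simp add: form_simps form_H_N form_H_N' form_N'_H form_N'_N')
  qed
  have w: "(\<Sum>\<nu>\<in>lie_basis. r \<nu> \<mu> *\<^sub>C \<nu>) = (1/2) *\<^sub>C h + p"
  proof (rule form_eqI)
    fix y
    obtain h' p' q' where y: "y = h' + p' + q'" "h' \<in> H" "p' \<in> N" "q' \<in> N'"
      using triangular_decomposition by blast
    show "B (\<Sum>\<nu>\<in>lie_basis. r \<nu> \<mu> *\<^sub>C \<nu>) y = B ((1/2) *\<^sub>C h + p) y"
      unfolding col coord_form[OF \<mu>] x(1) y(1) pairing_r[OF y(2-4) x(2-4)]
      using x(2-4) y(2-4) form_sym[of h' h] form_sym[of q' p]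
      by (simp add: form_simps form_H_N form_H_N' form_N_H form_N_N)
  qed
  have "- ((1/2) *\<^sub>C h + q) = - ((1/2) *\<^sub>C h) + - q" "(1/2) *\<^sub>C h + p = - (- ((1/2) *\<^sub>C h)) + p" by simp_all
  then show ?thesis
    unfolding v w manin_m_iff
    using x(2-4) cvs.subspace_neg[OF H_subspace cvs.subspace_scale[OF H_subspace]] cvs.subspace_neg[OF N'_subspace]
    by (intro bexI[of _ "- ((1/2) *\<^sub>C h)"] bexI[of _ p] bexI[of _ "- q"]) simp_all
qed

end

sublocale triangular_tensor \<subseteq> manin_complement B "manin_m H R" r
proof
  show "0 \<in> manin_m H R"
    unfolding manin_m_iff using cvs.subspace_0[OF H_subspace] cvs.subspace_0[OF N_subspace] cvs.subspace_0[OF N'_subspace]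
    by (intro bexI[of _ 0]) (simp_all add: zero_prod_def)
qed (simp_all add: manin_m_add manin_m_scale manin_m_isotropic manin_m_lie r_manin_m r_plus_transpose)

subsection \<open>Conjugacy classes\<close>

text \<open>Maximality holds because a pair z orthogonal to the graph lies in it: testing against
  \<open>(y', inv g y')\<close> gives \<open>B (fst z) y' = B (g (snd z)) y'\<close> for all
  y'.\<close>

lemma (in invariant_nondegenerate) lagrangian_graph:
  assumes g: "g \<in> Aut_form B"
  shows "lagrangian_subalgebra B (graph_subalgebra g)"
proof -
  interpret P: module "scale_pair :: complex \<Rightarrow> 'g \<times> 'g \<Rightarrow> 'g \<times> 'g"
    by standard (simp_all add: scale_pair_def scaleC_add_left scaleC_add_right scaleC_scaleC scaleC_one)
  have e: "endomorphism g" by (rule Aut_form_endomorphism[OF g])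
  have "P.subspace (graph_subalgebra g)"
    by (auto simp: P.subspace_def graph_subalgebra_def zero_prod_def scale_pair_def
        endomorphism_0[OF e] endomorphism_add[OF e] endomorphism_scale[OF e])
  moreover have "L' = graph_subalgebra g" if L': "isotropic_subspace B L'" "graph_subalgebra g \<subseteq> L'" for L'
  proof -
    have "z \<in> graph_subalgebra g" if z: "z \<in> L'" for z
    proof -
      have "B (fst z) y' = B (g (snd z)) y'" for y'
      proof -
        have "(g (inv g y'), inv g y') \<in> L'" using L'(2) by (auto simp: graph_subalgebra_def)
        then have "dform z (g (inv g y'), inv g y') = 0" using L'(1) z by (auto simp: isotropic_subspace_def)
        then show ?thesis
          using Aut_form_form[OF g, of "snd z" "inv g y'"] by (simp add: double_form_def Aut_form_inv_apply[OF g])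
      qed
      then have "fst z = g (snd z)" by (rule form_eqI)
      then show ?thesis by (cases z) (simp add: graph_subalgebra_def)
    qed
    then show ?thesis using L'(2) by blast
  qed
  ultimately show ?thesis
    unfolding lagrangian_subalgebra_def isotropic_subspace_def
    using graph_isotropic[OF g] graph_lie[OF g] by blast
qed

lemma conj_orbit_conjugation:
  assumes "h \<in> Int_group" "m \<in> conj_orbit g"
  shows "conjugation h m \<in> conj_orbit g"
proof -
  obtain k where k: "k \<in> Int_group" "m = conjugation k g" using assms(2) by (auto simp: conj_orbit_def)
  then have "conjugation h m = conjugation (h \<circ> k) g"
    using assms(1) by (simp add: conjugation_comp Int_group_bij)
  then show ?thesis using Int_group_comp[OF assms(1) k(1)] by (auto simp: conj_orbit_def)
qed

lemma conj_orbit_transitive: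
  assumes "m \<in> conj_orbit g" "m' \<in> conj_orbit g"
  shows "\<exists>h\<in>Int_group. conjugation h m = m'"
proof -
  obtain k k' where k: "k \<in> Int_group" "m = conjugation k g" and k': "k' \<in> Int_group" "m' = conjugation k' g"
    using assms by (auto simp: conj_orbit_def)
  have "conjugation (k' \<circ> inv k) m = conjugation (k' \<circ> (inv k \<circ> k)) g"
    using k k' by (simp add: conjugation_comp Int_group_bij Int_group_inv bij_comp)
  also have "inv k \<circ> k = id" using Int_group_bij[OF k(1)] by (simp add: bij_is_inj)
  finally have "conjugation (k' \<circ> inv k) m = m'" by (simp only: comp_id k'(2))
  moreover have "k' \<circ> inv k \<in> Int_group" using k(1) k'(1) by (intro Int_group_comp Int_group_inv)
  ultimately show ?thesis by blast
qed

lemma restrictions_regular: "M \<subseteq> S \<Longrightarrow> restrictions (regular S) M = regular M"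
proof (intro set_eqI iffI)
  fix \<phi> assume "M \<subseteq> S" "\<phi> \<in> restrictions (regular S) M"
  then obtain \<psi> where \<psi>: "\<psi> \<in> regular S" "\<forall>m\<in>M. \<phi> m = \<psi> m" unfolding restrictions_def by blast
  obtain p where "p \<in> poly_functions" "\<forall>m\<in>S. \<psi> m = p m" using \<psi>(1) unfolding regular_iff by blast
  then show "\<phi> \<in> regular M" unfolding regular_iff using \<psi>(2) \<open>M \<subseteq> S\<close> by (intro bexI[of _ p]) auto
next
  fix \<phi> assume "\<phi> \<in> regular M"
  then obtain p where "p \<in> poly_functions" "\<forall>m\<in>M. \<phi> m = p m" unfolding regular_iff by blast
  then show "\<phi> \<in> restrictions (regular S) M"
    unfolding restrictions_def using poly_regular by blast
qed

section \<open>The restricted bracket on a conjugacy class\<close>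

context manin_complement
begin

lemma conjugation_space_Aut: "conjugation_space B \<mm> r (Aut_form B) (X_bracket r)"
  by unfold_locales (auto simp: conjugation_Aut_form Int_group_Aut intro: X_bracket_eq)

lemma orbit_subset: "g \<in> Aut_form B \<Longrightarrow> conj_orbit g \<subseteq> Aut_form B"
  by (auto simp: conj_orbit_def conjugation_Aut_form Int_group_Aut)

text \<open>Each function has two polynomials attached: one representing it on the whole group,
  needed to evaluate \<open>X_bracket\<close>, and one agreeing with it merely on the class. By
  \<open>pbracket_cong\<close> the second pair gives the same value.\<close>

lemma X_bracket_orbit:
  assumes g: "g \<in> Aut_form B"
    and \<phi>: "\<phi> \<in> regular (Aut_form B)" and \<psi>: "\<psi> \<in> regular (Aut_form B)"
    and p: "p \<in> poly_functions" "\<And>m. m \<in> conj_orbit g \<Longrightarrow> \<phi> m = p m"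
    and q: "q \<in> poly_functions" "\<And>m. m \<in> conj_orbit g \<Longrightarrow> \<psi> m = q m"
    and m: "m \<in> conj_orbit g"
  shows "X_bracket r \<phi> \<psi> m = pbracket p q m"
proof -
  obtain p' where p': "p' \<in> poly_functions" "\<And>m. m \<in> Aut_form B \<Longrightarrow> \<phi> m = p' m"
    using \<phi> unfolding regular_iff by blast
  obtain q' where q': "q' \<in> poly_functions" "\<And>m. m \<in> Aut_form B \<Longrightarrow> \<psi> m = q' m"
    using \<psi> unfolding regular_iff by blast
  note sub = subsetD[OF orbit_subset[OF g]]
  have "X_bracket r \<phi> \<psi> m = pbracket p' q' m"
    using sub[OF m] by (intro X_bracket_eq p' q') auto
  also have "\<dots> = pbracket p q m"
    using p p' q q' sub m by (intro pbracket_cong[of _ _ _ _ "conj_orbit g"]) (auto simp: conj_orbit_conjugation)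
  finally show ?thesis .
qed

lemma bracket_restricts_orbit:
  assumes g: "g \<in> Aut_form B"
  shows "bracket_restricts (regular (Aut_form B)) (X_bracket r) (conj_orbit g)"
  unfolding bracket_restricts_def
proof (intro ballI impI; elim conjE)
  fix \<phi> \<phi>' \<psi> \<psi>' m
  assume mem: "\<phi> \<in> regular (Aut_form B)" "\<phi>' \<in> regular (Aut_form B)" "\<psi> \<in> regular (Aut_form B)"
      "\<psi>' \<in> regular (Aut_form B)"
    and eq: "\<forall>m\<in>conj_orbit g. \<phi> m = \<phi>' m" "\<forall>m\<in>conj_orbit g. \<psi> m = \<psi>' m" and m: "m \<in> conj_orbit g"
  obtain p where p: "p \<in> poly_functions" "\<And>m. m \<in> Aut_form B \<Longrightarrow> \<phi> m = p m"
    using mem(1) unfolding regular_iff by blast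
  obtain q where q: "q \<in> poly_functions" "\<And>m. m \<in> Aut_form B \<Longrightarrow> \<psi> m = q m"
    using mem(3) unfolding regular_iff by blast
  note sub = subsetD[OF orbit_subset[OF g]]
  have "X_bracket r \<phi> \<psi> m = pbracket p q m"
    using p q sub by (intro X_bracket_orbit[OF g mem(1,3) _ _ _ _ m]) auto
  moreover have "X_bracket r \<phi>' \<psi>' m = pbracket p q m"
    using p q sub eq by (intro X_bracket_orbit[OF g mem(2,4) _ _ _ _ m]) auto
  ultimately show "X_bracket r \<phi> \<psi> m = X_bracket r \<phi>' \<psi>' m" by simp
qed

text \<open>\<open>restricted_bracket\<close> works with unspecified extensions. A polynomial
  representative shows that one exists, and by \<open>X_bracket_orbit\<close> the choice does not
  influence the value on the class.\<close>

lemma conjugation_space_orbit: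
  assumes g: "g \<in> Aut_form B"
  shows "conjugation_space B \<mm> r (conj_orbit g)
    (restricted_bracket (regular (Aut_form B)) (X_bracket r) (conj_orbit g))"
proof unfold_locales
  fix m :: "'g \<Rightarrow> 'g" assume "m \<in> conj_orbit g"
  then show "m \<in> Aut_form B" using orbit_subset[OF g] by blast
next
  fix h m :: "'g \<Rightarrow> 'g" assume "h \<in> Int_group" "m \<in> conj_orbit g"
  then show "conjugation h m \<in> conj_orbit g" by (rule conj_orbit_conjugation)
next
  fix p q :: "('g \<Rightarrow> 'g) \<Rightarrow> complex" and \<phi> \<psi> m
  assume p: "p \<in> poly_functions" and q: "q \<in> poly_functions"
    and \<phi>: "\<And>m. m \<in> conj_orbit g \<Longrightarrow> \<phi> m = p m" and \<psi>: "\<And>m. m \<in> conj_orbit g \<Longrightarrow> \<psi> m = q m"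
    and m: "m \<in> conj_orbit g"
  define \<phi>' where "\<phi>' = (SOME \<phi>'. \<phi>' \<in> regular (Aut_form B) \<and> (\<forall>m\<in>conj_orbit g. \<phi>' m = \<phi> m))"
  define \<psi>' where "\<psi>' = (SOME \<psi>'. \<psi>' \<in> regular (Aut_form B) \<and> (\<forall>m\<in>conj_orbit g. \<psi>' m = \<psi> m))"
  have \<phi>': "\<phi>' \<in> regular (Aut_form B) \<and> (\<forall>m\<in>conj_orbit g. \<phi>' m = \<phi> m)"
    unfolding \<phi>'_def by (rule someI[of _ p]) (simp add: poly_regular p \<phi>)
  have \<psi>': "\<psi>' \<in> regular (Aut_form B) \<and> (\<forall>m\<in>conj_orbit g. \<psi>' m = \<psi> m)"
    unfolding \<psi>'_def by (rule someI[of _ q]) (simp add: poly_regular q \<psi>)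
  show "restricted_bracket (regular (Aut_form B)) (X_bracket r) (conj_orbit g) \<phi> \<psi> m = pbracket p q m"
    unfolding restricted_bracket_def \<phi>'_def[symmetric] \<psi>'_def[symmetric]
    using \<phi>' \<psi>' \<phi> \<psi> by (intro X_bracket_orbit[OF g _ _ p _ q _ m]) auto
qed

end

theorem theorem4p1:
  fixes B :: "'g::complex_lie_algebra \<Rightarrow> 'g \<Rightarrow> complex"
    and H :: "'g set" and R :: "('g \<Rightarrow> complex) set"
    and t0 t1 t2 r :: "'g tensor"
  assumes "semisimple TYPE('g)"
    and "invariant_form B" and "nondegenerate_form B"
    and "\<exists>K. compact_real_form K \<and> positive_definite_on K B"
    and "cartan_subalgebra H" and "positive_roots H R"
    and "t0 \<in> tensor_space H H"
    and "t1 \<in> tensor_space (n_plus H R) (n_minus H R)"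
    and "t2 \<in> tensor_space (n_minus H R) (n_plus H R)"
    and "form_tensor B = (\<lambda>\<mu> \<nu>. t0 \<mu> \<nu> + t1 \<mu> \<nu> + t2 \<mu> \<nu>)"
    and "r = (\<lambda>\<mu> \<nu>. t0 \<mu> \<nu> / 2 + t1 \<mu> \<nu>)"
  shows "poisson_bracket (Aut_form B) (regular (Aut_form B)) (X_bracket r)
    \<and> poisson_action r (Aut_form B) (regular (Aut_form B)) (X_bracket r) conjugation
    \<and> (\<forall>g\<in>Aut_form B.
         bracket_restricts (regular (Aut_form B)) (X_bracket r) (conj_orbit g) \<and>
         poisson_homogeneous_space r (conj_orbit g)
           (restrictions (regular (Aut_form B)) (conj_orbit g))
           (restricted_bracket (regular (Aut_form B)) (X_bracket r) (conj_orbit g))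
           conjugation \<and>
         lagrangian_subalgebra B (graph_subalgebra g) \<and>
         drinfeld_subalgebra B H R
           (restrictions (regular (Aut_form B)) (conj_orbit g))
           (restricted_bracket (regular (Aut_form B)) (X_bracket r) (conj_orbit g))
           conjugation g = graph_subalgebra g)"
proof -
  interpret triangular_tensor B H R t0 t1 t2 r
    by unfold_locales (use assms semisimple_centerless in blast)+
  interpret X: conjugation_space B "manin_m H R" r "Aut_form B" "X_bracket r"
    by (rule conjugation_space_Aut)
  have "bracket_restricts (regular (Aut_form B)) (X_bracket r) (conj_orbit g) \<and>
      poisson_homogeneous_space r (conj_orbit g)
        (restrictions (regular (Aut_form B)) (conj_orbit g))
        (restricted_bracket (regular (Aut_form B)) (X_bracket r) (conj_orbit g)) conjugation \<and>
      lagrangian_subalgebra B (graph_subalgebra g) \<and>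
      drinfeld_subalgebra B H R (restrictions (regular (Aut_form B)) (conj_orbit g))
        (restricted_bracket (regular (Aut_form B)) (X_bracket r) (conj_orbit g)) conjugation g =
      graph_subalgebra g" if g: "g \<in> Aut_form B" for g
  proof -
    interpret O: conjugation_space B "manin_m H R" r "conj_orbit g"
      "restricted_bracket (regular (Aut_form B)) (X_bracket r) (conj_orbit g)"
      by (rule conjugation_space_orbit[OF g])
    have g_orbit: "g \<in> conj_orbit g"
      unfolding conj_orbit_def using Exp_Int_group[of 0] conjugation_id[of g] by force
    have "poisson_homogeneous_space r (conj_orbit g) (regular (conj_orbit g))
        (restricted_bracket (regular (Aut_form B)) (X_bracket r) (conj_orbit g)) conjugation"
      using g_orbit by (intro O.poisson_homogeneous_space_P conj_orbit_transitive) auto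
    then show ?thesis
      using bracket_restricts_orbit[OF g] lagrangian_graph[OF g] O.drinfeld_graph[OF g_orbit]
      by (simp add: drinfeld_subalgebra_def restrictions_regular[OF orbit_subset[OF g]])
  qed
  then show ?thesis using X.poisson_bracket_P X.poisson_action_P by blast
qed

end
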